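(* Let $P$ be a (non)holonomic Poisson submanifold of the Poisson manifold $(M,\pi)$. Then the Lie algebroid $(T^*M,\sharp_\pi,\{\,,\,\}_\pi)$ induces a Lie algebroid structure on $P^*=T^*M/(\mathrm{ann}\,P)$. Furthermore, if we put anchor and bracket zero on $\mathrm{ann}\,P$, the sequence $$0\rightarrow \mathrm{ann}\,P\stackrel{\iota}{\rightarrow} T^*M \stackrel{p}{\rightarrow}T^*M/(\mathrm{ann}\,P)\rightarrow0,$$ where $\iota$ is the inclusion and $p$ is the natural projection, is an exact sequence of Lie algebroids over $M$.
   Context: All manifolds and objects are $C^\infty$. For a bivector field $\pi$, $\sharp_\pi\alpha=i(\alpha)\pi$, i.e. $\beta(\sharp_\pi\alpha)=\pi(\alpha,\beta)$. $\pi$ is Poisson if the Schouten-Nijenhuis bracket $[\pi,\pi]$ vanishes. The Poisson bracket of $1$-forms is $\{\alpha,\beta\}_\pi=L_{\sharp_\pi\alpha}\beta-L_{\sharp_\pi\beta}\alpha-d(\pi(\alpha,\beta))$; for $\pi$ Poisson, $(T^*M,\sharp_\pi,\{\,,\,\}_\pi)$ is a Lie algebroid. A (non)holonomic submanifold of $M$ is a vector subbundle $P\subseteq TM$ (not necessarily involutive). $P$ is a (non)holonomic Poisson submanifold of $(M,\pi)$ if: 1) $\mathrm{im}(\sharp_\pi:T^*M\rightarrow TM)\subseteq P$; 2) $[\sharp_\pi\alpha,X]\in P$ for every $\alpha\in\Omega^1(M)$ and every vector field $X\in P$. $\mathrm{ann}\,P\subseteq T^*M$ is the annihilator of $P$.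 The induced structure on $T^*M/(\mathrm{ann}\,P)$ has anchor induced by $\sharp_\pi$ on classes and bracket $\{[\alpha],[\beta]\}_\pi=[\{\alpha,\beta\}_\pi]$, where $[\cdot]$ denotes the class modulo $\mathrm{ann}\,P$. *)

theory Defs
  imports "HOL-Analysis.Analysis"
begin

section \<open>Smooth manifolds\<close>

primrec Ck_on :: "nat \<Rightarrow> 'a::real_normed_vector set \<Rightarrow> ('a \<Rightarrow> 'b::real_normed_vector) \<Rightarrow> bool" where
  "Ck_on 0 S f \<longleftrightarrow> continuous_on S f"
| "Ck_on (Suc k) S f \<longleftrightarrow> (\<forall>x\<in>S. f differentiable (at x)) \<and>
     (\<forall>v. Ck_on k S (\<lambda>x. frechet_derivative f (at x) v))"

definition C_inf_on :: "'a::real_normed_vector set \<Rightarrow> ('a \<Rightarrow> 'b::real_normed_vector) \<Rightarrow> bool" where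
  "C_inf_on S f \<longleftrightarrow> (\<forall>k. Ck_on k S f)"

text \<open>A chart is a pair of its domain and its coordinate map; the map is irrelevant outside the domain.
  The manifold is the whole (Hausdorff, second countable) type \<open>'m\<close>, its dimension is
  \<open>DIM('e)\<close>, and its smooth structure is given by an atlas, which need not be maximal.\<close>

type_synonym ('m, 'e) chart = "'m set \<times> ('m \<Rightarrow> 'e)"

definition is_chart :: "('m::topological_space, 'e::euclidean_space) chart \<Rightarrow> bool" where
  "is_chart = (\<lambda>(U, \<phi>). open U \<and> open (\<phi> ` U) \<and> homeomorphism U (\<phi> ` U) \<phi> (inv_into U \<phi>))"

definition smooth_manifold ::
    "('m::{t2_space,second_countable_topology}, 'e::euclidean_space) chart set \<Rightarrow> bool" where
  "smooth_manifold A \<longleftrightarrow>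
     (\<forall>\<kappa>\<in>A. is_chart \<kappa>) \<and> (\<Union>(U, \<phi>)\<in>A. U) = UNIV \<and>
     (\<forall>(U, \<phi>)\<in>A. \<forall>(V, \<psi>)\<in>A. C_inf_on (\<phi> ` (U \<inter> V)) (\<psi> \<circ> inv_into U \<phi>))"

text \<open>Smoothness on an open set \<open>W\<close>.\<close>

definition smooth_on :: "('m::topological_space, 'e::euclidean_space) chart set \<Rightarrow> 'm set \<Rightarrow> ('m \<Rightarrow> real) \<Rightarrow> bool" where
  "smooth_on A W f \<longleftrightarrow> (\<forall>(U, \<phi>)\<in>A. C_inf_on (\<phi> ` (U \<inter> W)) (f \<circ> inv_into U \<phi>))"

definition smooth_funs :: "('m::topological_space, 'e::euclidean_space) chart set \<Rightarrow> ('m \<Rightarrow> real) set" where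
  "smooth_funs A = {f. smooth_on A UNIV f}"

definition smooth_at :: "('m::topological_space, 'e::euclidean_space) chart set \<Rightarrow> 'm \<Rightarrow> ('m \<Rightarrow> real) \<Rightarrow> bool" where
  "smooth_at A p f \<longleftrightarrow> (\<exists>W. open W \<and> p \<in> W \<and> smooth_on A W f)"


section \<open>Tangent and cotangent vectors\<close>

text \<open>A tangent vector at \<open>p\<close> is a derivation of the algebra of germs at \<open>p\<close> of smooth functions.
  It is represented as a function on representatives of germs. Tangent vectors and covectors are
  set to \<open>0\<close> outside their proper domains, so that equality of them is equality of functions.\<close>

type_synonym 'm tvec = "('m \<Rightarrow> real) \<Rightarrow> real"
type_synonym 'm covec = "'m tvec \<Rightarrow> real"

definition tangent_space :: "('m::topological_space, 'e::euclidean_space) chart set \<Rightarrow> 'm \<Rightarrow> 'm tvec set" where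
  "tangent_space A p = {v.
     (\<forall>f g. smooth_at A p f \<longrightarrow> smooth_at A p g \<longrightarrow>
        v (\<lambda>x. f x + g x) = v f + v g \<and>
        v (\<lambda>x. f x * g x) = v f * g p + f p * v g) \<and>
     (\<forall>f c. smooth_at A p f \<longrightarrow> v (\<lambda>x. c * f x) = c * v f) \<and>
     (\<forall>f g. smooth_at A p f \<longrightarrow> smooth_at A p g \<longrightarrow> (\<forall>\<^sub>F x in nhds p. f x = g x) \<longrightarrow> v f = v g) \<and>
     (\<forall>f. \<not> smooth_at A p f \<longrightarrow> v f = 0)}"

definition cotangent_space :: "('m::topological_space, 'e::euclidean_space) chart set \<Rightarrow> 'm \<Rightarrow> 'm covec set" where
  "cotangent_space A p = {\<alpha>.
     (\<forall>u\<in>tangent_space A p. \<forall>v\<in>tangent_space A p. \<alpha> (\<lambda>f. u f + v f) = \<alpha> u + \<alpha> v) \<and>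
     (\<forall>v\<in>tangent_space A p. \<forall>c. \<alpha> (\<lambda>f. c * v f) = c * \<alpha> v) \<and>
     (\<forall>v. v \<notin> tangent_space A p \<longrightarrow> \<alpha> v = 0)}"

text \<open>An enumeration of the standard basis, for indices below \<open>DIM('e)\<close>.\<close>

definition basis_vec :: "nat \<Rightarrow> 'e::euclidean_space" where
  "basis_vec i = from_nat_into Basis i"

definition coord_fun :: "('m, 'e::euclidean_space) chart \<Rightarrow> nat \<Rightarrow> 'm \<Rightarrow> real" where
  "coord_fun \<kappa> i = (\<lambda>q. snd \<kappa> q \<bullet> basis_vec i)"

definition coord_vec :: "('m::topological_space, 'e::euclidean_space) chart set \<Rightarrow> ('m, 'e) chart \<Rightarrow> nat \<Rightarrow> 'm \<Rightarrow> 'm tvec" where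
  "coord_vec A \<kappa> i q f = (case \<kappa> of (U, \<phi>) \<Rightarrow>
     if smooth_at A q f then frechet_derivative (f \<circ> inv_into U \<phi>) (at (\<phi> q)) (basis_vec i) else 0)"

definition differential :: "('m::topological_space, 'e::euclidean_space) chart set \<Rightarrow> ('m \<Rightarrow> real) \<Rightarrow> 'm \<Rightarrow> 'm covec" where
  "differential A f p v = (if v \<in> tangent_space A p then v f else 0)"


section \<open>Vector bundles\<close>

text \<open>A vector bundle over \<open>'m\<close> is given by its fibres (as subsets of a type \<open>'v\<close>), their
  linear operations and an atlas of local trivializations \<open>(U, k, \<Phi>)\<close>, where \<open>\<Phi> q\<close> maps the fibre
  over \<open>q \<in> U\<close> isomorphically onto \<open>\<real>\<^sup>k\<close>. Elements of \<open>\<real>\<^sup>k\<close> are the sequences that vanish from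
  index \<open>k\<close> on.\<close>

definition Rk :: "nat \<Rightarrow> (nat \<Rightarrow> real) set" where
  "Rk k = {c. \<forall>i\<ge>k. c i = 0}"

type_synonym ('m, 'v) triv = "'m set \<times> nat \<times> ('m \<Rightarrow> 'v \<Rightarrow> nat \<Rightarrow> real)"

record ('m, 'v) vbundle =
  fibre :: "'m \<Rightarrow> 'v set"
  vadd :: "'m \<Rightarrow> 'v \<Rightarrow> 'v \<Rightarrow> 'v"
  vsmul :: "'m \<Rightarrow> real \<Rightarrow> 'v \<Rightarrow> 'v"
  vzero :: "'m \<Rightarrow> 'v"
  trivs :: "('m, 'v) triv set"

text \<open>The vector space axioms for the fibres follow from the linear bijections with \<open>\<real>\<^sup>k\<close>.\<close>

definition local_triv :: "('m::topological_space, 'v) vbundle \<Rightarrow> ('m, 'v) triv \<Rightarrow> bool" where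
  "local_triv E = (\<lambda>(U, k, \<Phi>). open U \<and>
     (\<forall>q\<in>U. bij_betw (\<Phi> q) (fibre E q) (Rk k) \<and>
        vzero E q \<in> fibre E q \<and> \<Phi> q (vzero E q) = (\<lambda>i. 0) \<and>
        (\<forall>u\<in>fibre E q. \<forall>v\<in>fibre E q. vadd E q u v \<in> fibre E q \<and>
           \<Phi> q (vadd E q u v) = (\<lambda>i. \<Phi> q u i + \<Phi> q v i)) \<and>
        (\<forall>c. \<forall>v\<in>fibre E q. vsmul E q c v \<in> fibre E q \<and>
           \<Phi> q (vsmul E q c v) = (\<lambda>i. c * \<Phi> q v i))))"

text \<open>The transition maps \<open>U \<inter> V \<rightarrow> Hom(\<real>\<^sup>k, \<real>\<^sup>l)\<close> from the first to the second trivialization are smooth.\<close>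

definition smooth_transition ::
    "('m::topological_space, 'e::euclidean_space) chart set \<Rightarrow> ('m, 'v) vbundle \<Rightarrow> ('m, 'v) triv \<Rightarrow> ('m, 'v) triv \<Rightarrow> bool" where
  "smooth_transition A E = (\<lambda>(U, k, \<Phi>) (V, l, \<Psi>). \<forall>c\<in>Rk k. \<forall>i.
     smooth_on A (U \<inter> V) (\<lambda>q. \<Psi> q (inv_into (fibre E q) (\<Phi> q) c) i))"

definition vector_bundle ::
    "('m::topological_space, 'e::euclidean_space) chart set \<Rightarrow> ('m, 'v) vbundle \<Rightarrow> bool" where
  "vector_bundle A E \<longleftrightarrow>
     (\<forall>t\<in>trivs E. local_triv E t) \<and> (\<Union>(U, k, \<Phi>)\<in>trivs E. U) = UNIV \<and>
     (\<forall>s\<in>trivs E. \<forall>t\<in>trivs E. smooth_transition A E s t)"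

text \<open>The members of the maximal atlas.\<close>

definition smooth_triv ::
    "('m::topological_space, 'e::euclidean_space) chart set \<Rightarrow> ('m, 'v) vbundle \<Rightarrow> ('m, 'v) triv \<Rightarrow> bool" where
  "smooth_triv A E t \<longleftrightarrow> local_triv E t \<and>
     (\<forall>s\<in>trivs E. smooth_transition A E s t \<and> smooth_transition A E t s)"

definition smooth_sections ::
    "('m::topological_space, 'e::euclidean_space) chart set \<Rightarrow> ('m, 'v) vbundle \<Rightarrow> ('m \<Rightarrow> 'v) set" where
  "smooth_sections A E = {s. (\<forall>q. s q \<in> fibre E q) \<and>
     (\<forall>(U, k, \<Phi>)\<in>trivs E. \<forall>i. smooth_on A U (\<lambda>q. \<Phi> q (s q) i))}"

text \<open>Smooth vector bundle homomorphisms over the identity.\<close>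

definition bundle_map ::
    "('m::topological_space, 'e::euclidean_space) chart set \<Rightarrow> ('m, 'v) vbundle \<Rightarrow> ('m, 'w) vbundle \<Rightarrow> ('m \<Rightarrow> 'v \<Rightarrow> 'w) \<Rightarrow> bool" where
  "bundle_map A E F h \<longleftrightarrow>
     (\<forall>q. \<forall>u\<in>fibre E q. h q u \<in> fibre F q \<and>
        (\<forall>v\<in>fibre E q. h q (vadd E q u v) = vadd F q (h q u) (h q v)) \<and>
        (\<forall>c. h q (vsmul E q c u) = vsmul F q c (h q u))) \<and>
     (\<forall>(U, k, \<Phi>)\<in>trivs E. \<forall>(V, l, \<Psi>)\<in>trivs F. \<forall>c\<in>Rk k. \<forall>i.
        smooth_on A (U \<inter> V) (\<lambda>q. \<Psi> q (h q (inv_into (fibre E q) (\<Phi> q) c)) i))"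

text \<open>A family \<open>F\<close> of subsets of the fibres of \<open>E\<close> is a subbundle if it is locally given by
  \<open>\<real>\<^sup>k \<subseteq> \<real>\<^sup>n\<close> in some smooth trivialization of \<open>E\<close>.\<close>

definition adapted_triv ::
    "('m::topological_space, 'e::euclidean_space) chart set \<Rightarrow> ('m, 'v) vbundle \<Rightarrow> ('m \<Rightarrow> 'v set) \<Rightarrow> nat \<Rightarrow> ('m, 'v) triv \<Rightarrow> bool" where
  "adapted_triv A E F k = (\<lambda>(U, n, \<Phi>). smooth_triv A E (U, n, \<Phi>) \<and> k \<le> n \<and> (\<forall>q\<in>U. \<Phi> q ` F q = Rk k))"

definition subbundle ::
    "('m::topological_space, 'e::euclidean_space) chart set \<Rightarrow> ('m, 'v) vbundle \<Rightarrow> ('m \<Rightarrow> 'v set) \<Rightarrow> bool" where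
  "subbundle A E F \<longleftrightarrow> (\<forall>q. F q \<subseteq> fibre E q) \<and>
     (\<forall>p. \<exists>U n \<Phi> k. p \<in> U \<and> adapted_triv A E F k (U, n, \<Phi>))"

definition sub_bundle ::
    "('m::topological_space, 'e::euclidean_space) chart set \<Rightarrow> ('m, 'v) vbundle \<Rightarrow> ('m \<Rightarrow> 'v set) \<Rightarrow> ('m, 'v) vbundle" where
  "sub_bundle A E F = \<lparr>fibre = F, vadd = vadd E, vsmul = vsmul E, vzero = vzero E,
     trivs = {(U, k, \<Phi>) | U k \<Phi>. \<exists>n. adapted_triv A E F k (U, n, \<Phi>)}\<rparr>"

definition coset :: "('m, 'v) vbundle \<Rightarrow> ('m \<Rightarrow> 'v set) \<Rightarrow> 'm \<Rightarrow> 'v \<Rightarrow> 'v set" where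
  "coset E F q u = {vadd E q u w | w. w \<in> F q}"

text \<open>The trivializations of \<open>E / F\<close> are induced from the adapted ones of \<open>E\<close> by \<open>\<real>\<^sup>n / \<real>\<^sup>k \<cong> \<real>\<^sup>n\<^sup>-\<^sup>k\<close>.
  Scalar multiples are formed with \<open>F q\<close> added, so that \<open>0\<close> times a coset is \<open>F q\<close> and not just the zero vector.\<close>

definition quotient_bundle ::
    "('m::topological_space, 'e::euclidean_space) chart set \<Rightarrow> ('m, 'v) vbundle \<Rightarrow> ('m \<Rightarrow> 'v set) \<Rightarrow> ('m, 'v set) vbundle" where
  "quotient_bundle A E F = \<lparr>
     fibre = (\<lambda>q. coset E F q ` fibre E q),
     vadd = (\<lambda>q C D. {vadd E q u v | u v. u \<in> C \<and> v \<in> D}),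
     vsmul = (\<lambda>q c C. {vadd E q (vsmul E q c u) w | u w. u \<in> C \<and> w \<in> F q}),
     vzero = F,
     trivs = {(U, n - k, \<lambda>q C i. \<Phi> q (SOME u. u \<in> C) (i + k)) | U n \<Phi> k. adapted_triv A E F k (U, n, \<Phi>)}\<rparr>"

definition TM :: "('m::topological_space, 'e::euclidean_space) chart set \<Rightarrow> ('m, 'm tvec) vbundle" where
  "TM A = \<lparr>fibre = tangent_space A,
     vadd = (\<lambda>q u v f. u f + v f), vsmul = (\<lambda>q c v f. c * v f), vzero = (\<lambda>q f. 0),
     trivs = {(fst \<kappa>, DIM('e), \<lambda>q v i. if i < DIM('e) then v (coord_fun \<kappa> i) else 0) | \<kappa>. \<kappa> \<in> A}\<rparr>"

definition cotM :: "('m::topological_space, 'e::euclidean_space) chart set \<Rightarrow> ('m, 'm covec) vbundle" where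
  "cotM A = \<lparr>fibre = cotangent_space A,
     vadd = (\<lambda>q \<alpha> \<beta> v. \<alpha> v + \<beta> v), vsmul = (\<lambda>q c \<alpha> v. c * \<alpha> v), vzero = (\<lambda>q v. 0),
     trivs = {(fst \<kappa>, DIM('e), \<lambda>q \<alpha> i. if i < DIM('e) then \<alpha> (coord_vec A \<kappa> i q) else 0) | \<kappa>. \<kappa> \<in> A}\<rparr>"

abbreviation vector_fields :: "('m::topological_space, 'e::euclidean_space) chart set \<Rightarrow> ('m \<Rightarrow> 'm tvec) set" where
  "vector_fields A \<equiv> smooth_sections A (TM A)"

abbreviation one_forms :: "('m::topological_space, 'e::euclidean_space) chart set \<Rightarrow> ('m \<Rightarrow> 'm covec) set" where
  "one_forms A \<equiv> smooth_sections A (cotM A)"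


section \<open>Lie brackets and Lie derivatives\<close>

definition lie_bracket ::
    "('m::topological_space, 'e::euclidean_space) chart set \<Rightarrow> ('m \<Rightarrow> 'm tvec) \<Rightarrow> ('m \<Rightarrow> 'm tvec) \<Rightarrow> 'm \<Rightarrow> 'm tvec" where
  "lie_bracket A X Y p f =
     (if smooth_at A p f then X p (\<lambda>q. Y q f) - Y p (\<lambda>q. X q f) else 0)"

text \<open>The Lie derivative of a 1-form is determined by \<open>(L\<^sub>X\<beta>)(Y) = X(\<beta>(Y)) - \<beta>([X,Y])\<close>.\<close>

definition lie_derivative ::
    "('m::topological_space, 'e::euclidean_space) chart set \<Rightarrow> ('m \<Rightarrow> 'm tvec) \<Rightarrow> ('m \<Rightarrow> 'm covec) \<Rightarrow> 'm \<Rightarrow> 'm covec" where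
  "lie_derivative A X \<beta> p = (THE \<gamma>. \<gamma> \<in> cotangent_space A p \<and>
     (\<forall>Y\<in>vector_fields A. \<gamma> (Y p) = X p (\<lambda>q. \<beta> q (Y q)) - \<beta> p (lie_bracket A X Y p)))"


section \<open>Poisson structures\<close>

text \<open>A bivector field is a smooth family of alternating bilinear forms on the cotangent spaces;
  smoothness means that of the components \<open>\<pi>(dx\<^sub>i, dx\<^sub>j)\<close> in charts.\<close>

definition bivector_field ::
    "('m::topological_space, 'e::euclidean_space) chart set \<Rightarrow> ('m \<Rightarrow> 'm covec \<Rightarrow> 'm covec \<Rightarrow> real) \<Rightarrow> bool" where
  "bivector_field A \<pi> \<longleftrightarrow>
     (\<forall>p. \<forall>\<alpha>\<in>cotangent_space A p. \<pi> p \<alpha> \<alpha> = 0 \<and>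
        (\<forall>\<beta>\<in>cotangent_space A p. \<forall>\<gamma>\<in>cotangent_space A p. \<forall>c.
           \<pi> p (\<lambda>v. \<alpha> v + \<beta> v) \<gamma> = \<pi> p \<alpha> \<gamma> + \<pi> p \<beta> \<gamma> \<and>
           \<pi> p \<gamma> (\<lambda>v. \<alpha> v + \<beta> v) = \<pi> p \<gamma> \<alpha> + \<pi> p \<gamma> \<beta> \<and>
           \<pi> p (\<lambda>v. c * \<alpha> v) \<beta> = c * \<pi> p \<alpha> \<beta> \<and>
           \<pi> p \<beta> (\<lambda>v. c * \<alpha> v) = c * \<pi> p \<beta> \<alpha>)) \<and>
     (\<forall>\<kappa>\<in>A. \<forall>i<DIM('e). \<forall>j<DIM('e). smooth_on A (fst \<kappa>)
        (\<lambda>q. \<pi> q (differential A (coord_fun \<kappa> i) q) (differential A (coord_fun \<kappa> j) q)))"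

definition sharp ::
    "('m::topological_space, 'e::euclidean_space) chart set \<Rightarrow> ('m \<Rightarrow> 'm covec \<Rightarrow> 'm covec \<Rightarrow> real) \<Rightarrow> 'm \<Rightarrow> 'm covec \<Rightarrow> 'm tvec" where
  "sharp A \<pi> p \<alpha> = (THE v. v \<in> tangent_space A p \<and> (\<forall>\<beta>\<in>cotangent_space A p. \<beta> v = \<pi> p \<alpha> \<beta>))"

text \<open>The Schouten-Nijenhuis bracket of multivector fields \<open>P\<close>, \<open>Q\<close> of degrees \<open>p\<close>, \<open>q\<close>
  (\<open>p + q \<ge> 1\<close>). A multivector field of degree \<open>p\<close> is identified with the alternating
  multiderivation \<open>[f\<^sub>1, \<dots>, f\<^sub>p] \<mapsto> P(df\<^sub>1, \<dots>, df\<^sub>p)\<close> of the algebra of smooth functions, and then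
  \<open>[P, Q] = P \<circ> Q - (-1)\<^bsup>(p-1)(q-1)\<^esup> Q \<circ> P\<close>, where
  \<open>P \<circ> Q\<close> sums \<open>\<plusminus> P(Q(f\<^sub>\<sigma>\<^sub>1, \<dots>, f\<^sub>\<sigma>\<^sub>q), f\<^sub>\<sigma>\<^sub>q\<^sub>+\<^sub>1, \<dots>)\<close> over all shuffles \<open>\<sigma>\<close>. A shuffle is
  given by the set \<open>S\<close> of the positions of the arguments of the inner multiderivation.\<close>

type_synonym 'm multider = "('m \<Rightarrow> real) list \<Rightarrow> 'm \<Rightarrow> real"

definition shuffle_sign :: "nat \<Rightarrow> nat set \<Rightarrow> real" where
  "shuffle_sign n S = (-1) ^ card {(i, j). i \<in> S \<and> j \<in> {..<n} - S \<and> j < i}"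

definition shuffle_comp :: "nat \<Rightarrow> 'm multider \<Rightarrow> 'm multider \<Rightarrow> 'm multider" where
  "shuffle_comp q P Q fs x =
     (\<Sum>S | S \<subseteq> {..<length fs} \<and> card S = q.
        shuffle_sign (length fs) S * P (Q (nths fs S) # nths fs (- S)) x)"

definition schouten :: "nat \<Rightarrow> nat \<Rightarrow> 'm multider \<Rightarrow> 'm multider \<Rightarrow> 'm multider" where
  "schouten p q P Q fs x =
     shuffle_comp q P Q fs x - (-1) ^ ((p + 1) * (q + 1)) * shuffle_comp p Q P fs x"

definition bivector_multider ::
    "('m::topological_space, 'e::euclidean_space) chart set \<Rightarrow> ('m \<Rightarrow> 'm covec \<Rightarrow> 'm covec \<Rightarrow> real) \<Rightarrow> 'm multider" where
  "bivector_multider A \<pi> fs x = \<pi> x (differential A (fs ! 0) x) (differential A (fs ! 1) x)"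

definition poisson ::
    "('m::topological_space, 'e::euclidean_space) chart set \<Rightarrow> ('m \<Rightarrow> 'm covec \<Rightarrow> 'm covec \<Rightarrow> real) \<Rightarrow> bool" where
  "poisson A \<pi> \<longleftrightarrow> bivector_field A \<pi> \<and>
     (\<forall>fs. length fs = 3 \<longrightarrow> set fs \<subseteq> smooth_funs A \<longrightarrow>
        (\<forall>x. schouten 2 2 (bivector_multider A \<pi>) (bivector_multider A \<pi>) fs x = 0))"

definition form_bracket ::
    "('m::topological_space, 'e::euclidean_space) chart set \<Rightarrow> ('m \<Rightarrow> 'm covec \<Rightarrow> 'm covec \<Rightarrow> real) \<Rightarrow>
     ('m \<Rightarrow> 'm covec) \<Rightarrow> ('m \<Rightarrow> 'm covec) \<Rightarrow> 'm \<Rightarrow> 'm covec" where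
  "form_bracket A \<pi> \<alpha> \<beta> p v =
     lie_derivative A (\<lambda>q. sharp A \<pi> q (\<alpha> q)) \<beta> p v
     - lie_derivative A (\<lambda>q. sharp A \<pi> q (\<beta> q)) \<alpha> p v
     - differential A (\<lambda>q. \<pi> q (\<alpha> q) (\<beta> q)) p v"

definition nonholonomic_submanifold ::
    "('m::topological_space, 'e::euclidean_space) chart set \<Rightarrow> ('m \<Rightarrow> 'm tvec set) \<Rightarrow> bool" where
  "nonholonomic_submanifold A P \<longleftrightarrow> subbundle A (TM A) P"

definition nonholonomic_poisson_submanifold ::
    "('m::topological_space, 'e::euclidean_space) chart set \<Rightarrow> ('m \<Rightarrow> 'm covec \<Rightarrow> 'm covec \<Rightarrow> real) \<Rightarrow> ('m \<Rightarrow> 'm tvec set) \<Rightarrow> bool" where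
  "nonholonomic_poisson_submanifold A \<pi> P \<longleftrightarrow>
     nonholonomic_submanifold A P \<and>
     (\<forall>p. sharp A \<pi> p ` cotangent_space A p \<subseteq> P p) \<and>
     (\<forall>\<alpha>\<in>one_forms A. \<forall>X\<in>vector_fields A. (\<forall>p. X p \<in> P p) \<longrightarrow>
        (\<forall>p. lie_bracket A (\<lambda>q. sharp A \<pi> q (\<alpha> q)) X p \<in> P p))"

definition annihilator ::
    "('m::topological_space, 'e::euclidean_space) chart set \<Rightarrow> ('m \<Rightarrow> 'm tvec set) \<Rightarrow> 'm \<Rightarrow> 'm covec set" where
  "annihilator A P p = {\<alpha> \<in> cotangent_space A p. \<forall>v\<in>P p. \<alpha> v = 0}"


section \<open>Lie algebroids\<close>

type_synonym ('m, 'v) anchor = "'m \<Rightarrow> 'v \<Rightarrow> 'm tvec"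
type_synonym ('m, 'v) bracket = "('m \<Rightarrow> 'v) \<Rightarrow> ('m \<Rightarrow> 'v) \<Rightarrow> 'm \<Rightarrow> 'v"

definition sadd :: "('m, 'v) vbundle \<Rightarrow> ('m \<Rightarrow> 'v) \<Rightarrow> ('m \<Rightarrow> 'v) \<Rightarrow> 'm \<Rightarrow> 'v" where
  "sadd E s t = (\<lambda>q. vadd E q (s q) (t q))"

definition smul :: "('m, 'v) vbundle \<Rightarrow> ('m \<Rightarrow> real) \<Rightarrow> ('m \<Rightarrow> 'v) \<Rightarrow> 'm \<Rightarrow> 'v" where
  "smul E f s = (\<lambda>q. vsmul E q (f q) (s q))"

text \<open>Brackets are only considered on smooth sections. That the anchor preserves brackets is
  a consequence of the other axioms, but is included as in many textbooks. Linearity over the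
  reals in the second argument follows from that in the first one.\<close>

definition lie_algebroid ::
    "('m::topological_space, 'e::euclidean_space) chart set \<Rightarrow> ('m, 'v) vbundle \<Rightarrow> ('m, 'v) anchor \<Rightarrow> ('m, 'v) bracket \<Rightarrow> bool" where
  "lie_algebroid A E \<rho> br \<longleftrightarrow>
     vector_bundle A E \<and> bundle_map A E (TM A) \<rho> \<and>
     (\<forall>s\<in>smooth_sections A E. \<forall>t\<in>smooth_sections A E.
        br s t \<in> smooth_sections A E \<and>
        br s s = vzero E \<and>
        br s t = smul E (\<lambda>q. -1) (br t s) \<and>
        (\<forall>c. br (smul E (\<lambda>q. c) s) t = smul E (\<lambda>q. c) (br s t)) \<and>
        (\<forall>u\<in>smooth_sections A E.
           br (sadd E s u) t = sadd E (br s t) (br u t) \<and>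
           sadd E (br s (br t u)) (sadd E (br t (br u s)) (br u (br s t))) = vzero E) \<and>
        (\<forall>f\<in>smooth_funs A.
           br s (smul E f t) = sadd E (smul E f (br s t)) (smul E (\<lambda>q. \<rho> q (s q) f) t)) \<and>
        (\<lambda>q. \<rho> q (br s t q)) = lie_bracket A (\<lambda>q. \<rho> q (s q)) (\<lambda>q. \<rho> q (t q)))"

text \<open>Morphisms over the identity of the base manifold.\<close>

definition lie_algebroid_morphism ::
    "('m::topological_space, 'e::euclidean_space) chart set \<Rightarrow>
     ('m, 'v) vbundle \<Rightarrow> ('m, 'v) anchor \<Rightarrow> ('m, 'v) bracket \<Rightarrow>
     ('m, 'w) vbundle \<Rightarrow> ('m, 'w) anchor \<Rightarrow> ('m, 'w) bracket \<Rightarrow> ('m \<Rightarrow> 'v \<Rightarrow> 'w) \<Rightarrow> bool" where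
  "lie_algebroid_morphism A E \<rho> br E' \<rho>' br' h \<longleftrightarrow>
     bundle_map A E E' h \<and>
     (\<forall>q. \<forall>u\<in>fibre E q. \<rho>' q (h q u) = \<rho> q u) \<and>
     (\<forall>s\<in>smooth_sections A E. \<forall>t\<in>smooth_sections A E.
        (\<lambda>q. h q (br s t q)) = br' (\<lambda>q. h q (s q)) (\<lambda>q. h q (t q)))"

definition exact_lie_algebroid_sequence ::
    "('m::topological_space, 'e::euclidean_space) chart set \<Rightarrow>
     ('m, 'u) vbundle \<Rightarrow> ('m, 'u) anchor \<Rightarrow> ('m, 'u) bracket \<Rightarrow> ('m \<Rightarrow> 'u \<Rightarrow> 'v) \<Rightarrow>
     ('m, 'v) vbundle \<Rightarrow> ('m, 'v) anchor \<Rightarrow> ('m, 'v) bracket \<Rightarrow> ('m \<Rightarrow> 'v \<Rightarrow> 'w) \<Rightarrow>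
     ('m, 'w) vbundle \<Rightarrow> ('m, 'w) anchor \<Rightarrow> ('m, 'w) bracket \<Rightarrow> bool" where
  "exact_lie_algebroid_sequence A E1 \<rho>1 br1 h E2 \<rho>2 br2 k E3 \<rho>3 br3 \<longleftrightarrow>
     lie_algebroid A E1 \<rho>1 br1 \<and> lie_algebroid A E2 \<rho>2 br2 \<and> lie_algebroid A E3 \<rho>3 br3 \<and>
     lie_algebroid_morphism A E1 \<rho>1 br1 E2 \<rho>2 br2 h \<and>
     lie_algebroid_morphism A E2 \<rho>2 br2 E3 \<rho>3 br3 k \<and>
     (\<forall>q. inj_on (h q) (fibre E1 q) \<and>
          h q ` fibre E1 q = {v \<in> fibre E2 q. k q v = vzero E3 q} \<and>
          k q ` fibre E2 q = fibre E3 q)"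

text \<open>The anchor \<open>\<rho>'\<close> and bracket \<open>br'\<close> on \<open>E / F\<close> are given by representatives.\<close>

definition induced_on_quotient ::
    "('m::topological_space, 'e::euclidean_space) chart set \<Rightarrow>
     ('m, 'v) vbundle \<Rightarrow> ('m, 'v) anchor \<Rightarrow> ('m, 'v) bracket \<Rightarrow> ('m \<Rightarrow> 'v set) \<Rightarrow>
     ('m, 'v set) anchor \<Rightarrow> ('m, 'v set) bracket \<Rightarrow> bool" where
  "induced_on_quotient A E \<rho> br F \<rho>' br' \<longleftrightarrow>
     (\<forall>q. \<forall>u\<in>fibre E q. \<rho>' q (coset E F q u) = \<rho> q u) \<and>
     (\<forall>s\<in>smooth_sections A E. \<forall>t\<in>smooth_sections A E.
        br' (\<lambda>q. coset E F q (s q)) (\<lambda>q. coset E F q (t q)) = (\<lambda>q. coset E F q (br s t q)))"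

end

theory Submission
  imports Defs
begin

text \<open>For one-forms \<open>\<alpha>\<close>, \<open>\<beta>\<close> where \<open>\<beta>\<close> annihilates \<open>P\<close>, both \<open>\<sharp>\<beta>\<close> and \<open>\<pi>(\<alpha>, \<beta>)\<close> vanish since the image of \<open>\<sharp>\<close> lies
  in \<open>P\<close>, and \<open>L\<^bsub>\<sharp>\<alpha>\<^esub> \<beta>\<close> annihilates \<open>P\<close> since \<open>[\<sharp>\<alpha>, X] \<in> P\<close> for \<open>X \<in> P\<close>. So the sections of \<open>ann P\<close> form an
  abelian ideal in the kernel of the anchor, and anchor and bracket descend to the quotient. The bracket of arbitrary
  sections of the quotient is then determined because these lift to one-forms, by a smooth partition of unity.

  The Lie algebroid axioms of the cotangent bundle reduce to exact forms: \<open>\<sharp>{\<alpha>, \<beta>} - [\<sharp>\<alpha>, \<sharp>\<beta>]\<close> and the Jacobiator are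
  linear over the smooth functions in each argument and vanish on differentials by the Jacobi identity
  \<open>{{f, g}, h} + \<dots> = 0\<close>, which is \<open>[\<pi>, \<pi>] = 0\<close> evaluated on \<open>f, g, h\<close>.\<close>

section \<open>Smooth maps between Euclidean spaces\<close>

text \<open>Smoothness of bundles is expressed in local trivializations, but the brackets and the
  fields that determine \<open>lie_derivative\<close> are global. Bump functions bridge this gap:
  germs of functions, tangent vectors and constant coefficient vectors in a trivialization all
  extend to global objects. Hence smoothness of fields and forms can be tested on global functions
  and fields, and no coordinate formula for a bracket is needed. Tensoriality has a second use: it
  shows that the definite description in \<open>lie_derivative\<close> denotes a covector. The order
  of the two reductions to differentials is forced: scaling an argument of the Jacobiator by
  \<open>h\<close> leaves the term \<open>[\<sharp>\<alpha>, \<sharp>\<beta>] h - \<sharp>{\<alpha>,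
  \<beta>} h\<close>, which vanishes because the anchor preserves brackets. A further obstacle is
  the annihilator: a subbundle has to occupy the leading coordinates of a trivialization, whereas in
  the frame dual to one adapted to \<open>P\<close> the annihilator occupies the trailing
  ones.\<close>

lemma frechet_derivativeI: "(f has_derivative f') (at x) \<Longrightarrow> frechet_derivative f (at x) = f'"
  by (rule frechet_derivative_at[symmetric])

section \<open>Calculus rules for maps of finite differentiability class\<close>

lemma frechet_derivative_cong_open:
  assumes "open S" "x \<in> S" "\<And>y. y \<in> S \<Longrightarrow> f y = g y"
  shows "f differentiable at x \<longleftrightarrow> g differentiable at x"
    "frechet_derivative f (at x) = frechet_derivative g (at x)"
proof -
  have *: "(f has_derivative D) (at x) \<longleftrightarrow> (g has_derivative D) (at x)" for D
    using has_derivative_transform_within_open[of f D x UNIV S g]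
      has_derivative_transform_within_open[of g D x UNIV S f] assms by auto
  show "f differentiable at x \<longleftrightarrow> g differentiable at x"
    by (simp add: differentiable_def *)
  show "frechet_derivative f (at x) = frechet_derivative g (at x)"
    by (simp add: frechet_derivative_def *)
qed

text \<open>The derivative \<open>at x\<close> sees a full neighbourhood of \<open>x\<close>, so it
  is the openness of \<open>S\<close> that carries agreement on \<open>S\<close> over to the
  derivatives.\<close>

lemma Ck_on_cong:
  assumes "open S" "\<And>x. x \<in> S \<Longrightarrow> f x = g x" "Ck_on k S f"
  shows "Ck_on k S g"
  using assms(2,3)
proof (induction k arbitrary: f g)
  case 0
  then show ?case using continuous_on_cong[of S S f g] by simp
next
  case (Suc k)
  have d: "g differentiable at x" "frechet_derivative f (at x) = frechet_derivative g (at x)" if "x \<in> S" for x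
    using frechet_derivative_cong_open[OF assms(1) that, of f g] Suc.prems that by auto
  have "Ck_on k S (\<lambda>x. frechet_derivative g (at x) v)" for v
    using Suc.IH[of "\<lambda>x. frechet_derivative f (at x) v" "\<lambda>x. frechet_derivative g (at x) v"] d Suc.prems
    by simp
  with d show ?case by simp
qed

lemma Ck_on_subset: "T \<subseteq> S \<Longrightarrow> Ck_on k S f \<Longrightarrow> Ck_on k T f"
  by (induction k arbitrary: f) (auto intro: continuous_on_subset)

lemma Ck_on_Suc_D: "Ck_on (Suc k) S f \<Longrightarrow> Ck_on k S f"
proof (induction k arbitrary: f)
  case 0
  then show ?case
    by (auto intro!: continuous_at_imp_continuous_on differentiable_imp_continuous_within)
next
  case (Suc k)
  then show ?case by (auto simp del: Ck_on.simps(1))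
qed

lemma Ck_on_local: "(\<And>x. x \<in> S \<Longrightarrow> \<exists>T. open T \<and> x \<in> T \<and> Ck_on k T f) \<Longrightarrow> Ck_on k S f"
proof (induction k arbitrary: f)
  case 0
  show ?case unfolding Ck_on.simps
  proof (rule continuous_at_imp_continuous_on, rule ballI)
    fix x assume "x \<in> S"
    then obtain T where "open T" "x \<in> T" "continuous_on T f" using 0 by auto
    then show "isCont f x" by (simp add: continuous_on_eq_continuous_at)
  qed
next
  case (Suc k)
  have "Ck_on k S (\<lambda>x. frechet_derivative f (at x) v)" for v
    using Suc.prems by (intro Suc.IH) (auto, meson)
  moreover have "f differentiable at x" if "x \<in> S" for x
    using Suc.prems[OF that] by auto
  ultimately show ?case by simp
qed

lemma Ck_on_const: "Ck_on k S (\<lambda>x. c)"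
proof (induction k arbitrary: c)
  case (Suc k)
  then show ?case by simp
qed simp

lemma Ck_on_add:
  assumes "open S"
  shows "Ck_on k S f \<Longrightarrow> Ck_on k S g \<Longrightarrow> Ck_on k S (\<lambda>x. f x + g x)"
proof (induction k arbitrary: f g)
  case (Suc k)
  have d: "((\<lambda>x. f x + g x) has_derivative
      (\<lambda>v. frechet_derivative f (at x) v + frechet_derivative g (at x) v)) (at x)" if "x \<in> S" for x
    using that Suc.prems by (auto intro!: derivative_intros simp: frechet_derivative_works[symmetric])
  have "Ck_on k S (\<lambda>x. frechet_derivative (\<lambda>x. f x + g x) (at x) v)" for v
    by (rule Ck_on_cong[OF assms _ Suc.IH[of "\<lambda>x. frechet_derivative f (at x) v" "\<lambda>x. frechet_derivative g (at x) v"]])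
      (use d Suc.prems in \<open>auto simp: frechet_derivativeI[OF d]\<close>)
  with d show ?case by (auto simp: differentiable_def)
qed (auto intro: continuous_on_add)

lemma Ck_on_sum:
  assumes "open S" "\<And>i. i \<in> I \<Longrightarrow> Ck_on k S (f i)"
  shows "Ck_on k S (\<lambda>x. \<Sum>i\<in>I. f i x)"
  using assms(2)
  by (induction I rule: infinite_finite_induct) (auto intro: Ck_on_const Ck_on_add[OF assms(1)])

lemma Ck_on_bounded_bilinear:
  assumes "open S" "bounded_bilinear B"
  shows "Ck_on k S f \<Longrightarrow> Ck_on k S g \<Longrightarrow> Ck_on k S (\<lambda>x. B (f x) (g x))"
proof (induction k arbitrary: f g)
  case 0
  then show ?case using bounded_bilinear.continuous_on[OF assms(2)] by auto
next
  case (Suc k)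
  have d: "((\<lambda>x. B (f x) (g x)) has_derivative
      (\<lambda>v. B (f x) (frechet_derivative g (at x) v) + B (frechet_derivative f (at x) v) (g x))) (at x)"
    if "x \<in> S" for x
    using that Suc.prems
    by (intro bounded_bilinear.FDERIV[OF assms(2)]) (auto simp: frechet_derivative_works[symmetric])
  have "Ck_on k S (\<lambda>x. frechet_derivative (\<lambda>x. B (f x) (g x)) (at x) v)" for v
    by (rule Ck_on_cong[OF assms(1) _ Ck_on_add[OF assms(1) Suc.IH Suc.IH,
            of f "\<lambda>x. frechet_derivative g (at x) v" "\<lambda>x. frechet_derivative f (at x) v" g]])
      (use d Suc.prems Ck_on_Suc_D in \<open>auto simp: frechet_derivativeI[OF d]\<close>)
  with d show ?case by (auto simp: differentiable_def)
qed

lemma Ck_on_bounded_linear: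
  assumes "bounded_linear h" "open S"
  shows "Ck_on k S f \<Longrightarrow> Ck_on k S (\<lambda>x. h (f x))"
proof (induction k arbitrary: f)
  case 0
  then show ?case using bounded_linear.continuous_on[OF assms(1)] by auto
next
  case (Suc k)
  have d: "((\<lambda>x. h (f x)) has_derivative (\<lambda>v. h (frechet_derivative f (at x) v))) (at x)"
    if "x \<in> S" for x
    using that Suc.prems
    by (intro bounded_linear.has_derivative[OF assms(1)]) (auto simp: frechet_derivative_works[symmetric])
  have "Ck_on k S (\<lambda>x. frechet_derivative (\<lambda>x. h (f x)) (at x) v)" for v
    by (rule Ck_on_cong[OF assms(2) _ Suc.IH[of "\<lambda>x. frechet_derivative f (at x) v"]])
      (use d Suc.prems in \<open>auto simp: frechet_derivativeI[OF d]\<close>)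
  with d show ?case by (auto simp: differentiable_def)
qed

lemma Ck_on_ident: "Ck_on k S (\<lambda>x. x)"
  by (cases k) (auto intro: Ck_on_const simp: frechet_derivativeI[OF has_derivative_ident])

text \<open>The derivative \<open>f'(g x) (g' x v)\<close> is not a composition with a fixed
  direction, so the induction hypothesis does not apply to it directly. Expanding
  \<open>g' x v\<close> in the basis of the Euclidean middle space gives products of coordinates of
  \<open>g' x v\<close> with the compositions \<open>f'(g x) b\<close>, to which it applies.\<close>

lemma Ck_on_compose:
  fixes g :: "'a::real_normed_vector \<Rightarrow> 'b::euclidean_space" and f :: "'b \<Rightarrow> 'c::real_normed_vector"
  assumes "open S" "open T" "g ` S \<subseteq> T"
  shows "Ck_on k T f \<Longrightarrow> Ck_on k S g \<Longrightarrow> Ck_on k S (\<lambda>x. f (g x))"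
proof (induction k arbitrary: f)
  case 0
  then show ?case using continuous_on_compose2[OF _ _ assms(3)] by auto
next
  case (Suc k)
  have f': "(f has_derivative frechet_derivative f (at (g x))) (at (g x))" if "x \<in> S" for x
    using that Suc.prems assms(3) by (auto simp: frechet_derivative_works[symmetric])
  have d: "((\<lambda>x. f (g x)) has_derivative
      (\<lambda>v. frechet_derivative f (at (g x)) (frechet_derivative g (at x) v))) (at x)" if "x \<in> S" for x
    using diff_chain_at[of g "frechet_derivative g (at x)" x f "frechet_derivative f (at (g x))"]
      f'[OF that] that Suc.prems
    by (auto simp: frechet_derivative_works[symmetric] o_def)
  have e: "frechet_derivative (\<lambda>x. f (g x)) (at x) v =
      (\<Sum>b\<in>Basis. (frechet_derivative g (at x) v \<bullet> b) *\<^sub>R frechet_derivative f (at (g x)) b)" if "x \<in> S" for x v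
  proof -
    interpret l: linear "frechet_derivative f (at (g x))"
      using f'[OF that] has_derivative_linear by blast
    have "frechet_derivative f (at (g x)) (frechet_derivative g (at x) v) =
       frechet_derivative f (at (g x)) (\<Sum>b\<in>Basis. (frechet_derivative g (at x) v \<bullet> b) *\<^sub>R b)"
      by (simp add: euclidean_representation)
    then show ?thesis by (simp add: frechet_derivativeI[OF d[OF that]] l.sum l.scale)
  qed
  have "Ck_on k S (\<lambda>x. frechet_derivative (\<lambda>x. f (g x)) (at x) v)" for v
  proof (rule Ck_on_cong[OF assms(1) e[symmetric]])
    show "Ck_on k S (\<lambda>x. \<Sum>b\<in>Basis. (frechet_derivative g (at x) v \<bullet> b) *\<^sub>R frechet_derivative f (at (g x)) b)"
      using Suc.prems Ck_on_Suc_D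
      by (intro Ck_on_sum[OF assms(1)] Ck_on_bounded_bilinear[OF assms(1) bounded_bilinear_scaleR]
          Ck_on_bounded_linear[OF bounded_linear_inner_left assms(1)] Suc.IH) auto
  qed
  with d show ?case by (auto simp: differentiable_def)
qed

text \<open>The derivative \<open>- (inverse x * v * inverse x)\<close> is a polynomial in
  \<open>inverse\<close> itself, so the induction on \<open>k\<close> closes.\<close>

lemma Ck_on_inverse: "Ck_on k (- {0}) (inverse :: real \<Rightarrow> real)"
proof (induction k)
  case 0
  show ?case by (auto intro: continuous_on_inverse continuous_on_id)
next
  case (Suc k)
  have o: "open (- {0::real})" by auto
  have d: "(inverse has_derivative (\<lambda>v. - (inverse x * v * inverse x))) (at x)" if "x \<noteq> 0" for x :: real
    using that by (rule has_derivative_inverse')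
  have "Ck_on k (- {0}) (\<lambda>x. frechet_derivative inverse (at x) v)" for v :: real
    by (rule Ck_on_cong[OF o _ Ck_on_bounded_bilinear[OF o bounded_bilinear_mult
       Ck_on_bounded_bilinear[OF o bounded_bilinear_mult Suc.IH Suc.IH] Ck_on_const, of "- v"]])
      (auto simp: frechet_derivativeI[OF d] simp del: inverse_mult_distrib)
  with d show ?case by (auto simp: differentiable_def)
qed

section \<open>Calculus rules for smooth maps\<close>

lemma C_inf_on_cong: "open S \<Longrightarrow> (\<And>x. x \<in> S \<Longrightarrow> f x = g x) \<Longrightarrow> C_inf_on S f \<Longrightarrow> C_inf_on S g"
  unfolding C_inf_on_def using Ck_on_cong by blast

lemma C_inf_on_subset: "C_inf_on S f \<Longrightarrow> T \<subseteq> S \<Longrightarrow> C_inf_on T f"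
  unfolding C_inf_on_def using Ck_on_subset by blast

lemma C_inf_on_local: "(\<And>x. x \<in> S \<Longrightarrow> \<exists>T. open T \<and> x \<in> T \<and> C_inf_on T f) \<Longrightarrow> C_inf_on S f"
  unfolding C_inf_on_def by (intro allI Ck_on_local) meson

lemma C_inf_on_const: "C_inf_on S (\<lambda>x. c)"
  by (simp add: C_inf_on_def Ck_on_const)

lemma C_inf_on_ident: "C_inf_on S (\<lambda>x. x)"
  by (simp add: C_inf_on_def Ck_on_ident)

lemma C_inf_on_inverse: "C_inf_on (- {0}) (inverse :: real \<Rightarrow> real)"
  by (simp add: C_inf_on_def Ck_on_inverse)

lemma C_inf_on_add: "open S \<Longrightarrow> C_inf_on S f \<Longrightarrow> C_inf_on S g \<Longrightarrow> C_inf_on S (\<lambda>x. f x + g x)"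
  by (simp add: C_inf_on_def Ck_on_add)

lemma C_inf_on_bounded_linear:
  "bounded_linear h \<Longrightarrow> open S \<Longrightarrow> C_inf_on S f \<Longrightarrow> C_inf_on S (\<lambda>x. h (f x))"
  by (simp add: C_inf_on_def Ck_on_bounded_linear)

lemma C_inf_on_mult:
  fixes f g :: "'a::real_normed_vector \<Rightarrow> real"
  shows "open S \<Longrightarrow> C_inf_on S f \<Longrightarrow> C_inf_on S g \<Longrightarrow> C_inf_on S (\<lambda>x. f x * g x)"
  by (simp add: C_inf_on_def Ck_on_bounded_bilinear bounded_bilinear_mult)

lemma C_inf_on_compose:
  fixes g :: "'a::real_normed_vector \<Rightarrow> 'b::euclidean_space" and f :: "'b \<Rightarrow> 'c::real_normed_vector"
  assumes "open S" "open T" "g ` S \<subseteq> T" "C_inf_on T f" "C_inf_on S g"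
  shows "C_inf_on S (\<lambda>x. f (g x))"
  using assms(4,5) Ck_on_compose[OF assms(1-3), of _ f] by (simp add: C_inf_on_def)

lemma C_inf_on_frechet_derivative: "C_inf_on S f \<Longrightarrow> C_inf_on S (\<lambda>x. frechet_derivative f (at x) v)"
  unfolding C_inf_on_def by (metis Ck_on.simps(2))

lemma C_inf_on_has_derivative:
  "C_inf_on S f \<Longrightarrow> x \<in> S \<Longrightarrow> (f has_derivative frechet_derivative f (at x)) (at x)"
  unfolding C_inf_on_def by (metis Ck_on.simps(2) frechet_derivative_works)

lemma C_inf_on_continuous: "C_inf_on S f \<Longrightarrow> continuous_on S f"
  unfolding C_inf_on_def by (metis Ck_on.simps(1))

text \<open>Induction on the order for a whole family at once: the family is closed under
  differentiation up to operations that preserve the class, so each order is inherited from the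
  previous one.\<close>

lemma C_inf_on_coinduct:
  fixes f :: "'i \<Rightarrow> 'a::real_normed_vector \<Rightarrow> 'b::real_normed_vector"
  assumes "open S" "\<And>i x. x \<in> S \<Longrightarrow> f i differentiable at x"
    and der: "\<And>i v k. (\<And>j. Ck_on k S (f j)) \<Longrightarrow> Ck_on k S (\<lambda>x. frechet_derivative (f i) (at x) v)"
  shows "C_inf_on S (f i)"
proof -
  have "Ck_on k S (f j)" for k j
  proof (induction k arbitrary: j)
    case 0
    then show ?case using assms(2)
      by (auto intro!: continuous_at_imp_continuous_on differentiable_imp_continuous_within)
  next
    case (Suc k)
    then show ?case using assms(2) der by auto
  qed
  then show ?thesis by (simp add: C_inf_on_def)
qed

subsection \<open>Smooth step functions\<close>

text \<open>The function of interest is exp(-1/t), extended by 0, which is the case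
  \<open>k = 0\<close>. The negative powers of \<open>t\<close> are included so that derivatives are
  linear combinations of members of the family.\<close>

definition exp_flat :: "nat \<Rightarrow> real \<Rightarrow> real" where
  "exp_flat k t = (if t > 0 then exp (- inverse t) * inverse t ^ k else 0)"

lemma exp_flat_has_derivative:
  "(exp_flat k has_real_derivative (exp_flat (k + 2) t - k * exp_flat (k + 1) t)) (at t)"
proof -
  consider "t > 0" | "t < 0" | "t = 0" by linarith
  then show ?thesis
  proof cases
    case 1
    \<comment> \<open>For \<open>k = 0\<close> the truncated difference \<open>k - 1\<close> is 0 as
      well, but the factor \<open>real k\<close> vanishes.\<close>
    have "inverse t ^ (k - 1) * real k = inverse t ^ k * t * real k"
      using 1 by (cases k) auto
    then have "((\<lambda>t. exp (- inverse t) * inverse t ^ k) has_real_derivative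
        (exp_flat (k + 2) t - k * exp_flat (k + 1) t)) (at t)"
      using 1 by (auto intro!: derivative_eq_intros simp: exp_flat_def power2_eq_square algebra_simps)
    then show ?thesis
      by (rule DERIV_cong_ev[THEN iffD1, rotated 3])
        (use 1 in \<open>auto simp: exp_flat_def eventually_nhds intro!: exI[of _ "{0<..}"]\<close>)
  next
    case 2
    have "((\<lambda>t. 0) has_real_derivative 0) (at t)" by simp
    then have "(exp_flat k has_real_derivative 0) (at t)"
      by (rule DERIV_cong_ev[THEN iffD1, rotated 3])
        (use 2 in \<open>auto simp: exp_flat_def eventually_nhds intro!: exI[of _ "{..<0}"]\<close>)
    then show ?thesis using 2 by (simp add: exp_flat_def)
  next
    case 3
    have "((\<lambda>h. exp_flat k h / h) \<longlongrightarrow> 0) (at_right 0)"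
    proof -
      \<comment> \<open>The right-hand difference quotient at 0 is this function of
        \<open>1 / h\<close>; the extra power comes from the division by \<open>h\<close>.\<close>
      have "((\<lambda>t::real. t ^ (k + 1) / exp t) \<longlongrightarrow> 0) at_top" by (rule tendsto_power_div_exp_0)
      then have "((\<lambda>h::real. inverse h ^ (k + 1) / exp (inverse h)) \<longlongrightarrow> 0) (at_right 0)"
        using filterlim_compose filterlim_inverse_at_top_right by blast
      then show ?thesis
        by (rule Lim_transform_eventually)
          (auto simp: exp_flat_def eventually_at_right_less exp_minus field_simps
             intro: eventually_at_rightI[of 0 1])
    qed
    moreover have "((\<lambda>h. exp_flat k h / h) \<longlongrightarrow> 0) (at_left 0)"
      by (rule Lim_transform_eventually[OF tendsto_const])
        (auto simp: exp_flat_def intro: eventually_at_leftI[of "-1" 0])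
    ultimately have "((\<lambda>h. exp_flat k h / h) \<longlongrightarrow> 0) (at 0)"
      using filterlim_split_at by blast
    then show ?thesis using 3 by (simp add: DERIV_def exp_flat_def)
  qed
qed

lemma C_inf_on_exp_flat: "C_inf_on UNIV (exp_flat k)"
proof (rule C_inf_on_coinduct[of UNIV exp_flat])
  fix k m v
  show "exp_flat k differentiable at x" for x
    using exp_flat_has_derivative has_field_derivative_imp_has_derivative differentiable_def by blast
  assume IH: "Ck_on m UNIV (exp_flat j)" for j
  have "(\<lambda>x. frechet_derivative (exp_flat k) (at x) v) =
     (\<lambda>x. v * exp_flat (k + 2) x + (- (v * k)) * exp_flat (k + 1) x)"
    using frechet_derivativeI[OF has_field_derivative_imp_has_derivative[OF exp_flat_has_derivative]]
    by (auto simp: fun_eq_iff algebra_simps)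
  moreover have "Ck_on m UNIV \<dots>"
    by (intro Ck_on_add Ck_on_bounded_bilinear[OF _ bounded_bilinear_mult] Ck_on_const IH) auto
  ultimately show "Ck_on m UNIV (\<lambda>x. frechet_derivative (exp_flat k) (at x) v)" by simp
qed simp

abbreviation "flat \<equiv> exp_flat 0"

lemma flat_pos_iff: "flat t > 0 \<longleftrightarrow> t > 0" and flat_eq_0_iff: "flat t = 0 \<longleftrightarrow> t \<le> 0" and flat_nonneg: "flat t \<ge> 0"
  by (auto simp: exp_flat_def)

text \<open>The numerator vanishes for \<open>t \<ge> 2\<close>, the second summand of the
  denominator for \<open>t \<le> 1\<close>, which makes the value 0 and 1 there. As
  \<open>2 - t\<close> and \<open>t - 1\<close> are never both nonpositive, the denominator is
  positive.\<close>

definition smooth_step :: "real \<Rightarrow> real" where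
  "smooth_step t = flat (2 - t) * inverse (flat (2 - t) + flat (t - 1))"

lemma smooth_step_denom: "flat (2 - t) + flat (t - 1) \<noteq> 0"
  using flat_pos_iff[of "2 - t"] flat_pos_iff[of "t - 1"] flat_nonneg[of "2 - t"] flat_nonneg[of "t - 1"]
  by linarith

lemma smooth_step_eq_1:
  assumes "t \<le> 1"
  shows "smooth_step t = 1"
proof -
  have "flat (t - 1) = 0" "flat (2 - t) \<noteq> 0" using assms by (simp_all add: flat_eq_0_iff)
  then show ?thesis by (simp add: smooth_step_def)
qed

lemma smooth_step_eq_0: "t \<ge> 2 \<Longrightarrow> smooth_step t = 0"
  by (simp add: smooth_step_def flat_eq_0_iff)

lemma smooth_step_nonneg: "smooth_step t \<ge> 0"
  by (simp add: smooth_step_def flat_nonneg)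

lemma C_inf_on_smooth_step: "C_inf_on UNIV smooth_step"
proof -
  have "C_inf_on UNIV (\<lambda>t::real. - t)"
    using C_inf_on_bounded_linear[OF bounded_linear_minus[OF bounded_linear_ident] open_UNIV C_inf_on_ident] .
  from C_inf_on_add[OF open_UNIV C_inf_on_const[of _ 2] this]
  have "C_inf_on UNIV (\<lambda>t::real. 2 - t)" by simp
  from C_inf_on_compose[OF open_UNIV open_UNIV _ C_inf_on_exp_flat this]
  have 1: "C_inf_on UNIV (\<lambda>t. flat (2 - t))" by simp
  from C_inf_on_add[OF open_UNIV C_inf_on_ident C_inf_on_const[of _ "- 1"]]
  have "C_inf_on UNIV (\<lambda>t::real. t - 1)" by simp
  from C_inf_on_compose[OF open_UNIV open_UNIV _ C_inf_on_exp_flat this]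
  have 2: "C_inf_on UNIV (\<lambda>t. flat (t - 1))" by simp
  have "C_inf_on UNIV (\<lambda>t. inverse (flat (2 - t) + flat (t - 1)))"
    by (rule C_inf_on_compose[OF open_UNIV _ _ C_inf_on_inverse C_inf_on_add[OF open_UNIV 1 2]])
      (auto simp: smooth_step_denom)
  from C_inf_on_mult[OF open_UNIV 1 this] show ?thesis
    by (simp add: smooth_step_def[abs_def])
qed

subsection \<open>Hadamard's lemma\<close>

lemma segment_in_ball:
  fixes a :: "'a::real_normed_vector"
  assumes "y \<in> ball a r" "t \<in> {0..1}"
  shows "a + t *\<^sub>R (y - a) \<in> ball a r"
proof -
  have "dist a (a + t *\<^sub>R (y - a)) = \<bar>t\<bar> * dist a y"
    by (simp add: dist_norm norm_minus_commute)
  also have "\<dots> \<le> 1 * dist a y" using assms by (intro mult_right_mono) auto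
  finally show ?thesis using assms by simp
qed

text \<open>Differentiation under the integral sign. The inner map \<open>a + t (x - a)\<close>
  contributes a factor \<open>t\<close> by the chain rule, so the weight rises from
  \<open>t ^ m\<close> to \<open>t ^ Suc m\<close>; a general \<open>m\<close> makes the statement
  stable under further differentiation.\<close>

lemma C_inf_on_has_derivative_integral:
  fixes h :: "'a::euclidean_space \<Rightarrow> real"
  assumes h: "C_inf_on (ball a r) h" and x: "x \<in> ball a r"
  shows "((\<lambda>x. integral {0..1} (\<lambda>t. t ^ m * h (a + t *\<^sub>R (x - a)))) has_derivative
    (\<lambda>v. integral {0..1} (\<lambda>t. t ^ Suc m * frechet_derivative h (at (a + t *\<^sub>R (x - a))) v))) (at x)"
proof -
  note in_ball = segment_in_ball[of _ a r]
  \<comment> \<open>The Leibniz rule for integrals asks for the derivative as a continuous family of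
    bounded linear functions.\<close>
  define F where "F y t = t ^ Suc m *\<^sub>R Blinfun (frechet_derivative h (at (a + t *\<^sub>R (y - a))))" for y t
  have bl: "blinfun_apply (Blinfun (frechet_derivative h (at y))) = frechet_derivative h (at y)" if "y \<in> ball a r" for y
    using C_inf_on_has_derivative[OF h that] by (intro bounded_linear_Blinfun_apply has_derivative_bounded_linear)
  have cont_arg: "continuous_on (ball a r \<times> {0..1}) (\<lambda>z. g (a + snd z *\<^sub>R (fst z - a)))"
    if "C_inf_on (ball a r) g" for g :: "'a \<Rightarrow> real"
    by (rule continuous_on_compose2[OF C_inf_on_continuous[OF that]])
      (auto intro!: continuous_intros in_ball simp del: mem_ball)
  have "((\<lambda>x. integral (cbox 0 1) (\<lambda>t. t ^ m * h (a + t *\<^sub>R (x - a)))) has_derivative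
      blinfun_apply (integral (cbox 0 1) (F x))) (at x within ball a r)"
  proof (rule leibniz_rule)
    fix y t assume y: "y \<in> ball a r" and t: "t \<in> cbox (0::real) 1"
    then have t': "t \<in> {0..1}" by simp
    have "((\<lambda>y. a + t *\<^sub>R (y - a)) has_derivative (\<lambda>v. t *\<^sub>R v)) (at y)"
      by (auto intro!: derivative_eq_intros)
    from diff_chain_at[OF this C_inf_on_has_derivative[OF h in_ball[OF y t']]]
    have "((\<lambda>y. t ^ m * h (a + t *\<^sub>R (y - a))) has_derivative
       (\<lambda>v. t ^ m * frechet_derivative h (at (a + t *\<^sub>R (y - a))) (t *\<^sub>R v))) (at y)"
      by (auto simp: o_def intro: has_derivative_mult_right)
    moreover have "frechet_derivative h (at (a + t *\<^sub>R (y - a))) (t *\<^sub>R v) =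
         t * frechet_derivative h (at (a + t *\<^sub>R (y - a))) v" for v
      using linear_scale[OF has_derivative_linear[OF C_inf_on_has_derivative[OF h in_ball[OF y t']]]] by simp
    moreover have "blinfun_apply (F y t) = (\<lambda>v. t * (t ^ m * frechet_derivative h (at (a + t *\<^sub>R (y - a))) v))"
      using bl[OF in_ball[OF y t']] by (auto simp: F_def blinfun.scaleR_left)
    ultimately have "((\<lambda>y. t ^ m * h (a + t *\<^sub>R (y - a))) has_derivative blinfun_apply (F y t)) (at y)"
      by (simp add: mult_ac)
    then show "((\<lambda>y. t ^ m * h (a + t *\<^sub>R (y - a))) has_derivative blinfun_apply (F y t)) (at y within ball a r)"
      by (rule has_derivative_at_withinI)
  next
    fix y assume y: "y \<in> ball a r"
    show "(\<lambda>t. t ^ m * h (a + t *\<^sub>R (y - a))) integrable_on cbox 0 1"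
      by (intro integrable_continuous continuous_intros continuous_on_compose2[OF C_inf_on_continuous[OF h]])
        (use y in \<open>auto intro!: continuous_intros in_ball simp del: mem_ball\<close>)
  next
    have "continuous_on (ball a r \<times> cbox 0 1) (\<lambda>z. F (fst z) (snd z))"
    proof (rule continuous_on_blinfun_componentwise)
      fix b :: 'a
      have "continuous_on (ball a r \<times> cbox 0 1) (\<lambda>z. snd z ^ Suc m * frechet_derivative h (at (a + snd z *\<^sub>R (fst z - a))) b)"
        using cont_arg[OF C_inf_on_frechet_derivative[OF h, of b]] by (intro continuous_intros) auto
      then show "continuous_on (ball a r \<times> cbox 0 1) (\<lambda>z. blinfun_apply (F (fst z) (snd z)) b)"
        by (rule continuous_on_eq) (use bl in_ball in \<open>auto simp: F_def blinfun.scaleR_left simp del: mem_ball\<close>)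
    qed
    then show "continuous_on (ball a r \<times> cbox 0 1) (\<lambda>(y, t). F y t)" by (simp add: split_beta)
  qed (use x in auto)
  moreover have "blinfun_apply (integral (cbox 0 1) (F x)) v =
     integral {0..1} (\<lambda>t. t ^ Suc m * frechet_derivative h (at (a + t *\<^sub>R (x - a))) v)" for v
  proof -
    have "continuous_on (cbox 0 1) (F x)"
    proof (rule continuous_on_blinfun_componentwise)
      fix b :: 'a
      have "continuous_on {0..1} (\<lambda>t. t ^ Suc m * frechet_derivative h (at (a + t *\<^sub>R (x - a))) b)"
        by (intro continuous_intros continuous_on_compose2[OF C_inf_on_continuous[OF C_inf_on_frechet_derivative[OF h, of b]]])
          (use x in \<open>auto intro!: continuous_intros in_ball simp del: mem_ball\<close>)
      then show "continuous_on (cbox 0 1) (\<lambda>t. blinfun_apply (F x t) b)"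
        unfolding box_real
        by (rule continuous_on_eq) (use bl in_ball[OF x] in \<open>auto simp: F_def blinfun.scaleR_left simp del: mem_ball\<close>)
    qed
    then have "F x integrable_on cbox 0 1" by (rule integrable_continuous)
    then have "blinfun_apply (integral (cbox 0 1) (F x)) v = integral (cbox 0 1) (\<lambda>t. blinfun_apply (F x t) v)"
      by (rule blinfun_apply_integral)
    also have "\<dots> = integral {0..1} (\<lambda>t. t ^ Suc m * frechet_derivative h (at (a + t *\<^sub>R (x - a))) v)"
      using bl in_ball[OF x] by (auto simp: F_def blinfun.scaleR_left intro!: integral_cong)
    finally show ?thesis .
  qed
  moreover have "blinfun_apply (integral (cbox 0 1) (F x)) = (\<lambda>v. integral {0..1} (\<lambda>t. t ^ Suc m * frechet_derivative h (at (a + t *\<^sub>R (x - a))) v))"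
    using calculation(2) by auto
  ultimately show ?thesis using x by (simp add: at_within_open[of x "ball a r"])
qed

lemma C_inf_on_integral:
  fixes h :: "'a::euclidean_space \<Rightarrow> real"
  assumes "C_inf_on (ball a r) h"
  shows "C_inf_on (ball a r) (\<lambda>x. integral {0..1} (\<lambda>t. h (a + t *\<^sub>R (x - a))))"
proof -
  \<comment> \<open>Induction over all \<open>h\<close> and \<open>m\<close> at once: a directional
    derivative of \<open>G h m\<close> is \<open>G\<close> of a directional derivative of
    \<open>h\<close>, with weight \<open>m + 1\<close>.\<close>
  define G where "G = (\<lambda>h m x. integral {0..1} (\<lambda>t. t ^ m * h (a + t *\<^sub>R (x - a))))"
  have der: "(G h m has_derivative (\<lambda>v. G (\<lambda>y. frechet_derivative h (at y) v) (Suc m) x)) (at x)"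
    if "C_inf_on (ball a r) h" "x \<in> ball a r" for h m x
    unfolding G_def by (rule C_inf_on_has_derivative_integral[OF that])
  have "Ck_on k (ball a r) (G h m)" if "C_inf_on (ball a r) h" for h m k
    using that
  proof (induction k arbitrary: h m)
    case 0
    then show ?case using der
      by (auto intro!: continuous_at_imp_continuous_on has_derivative_continuous simp del: mem_ball)
  next
    case (Suc k)
    have "Ck_on k (ball a r) (\<lambda>x. frechet_derivative (G h m) (at x) v)" for v
      by (rule Ck_on_cong[OF _ _ Suc.IH[OF C_inf_on_frechet_derivative[OF Suc.prems, of v], of "Suc m"]])
        (simp_all add: frechet_derivativeI[OF der[OF Suc.prems]] del: mem_ball)
    then show ?case using der[OF Suc.prems] by (auto simp: differentiable_def simp del: mem_ball)
  qed
  from this[OF assms, of _ 0] show ?thesis by (simp add: C_inf_on_def G_def)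
qed

text \<open>Fundamental theorem of calculus along the segment from \<open>a\<close> to
  \<open>x\<close>. The coefficient \<open>g b\<close> is the derivative in direction
  \<open>b\<close> averaged over the segment; expanding \<open>x - a\<close> in the basis pulls the
  coordinates out of the integral.\<close>

lemma hadamard:
  fixes f :: "'a::euclidean_space \<Rightarrow> real"
  assumes f: "C_inf_on (ball a r) f" and r: "r > 0"
  obtains g where "\<And>b. C_inf_on (ball a r) (g b)"
    "\<And>b. g b a = frechet_derivative f (at a) b"
    "\<And>x. x \<in> ball a r \<Longrightarrow> f x = f a + (\<Sum>b\<in>Basis. ((x - a) \<bullet> b) * g b x)"
proof
  define g where "g = (\<lambda>b x. integral {0..1} (\<lambda>t. frechet_derivative f (at (a + t *\<^sub>R (x - a))) b))"
  show "C_inf_on (ball a r) (g b)" for b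
    unfolding g_def by (rule C_inf_on_integral[OF C_inf_on_frechet_derivative[OF f]])
  show "g b a = frechet_derivative f (at a) b" for b
    by (simp add: g_def)
  fix x assume x: "x \<in> ball a r"
  note in_ball = segment_in_ball[OF x]
  have expand: "frechet_derivative f (at (a + t *\<^sub>R (x - a))) (x - a) =
      (\<Sum>b\<in>Basis. ((x - a) \<bullet> b) * frechet_derivative f (at (a + t *\<^sub>R (x - a))) b)" if "t \<in> {0..1}" for t
  proof -
    interpret l: linear "frechet_derivative f (at (a + t *\<^sub>R (x - a)))"
      using has_derivative_linear[OF C_inf_on_has_derivative[OF f in_ball[OF that]]] .
    have "frechet_derivative f (at (a + t *\<^sub>R (x - a))) (\<Sum>b\<in>Basis. ((x - a) \<bullet> b) *\<^sub>R b) =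
      (\<Sum>b\<in>Basis. ((x - a) \<bullet> b) * frechet_derivative f (at (a + t *\<^sub>R (x - a))) b)"
      by (simp only: l.sum l.scale real_scaleR_def)
    then show ?thesis by (simp only: euclidean_representation)
  qed
  have "((\<lambda>t. f (a + t *\<^sub>R (x - a))) has_vector_derivative
      frechet_derivative f (at (a + t *\<^sub>R (x - a))) (x - a)) (at t within {0..1})" if "t \<in> {0..1}" for t
  proof -
    note d = C_inf_on_has_derivative[OF f in_ball[OF that]]
    have "((\<lambda>t. a + t *\<^sub>R (x - a)) has_derivative (\<lambda>s. s *\<^sub>R (x - a))) (at t)"
      by (auto intro!: derivative_eq_intros)
    from diff_chain_at[OF this d] show ?thesis
      using linear_scale[OF has_derivative_linear[OF d]]
      by (auto simp: o_def has_vector_derivative_def intro: has_derivative_at_withinI)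
  qed
  then have "((\<lambda>t. frechet_derivative f (at (a + t *\<^sub>R (x - a))) (x - a)) has_integral f x - f a) {0..1}"
    using fundamental_theorem_of_calculus[of 0 1 "\<lambda>t. f (a + t *\<^sub>R (x - a))"
        "\<lambda>t. frechet_derivative f (at (a + t *\<^sub>R (x - a))) (x - a)"] by simp
  then have "f x - f a = integral {0..1} (\<lambda>t. frechet_derivative f (at (a + t *\<^sub>R (x - a))) (x - a))"
    by (simp add: integral_unique)
  also have "\<dots> = integral {0..1} (\<lambda>t. \<Sum>b\<in>Basis. ((x - a) \<bullet> b) * frechet_derivative f (at (a + t *\<^sub>R (x - a))) b)"
    by (rule integral_cong) (rule expand)
  also have "\<dots> = (\<Sum>b\<in>Basis. ((x - a) \<bullet> b) * g b x)"
  proof -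
    have "(\<lambda>t. frechet_derivative f (at (a + t *\<^sub>R (x - a))) b) integrable_on {0..1}" for b
      unfolding box_real[symmetric]
      by (intro integrable_continuous continuous_on_compose2[OF C_inf_on_continuous[OF C_inf_on_frechet_derivative[OF f, of b]]])
        (use in_ball in \<open>auto intro!: continuous_intros simp del: mem_ball\<close>)
    then show ?thesis unfolding g_def
      by (subst integral_sum) (auto intro: integrable_on_mult_right)
  qed
  finally show "f x = f a + (\<Sum>b\<in>Basis. ((x - a) \<bullet> b) * g b x)" by simp
qed

section \<open>Smooth functions and tangent vectors on manifolds\<close>

lemma bij_basis_vec: "bij_betw (basis_vec :: nat \<Rightarrow> 'e::euclidean_space) {..<DIM('e)} Basis"
  using bij_betw_from_nat_into_finite[OF finite_Basis] by (simp add: basis_vec_def[abs_def])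

lemma basis_vec_in_Basis: "i < DIM('e::euclidean_space) \<Longrightarrow> (basis_vec i :: 'e) \<in> Basis"
  using bij_basis_vec by (auto dest: bij_betwE)

lemma inner_basis_vec:
  "i < DIM('e::euclidean_space) \<Longrightarrow> j < DIM('e) \<Longrightarrow> (basis_vec i :: 'e) \<bullet> basis_vec j = (if i = j then 1 else 0)"
  using bij_basis_vec[where 'e='e] by (auto simp: inner_Basis basis_vec_in_Basis bij_betw_def dest: inj_onD)

locale smooth_mfd =
  fixes A :: "('m::{t2_space,second_countable_topology}, 'e::euclidean_space) chart set"
  assumes mfd: "smooth_manifold A"
begin

section \<open>Charts and germs of smooth functions\<close>

lemma chart_props:
  assumes "(U, \<phi>) \<in> A"
  shows "open U" "open (\<phi> ` U)" "homeomorphism U (\<phi> ` U) \<phi> (inv_into U \<phi>)" "inj_on \<phi> U"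
    "continuous_on U \<phi>" "continuous_on (\<phi> ` U) (inv_into U \<phi>)"
proof -
  have "is_chart (U, \<phi>)" using mfd assms unfolding smooth_manifold_def by blast
  then show "open U" "open (\<phi> ` U)" and h: "homeomorphism U (\<phi> ` U) \<phi> (inv_into U \<phi>)"
    by (auto simp: is_chart_def)
  then show "inj_on \<phi> U" "continuous_on U \<phi>" "continuous_on (\<phi> ` U) (inv_into U \<phi>)"
    by (auto simp: homeomorphism_def intro: inj_on_inverseI)
qed

lemma chart_cover: obtains U \<phi> where "(U, \<phi>) \<in> A" "p \<in> U"
  using mfd unfolding smooth_manifold_def by (blast intro: that)

lemma chart_inv: "(U, \<phi>) \<in> A \<Longrightarrow> q \<in> U \<Longrightarrow> inv_into U \<phi> (\<phi> q) = q"
  using chart_props(4) inv_into_f_f by metis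

lemma chart_open_image:
  assumes "(U, \<phi>) \<in> A" "open W"
  shows "open (\<phi> ` (U \<inter> W))"
proof -
  have "openin (top_of_set (\<phi> ` U)) (\<phi> ` (U \<inter> W))"
    using homeomorphism_imp_open_map[OF chart_props(3)[OF assms(1)]] assms(2) by blast
  then show ?thesis using chart_props(2)[OF assms(1)] openin_open_trans by blast
qed

lemma chart_open_preimage:
  assumes "(U, \<phi>) \<in> A" "open V"
  shows "open (U \<inter> \<phi> -` V)"
  using continuous_open_preimage[OF chart_props(5)[OF assms(1)] chart_props(1)[OF assms(1)] assms(2)] .

text \<open>One chart around \<open>p\<close> decides, because the expressions in all other charts
  arise from it by composition with transition maps, which are smooth on the overlaps.\<close>

lemma smooth_at_chart_iff:
  assumes U: "(U, \<phi>) \<in> A" "p \<in> U"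
  shows "smooth_at A p f \<longleftrightarrow> (\<exists>V. open V \<and> \<phi> p \<in> V \<and> V \<subseteq> \<phi> ` U \<and> C_inf_on V (f \<circ> inv_into U \<phi>))"
proof
  assume "smooth_at A p f"
  then obtain W where W: "open W" "p \<in> W" "smooth_on A W f" unfolding smooth_at_def by blast
  then have "C_inf_on (\<phi> ` (U \<inter> W)) (f \<circ> inv_into U \<phi>)" using U unfolding smooth_on_def by blast
  then show "\<exists>V. open V \<and> \<phi> p \<in> V \<and> V \<subseteq> \<phi> ` U \<and> C_inf_on V (f \<circ> inv_into U \<phi>)"
    using chart_open_image[OF U(1) W(1)] W U by blast
next
  assume "\<exists>V. open V \<and> \<phi> p \<in> V \<and> V \<subseteq> \<phi> ` U \<and> C_inf_on V (f \<circ> inv_into U \<phi>)"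
  then obtain V where V: "open V" "\<phi> p \<in> V" "V \<subseteq> \<phi> ` U" "C_inf_on V (f \<circ> inv_into U \<phi>)" by blast
  define W where "W = U \<inter> \<phi> -` V"
  have W: "open W" unfolding W_def using chart_open_preimage[OF U(1) V(1)] .
  have "C_inf_on (\<psi> ` (U' \<inter> W)) (f \<circ> inv_into U' \<psi>)" if U': "(U', \<psi>) \<in> A" for U' \<psi>
  proof -
    have o: "open (\<psi> ` (U' \<inter> W))" by (rule chart_open_image[OF U' W])
    have "C_inf_on (\<psi> ` (U' \<inter> U)) (\<phi> \<circ> inv_into U' \<psi>)"
      using mfd U' U(1) unfolding smooth_manifold_def by blast
    then have t: "C_inf_on (\<psi> ` (U' \<inter> W)) (\<phi> \<circ> inv_into U' \<psi>)"
      by (rule C_inf_on_subset) (auto simp: W_def)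
    have "(\<phi> \<circ> inv_into U' \<psi>) ` \<psi> ` (U' \<inter> W) \<subseteq> V"
      using chart_inv[OF U'] by (auto simp: W_def)
    from C_inf_on_compose[OF o V(1) this V(4) t]
    show ?thesis
      by (rule C_inf_on_cong[OF o, rotated]) (use chart_inv[OF U'] chart_inv[OF U(1)] in \<open>auto simp: W_def\<close>)
  qed
  then have "smooth_on A W f" unfolding smooth_on_def by auto
  with W show "smooth_at A p f" using V U unfolding smooth_at_def W_def by blast
qed

text \<open>Being smooth is local. Passing to germs gives the form in which functions can be
  replaced by formulas valid near a point, by \<open>smooth_at_cong\<close>.\<close>

lemma smooth_on_iff:
  assumes "open W"
  shows "smooth_on A W f \<longleftrightarrow> (\<forall>p\<in>W. smooth_at A p f)"
proof
  assume "smooth_on A W f"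
  then show "\<forall>p\<in>W. smooth_at A p f" using assms unfolding smooth_at_def by blast
next
  assume s: "\<forall>p\<in>W. smooth_at A p f"
  have "C_inf_on (\<phi> ` (U \<inter> W)) (f \<circ> inv_into U \<phi>)" if U: "(U, \<phi>) \<in> A" for U \<phi>
  proof (rule C_inf_on_local)
    fix x assume "x \<in> \<phi> ` (U \<inter> W)"
    then obtain p where p: "p \<in> U" "p \<in> W" "x = \<phi> p" by blast
    then show "\<exists>T. open T \<and> x \<in> T \<and> C_inf_on T (f \<circ> inv_into U \<phi>)"
      using s smooth_at_chart_iff[OF U p(1)] by blast
  qed
  then show "smooth_on A W f" unfolding smooth_on_def by auto
qed

lemma smooth_funs_iff: "f \<in> smooth_funs A \<longleftrightarrow> (\<forall>p. smooth_at A p f)"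
  by (simp add: smooth_funs_def smooth_on_iff)

lemma smooth_funsI: "(\<And>p. smooth_at A p f) \<Longrightarrow> f \<in> smooth_funs A"
  by (simp add: smooth_funs_iff)

lemma smooth_at_smooth_funs: "f \<in> smooth_funs A \<Longrightarrow> smooth_at A p f"
  by (simp add: smooth_funs_iff)

lemma smooth_at_eventually:
  assumes "smooth_at A p f"
  shows "\<forall>\<^sub>F q in nhds p. smooth_at A q f"
proof -
  obtain W where "open W" "p \<in> W" "smooth_on A W f" using assms unfolding smooth_at_def by blast
  then show ?thesis unfolding eventually_nhds smooth_at_def by blast
qed

lemma smooth_at_cong:
  assumes "smooth_at A p f" "\<forall>\<^sub>F q in nhds p. f q = g q"
  shows "smooth_at A p g"
proof -
  obtain U \<phi> where U: "(U, \<phi>) \<in> A" "p \<in> U" by (rule chart_cover)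
  obtain V where V: "open V" "\<phi> p \<in> V" "V \<subseteq> \<phi> ` U" "C_inf_on V (f \<circ> inv_into U \<phi>)"
    using assms(1) smooth_at_chart_iff[OF U] by blast
  obtain W where W: "open W" "p \<in> W" "\<And>q. q \<in> W \<Longrightarrow> f q = g q"
    using assms(2) unfolding eventually_nhds by blast
  have o: "open (V \<inter> \<phi> ` (U \<inter> W))" using V(1) chart_open_image[OF U(1) W(1)] by blast
  have "C_inf_on (V \<inter> \<phi> ` (U \<inter> W)) (g \<circ> inv_into U \<phi>)"
    by (rule C_inf_on_cong[OF o _ C_inf_on_subset[OF V(4)]]) (use W(3) chart_inv[OF U(1)] in auto)
  with o show ?thesis using U V W by (subst smooth_at_chart_iff[OF U]) blast
qed

lemma smooth_at_chart_compose:
  assumes U: "(U, \<phi>) \<in> A" "p \<in> U" and T: "open T" "\<phi> p \<in> T" "C_inf_on T h"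
  shows "smooth_at A p (\<lambda>q. h (\<phi> q))"
proof -
  have o: "open (T \<inter> \<phi> ` U)" using T(1) chart_props(2)[OF U(1)] by blast
  have "C_inf_on (T \<inter> \<phi> ` U) ((\<lambda>q. h (\<phi> q)) \<circ> inv_into U \<phi>)"
    by (rule C_inf_on_cong[OF o _ C_inf_on_subset[OF T(3)]]) (use chart_inv[OF U(1)] in auto)
  with o show ?thesis using U T by (subst smooth_at_chart_iff[OF U]) blast
qed

lemma smooth_at_const: "smooth_at A p (\<lambda>q. c)"
proof -
  obtain U \<phi> where "(U, \<phi>) \<in> A" "p \<in> U" by (rule chart_cover)
  from smooth_at_chart_compose[OF this open_UNIV UNIV_I C_inf_on_const] show ?thesis .
qed

lemma smooth_at_binop:
  assumes "smooth_at A p f" "smooth_at A p g"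
    and op: "\<And>V F G. open V \<Longrightarrow> C_inf_on V F \<Longrightarrow> C_inf_on V G \<Longrightarrow> C_inf_on V (\<lambda>x::'e. h (F x) (G x))"
  shows "smooth_at A p (\<lambda>q. h (f q) (g q))"
proof -
  obtain U \<phi> where U: "(U, \<phi>) \<in> A" "p \<in> U" by (rule chart_cover)
  obtain V V' where V: "open V" "\<phi> p \<in> V" "V \<subseteq> \<phi> ` U" "C_inf_on V (f \<circ> inv_into U \<phi>)"
    and V': "open V'" "\<phi> p \<in> V'" "C_inf_on V' (g \<circ> inv_into U \<phi>)"
    using assms(1,2) smooth_at_chart_iff[OF U] by metis
  have "C_inf_on (V \<inter> V') (\<lambda>x. h ((f \<circ> inv_into U \<phi>) x) ((g \<circ> inv_into U \<phi>) x))"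
    by (intro op C_inf_on_subset[OF V(4)] C_inf_on_subset[OF V'(3)]) (use V V' in auto)
  then show ?thesis using V V'
    by (subst smooth_at_chart_iff[OF U]) (auto simp: o_def intro!: exI[of _ "V \<inter> V'"])
qed

lemma smooth_at_add: "smooth_at A p f \<Longrightarrow> smooth_at A p g \<Longrightarrow> smooth_at A p (\<lambda>q. f q + g q)"
  by (rule smooth_at_binop) (auto intro: C_inf_on_add)

lemma smooth_at_mult: "smooth_at A p f \<Longrightarrow> smooth_at A p g \<Longrightarrow> smooth_at A p (\<lambda>q. f q * g q)"
  by (rule smooth_at_binop) (auto intro: C_inf_on_mult)

lemma smooth_at_minus: "smooth_at A p f \<Longrightarrow> smooth_at A p (\<lambda>q. - f q)"
  using smooth_at_mult[OF smooth_at_const[of p "- 1"]] by simp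

lemma smooth_at_diff: "smooth_at A p f \<Longrightarrow> smooth_at A p g \<Longrightarrow> smooth_at A p (\<lambda>q. f q - g q)"
  using smooth_at_add[OF _ smooth_at_minus] by simp

lemma smooth_at_sum: "(\<And>i. i \<in> I \<Longrightarrow> smooth_at A p (f i)) \<Longrightarrow> smooth_at A p (\<lambda>q. \<Sum>i\<in>I. f i q)"
  by (induction I rule: infinite_finite_induct) (auto intro: smooth_at_const smooth_at_add)

lemma smooth_at_prod: "(\<And>i. i \<in> I \<Longrightarrow> smooth_at A p (f i)) \<Longrightarrow> smooth_at A p (\<lambda>q. \<Prod>i\<in>I. f i q)"
  by (induction I rule: infinite_finite_induct) (auto intro: smooth_at_const smooth_at_mult)

lemma smooth_at_isCont:
  assumes "smooth_at A p f"
  shows "isCont f p"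
proof -
  obtain U \<phi> where U: "(U, \<phi>) \<in> A" "p \<in> U" by (rule chart_cover)
  obtain V where V: "open V" "\<phi> p \<in> V" "V \<subseteq> \<phi> ` U" "C_inf_on V (f \<circ> inv_into U \<phi>)"
    using assms smooth_at_chart_iff[OF U] by blast
  have "continuous_on (U \<inter> \<phi> -` V) (\<lambda>q. (f \<circ> inv_into U \<phi>) (\<phi> q))"
    by (rule continuous_on_compose2[OF C_inf_on_continuous[OF V(4)]])
      (auto intro: continuous_on_subset[OF chart_props(5)[OF U(1)]])
  then have "continuous_on (U \<inter> \<phi> -` V) f"
    by (rule continuous_on_eq) (use chart_inv[OF U(1)] in auto)
  then show ?thesis using chart_open_preimage[OF U(1) V(1)] U V
    by (auto simp: continuous_on_eq_continuous_at)
qed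

lemma smooth_at_compose:
  fixes h :: "real \<Rightarrow> real"
  assumes "smooth_at A p f" "open T" "f p \<in> T" "C_inf_on T h"
  shows "smooth_at A p (\<lambda>q. h (f q))"
proof -
  obtain U \<phi> where U: "(U, \<phi>) \<in> A" "p \<in> U" by (rule chart_cover)
  obtain V where V: "open V" "\<phi> p \<in> V" "V \<subseteq> \<phi> ` U" "C_inf_on V (f \<circ> inv_into U \<phi>)"
    using assms(1) smooth_at_chart_iff[OF U] by blast
  have o: "open (V \<inter> (f \<circ> inv_into U \<phi>) -` T)"
    by (rule continuous_open_preimage[OF C_inf_on_continuous[OF V(4)] V(1) assms(2)])
  have "C_inf_on (V \<inter> (f \<circ> inv_into U \<phi>) -` T) (\<lambda>x. h ((f \<circ> inv_into U \<phi>) x))"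
    by (rule C_inf_on_compose[OF o assms(2) _ assms(4) C_inf_on_subset[OF V(4)]]) auto
  with o show ?thesis using V assms(3) chart_inv[OF U]
    by (subst smooth_at_chart_iff[OF U]) (auto simp: o_def intro!: exI[of _ "V \<inter> (f \<circ> inv_into U \<phi>) -` T"])
qed

lemma smooth_at_inverse: "smooth_at A p f \<Longrightarrow> f p \<noteq> 0 \<Longrightarrow> smooth_at A p (\<lambda>q. inverse (f q))"
  by (rule smooth_at_compose[OF _ _ _ C_inf_on_inverse]) auto

lemmas smooth_at_intros = smooth_at_const smooth_at_add smooth_at_mult smooth_at_minus smooth_at_diff
  smooth_at_sum smooth_at_prod

section \<open>Coordinate functions and coordinate vectors\<close>

lemma smooth_at_coord_fun:
  assumes "\<kappa> \<in> A" "p \<in> fst \<kappa>"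
  shows "smooth_at A p (coord_fun \<kappa> i)"
proof -
  have "C_inf_on UNIV (\<lambda>x. x \<bullet> (basis_vec i :: 'e))"
    by (rule C_inf_on_bounded_linear[OF bounded_linear_inner_left open_UNIV C_inf_on_ident])
  from smooth_at_chart_compose[of "fst \<kappa>" "snd \<kappa>", OF _ assms(2) open_UNIV UNIV_I this] assms(1)
  show ?thesis by (simp add: coord_fun_def)
qed

lemma smooth_at_coord_vec:
  assumes \<kappa>: "\<kappa> \<in> A" "p \<in> fst \<kappa>" and f: "smooth_at A p f"
  shows "smooth_at A p (\<lambda>q. coord_vec A \<kappa> i q f)"
proof -
  obtain U \<phi> where e: "\<kappa> = (U, \<phi>)" by (cases \<kappa>)
  with \<kappa> have U: "(U, \<phi>) \<in> A" "p \<in> U" by auto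
  obtain V where V: "open V" "\<phi> p \<in> V" "V \<subseteq> \<phi> ` U" "C_inf_on V (f \<circ> inv_into U \<phi>)"
    using f smooth_at_chart_iff[OF U] by blast
  from smooth_at_chart_compose[OF U V(1,2) C_inf_on_frechet_derivative[OF V(4)]]
  \<comment> \<open>\<open>coord_vec\<close> is 0 at points where \<open>f\<close> is not smooth;
    but \<open>f\<close> is smooth at all points near \<open>p\<close>, so there it is the partial
    derivative.\<close>
  show ?thesis
    by (rule smooth_at_cong)
      (use smooth_at_eventually[OF f] in \<open>auto simp: coord_vec_def e elim: eventually_mono\<close>)
qed

lemma smooth_at_has_derivative:
  assumes "(U, \<phi>) \<in> A" "p \<in> U" "smooth_at A p f"
  shows "(f \<circ> inv_into U \<phi> has_derivative frechet_derivative (f \<circ> inv_into U \<phi>) (at (\<phi> p))) (at (\<phi> p))"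
  using assms(3) smooth_at_chart_iff[OF assms(1,2)] C_inf_on_has_derivative by blast

lemma coord_vec_coord_fun:
  assumes "\<kappa> \<in> A" "p \<in> fst \<kappa>" "i < DIM('e)" "j < DIM('e)"
  shows "coord_vec A \<kappa> i p (coord_fun \<kappa> j) = (if i = j then 1 else 0)"
proof -
  obtain U \<phi> where e: "\<kappa> = (U, \<phi>)" by (cases \<kappa>)
  with assms have U: "(U, \<phi>) \<in> A" "p \<in> U" by auto
  have "((\<lambda>x. x \<bullet> (basis_vec j :: 'e)) has_derivative (\<lambda>x. x \<bullet> (basis_vec j :: 'e))) (at (\<phi> p))"
    by (rule bounded_linear_imp_has_derivative[OF bounded_linear_inner_left])
  then have "(coord_fun \<kappa> j \<circ> inv_into U \<phi> has_derivative (\<lambda>x. x \<bullet> (basis_vec j :: 'e))) (at (\<phi> p))"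
    by (rule has_derivative_transform_within_open[OF _ chart_props(2)[OF U(1)]])
      (use U chart_inv[OF U(1)] in \<open>auto simp: coord_fun_def e\<close>)
  then show ?thesis
    using smooth_at_coord_fun[OF assms(1,2), of j] inner_basis_vec[OF assms(3,4)]
      frechet_derivativeI[of "coord_fun \<kappa> j \<circ> inv_into U \<phi>"]
    by (simp add: coord_vec_def e)
qed

section \<open>Derivations of germs at a point\<close>

lemma tangent_spaceD:
  assumes "v \<in> tangent_space A p"
  shows "smooth_at A p f \<Longrightarrow> smooth_at A p g \<Longrightarrow> v (\<lambda>x. f x + g x) = v f + v g"
    "smooth_at A p f \<Longrightarrow> smooth_at A p g \<Longrightarrow> v (\<lambda>x. f x * g x) = v f * g p + f p * v g"
    "smooth_at A p f \<Longrightarrow> v (\<lambda>x. c * f x) = c * v f"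
    "smooth_at A p f \<Longrightarrow> \<forall>\<^sub>F x in nhds p. f x = g x \<Longrightarrow> v f = v g"
    "\<not> smooth_at A p f \<Longrightarrow> v f = 0"
  using assms smooth_at_cong unfolding tangent_space_def by blast+

text \<open>\<open>v 1 = v (1 * 1) = 2 * v 1\<close> forces \<open>v 1 = 0\<close>.\<close>

lemma tangent_const: "v \<in> tangent_space A p \<Longrightarrow> v (\<lambda>x. c) = 0"
  using tangent_spaceD(2)[of v p "\<lambda>_. 1" "\<lambda>_. 1"] tangent_spaceD(3)[of v p "\<lambda>_. 1" c] smooth_at_const by simp

lemma tangent_minus: "v \<in> tangent_space A p \<Longrightarrow> smooth_at A p f \<Longrightarrow> v (\<lambda>x. - f x) = - v f"
  using tangent_spaceD(3)[of v p f "- 1"] by simp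

lemma tangent_diff:
  "v \<in> tangent_space A p \<Longrightarrow> smooth_at A p f \<Longrightarrow> smooth_at A p g \<Longrightarrow> v (\<lambda>x. f x - g x) = v f - v g"
  using tangent_spaceD(1)[of v p f "\<lambda>x. - g x"] tangent_minus smooth_at_minus by simp

lemma tangent_sum:
  "v \<in> tangent_space A p \<Longrightarrow> (\<And>i. i \<in> I \<Longrightarrow> smooth_at A p (f i)) \<Longrightarrow> v (\<lambda>x. \<Sum>i\<in>I. f i x) = (\<Sum>i\<in>I. v (f i))"
proof (induction I rule: infinite_finite_induct)
  case (insert i I)
  then show ?case
    using tangent_spaceD(1)[OF insert.prems(1), of "f i" "\<lambda>x. \<Sum>i\<in>I. f i x"] smooth_at_sum[of I p f] by simp
qed (auto simp: tangent_const)

lemma tangent_zero: "(\<lambda>f. 0) \<in> tangent_space A p"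
  by (simp add: tangent_space_def)

lemma tangent_plus:
  assumes "u \<in> tangent_space A p" "v \<in> tangent_space A p"
  shows "(\<lambda>f. u f + v f) \<in> tangent_space A p"
  unfolding tangent_space_def
  using tangent_spaceD(1-3,5)[OF assms(1)] tangent_spaceD(4)[OF assms(1)]
    tangent_spaceD(1-3,5)[OF assms(2)] tangent_spaceD(4)[OF assms(2)]
  by (auto simp: algebra_simps)

lemma tangent_scale:
  assumes "v \<in> tangent_space A p"
  shows "(\<lambda>f. c * v f) \<in> tangent_space A p"
  unfolding tangent_space_def
  using tangent_spaceD(1-3,5)[OF assms] tangent_spaceD(4)[OF assms]
  by (auto simp: algebra_simps)

lemma tangent_sum_closed:
  "(\<And>i. i \<in> I \<Longrightarrow> v i \<in> tangent_space A p) \<Longrightarrow> (\<lambda>f. \<Sum>i\<in>I. c i * v i f) \<in> tangent_space A p"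
proof (induction I rule: infinite_finite_induct)
  case (insert i I)
  then show ?case using tangent_plus[OF tangent_scale[of "v i" p "c i"]] by simp
qed (auto simp: tangent_zero)

lemma coord_vec_tangent:
  assumes "\<kappa> \<in> A" "p \<in> fst \<kappa>"
  shows "coord_vec A \<kappa> i p \<in> tangent_space A p"
proof -
  obtain U \<phi> where e: "\<kappa> = (U, \<phi>)" by (cases \<kappa>)
  with assms have U: "(U, \<phi>) \<in> A" "p \<in> U" by auto
  note d = smooth_at_has_derivative[OF U]
  have c: "coord_vec A \<kappa> i p f = frechet_derivative (f \<circ> inv_into U \<phi>) (at (\<phi> p)) (basis_vec i)" if "smooth_at A p f" for f
    using that by (simp add: coord_vec_def e)
  have inv: "inv_into U \<phi> (\<phi> p) = p" using chart_inv[OF U] .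
  show ?thesis unfolding tangent_space_def
  proof (intro CollectI conjI allI impI)
    fix f g assume f: "smooth_at A p f" and g: "smooth_at A p g"
    show "coord_vec A \<kappa> i p (\<lambda>x. f x + g x) = coord_vec A \<kappa> i p f + coord_vec A \<kappa> i p g"
      using frechet_derivativeI[OF has_derivative_add[OF d[OF f] d[OF g]]] f g
      by (simp add: c smooth_at_add o_def)
    show "coord_vec A \<kappa> i p (\<lambda>x. f x * g x) = coord_vec A \<kappa> i p f * g p + f p * coord_vec A \<kappa> i p g"
      using frechet_derivativeI[OF has_derivative_mult[OF d[OF f] d[OF g]]] f g
      by (simp add: c smooth_at_mult o_def inv)
  next
    fix f r assume f: "smooth_at A p f"
    show "coord_vec A \<kappa> i p (\<lambda>x. r * f x) = r * coord_vec A \<kappa> i p f"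
      using frechet_derivativeI[OF has_derivative_mult_right[OF d[OF f], of r]] f
      by (simp add: c smooth_at_mult smooth_at_const o_def)
  next
    fix f g assume f: "smooth_at A p f" and g: "smooth_at A p g" and ev: "\<forall>\<^sub>F x in nhds p. f x = g x"
    obtain W where W: "open W" "p \<in> W" "\<And>q. q \<in> W \<Longrightarrow> f q = g q"
      using ev unfolding eventually_nhds by blast
    have "frechet_derivative (f \<circ> inv_into U \<phi>) (at (\<phi> p)) = frechet_derivative (g \<circ> inv_into U \<phi>) (at (\<phi> p))"
      by (rule frechet_derivative_cong_open[OF chart_open_image[OF U(1) W(1)]])
        (use U W chart_inv[OF U(1)] in auto)
    with f g show "coord_vec A \<kappa> i p f = coord_vec A \<kappa> i p g" by (simp add: c)
  next
    fix f assume "\<not> smooth_at A p f"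
    then show "coord_vec A \<kappa> i p f = 0" by (simp add: coord_vec_def e)
  qed
qed

text \<open>By Hadamard's lemma the differences from \<open>f p\<close> are combinations of products of functions
  vanishing at \<open>p\<close> and smooth functions, so derivations are determined by the coordinates.\<close>

lemma tangent_expand:
  assumes \<kappa>: "\<kappa> \<in> A" "p \<in> fst \<kappa>" and v: "v \<in> tangent_space A p" and f: "smooth_at A p f"
  shows "v f = (\<Sum>i<DIM('e). v (coord_fun \<kappa> i) * coord_vec A \<kappa> i p f)"
proof -
  obtain U \<phi> where e: "\<kappa> = (U, \<phi>)" by (cases \<kappa>)
  with \<kappa> have U: "(U, \<phi>) \<in> A" "p \<in> U" by auto
  obtain V where V: "open V" "\<phi> p \<in> V" "V \<subseteq> \<phi> ` U" "C_inf_on V (f \<circ> inv_into U \<phi>)"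
    using f smooth_at_chart_iff[OF U] by blast
  obtain r where r: "r > 0" "ball (\<phi> p) r \<subseteq> V" using V(1,2) open_contains_ball by blast
  obtain g where g: "\<And>b. C_inf_on (ball (\<phi> p) r) (g b)"
    "\<And>b. g b (\<phi> p) = frechet_derivative (f \<circ> inv_into U \<phi>) (at (\<phi> p)) b"
    "\<And>x. x \<in> ball (\<phi> p) r \<Longrightarrow> (f \<circ> inv_into U \<phi>) x =
       (f \<circ> inv_into U \<phi>) (\<phi> p) + (\<Sum>b\<in>Basis. ((x - \<phi> p) \<bullet> b) * g b x)"
    using hadamard[OF C_inf_on_subset[OF V(4) r(2)] r(1)] by blast
  define x where "x = coord_fun \<kappa>"
  define h where "h i q = g (basis_vec i) (\<phi> q)" for i q
  have x: "smooth_at A p (x i)" for i unfolding x_def by (rule smooth_at_coord_fun[OF \<kappa>])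
  have h: "smooth_at A p (h i)" for i unfolding h_def
    by (rule smooth_at_chart_compose[OF U _ _ g(1)]) (use r in auto)
  have h_p: "h i p = coord_vec A \<kappa> i p f" for i
    using f by (simp add: h_def g(2) coord_vec_def e)
  have xc: "smooth_at A p (\<lambda>q. x i q - x i p)" for i by (intro smooth_at_intros x)
  have "\<forall>\<^sub>F q in nhds p. f q = f p + (\<Sum>i<DIM('e). (x i q - x i p) * h i q)"
  proof -
    have "f q = f p + (\<Sum>i<DIM('e). (x i q - x i p) * h i q)" if q: "q \<in> U \<inter> \<phi> -` ball (\<phi> p) r" for q
    proof -
      have "f q = f p + (\<Sum>b\<in>Basis. ((\<phi> q - \<phi> p) \<bullet> b) * g b (\<phi> q))"
        using g(3)[of "\<phi> q"] q chart_inv[OF U(1)] U by auto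
      also have "(\<Sum>b\<in>Basis. ((\<phi> q - \<phi> p) \<bullet> b) * g b (\<phi> q)) = (\<Sum>i<DIM('e). (x i q - x i p) * h i q)"
        by (subst sum.reindex_bij_betw[OF bij_basis_vec, symmetric])
          (simp add: x_def h_def coord_fun_def e inner_diff_left)
      finally show ?thesis .
    qed
    moreover have "\<forall>\<^sub>F q in nhds p. q \<in> U \<inter> \<phi> -` ball (\<phi> p) r"
      by (rule eventually_nhds_in_open[OF chart_open_preimage[OF U(1) open_ball]]) (use U r in auto)
    ultimately show ?thesis by (rule eventually_mono[rotated])
  qed
  then have "v f = v (\<lambda>q. f p + (\<Sum>i<DIM('e). (x i q - x i p) * h i q))"
    by (rule tangent_spaceD(4)[OF v f])
  also have "\<dots> = (\<Sum>i<DIM('e). v (\<lambda>q. (x i q - x i p) * h i q))"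
  proof -
    define y where "y i q = (x i q - x i p) * h i q" for i q
    have "smooth_at A p (y i)" for i
      using smooth_at_mult[OF xc h, of i i] by (simp add: y_def[abs_def])
    then show ?thesis
      using tangent_spaceD(1)[OF v smooth_at_const, of "\<lambda>q. \<Sum>i<DIM('e). y i q" "f p"]
        smooth_at_sum[of "{..<DIM('e)}" p y] tangent_sum[OF v, of "{..<DIM('e)}" y] tangent_const[OF v]
      by (simp add: y_def[abs_def])
  qed
  \<comment> \<open>Leibniz rule at \<open>p\<close>: the factor \<open>x i q - x i p\<close>
    vanishes there, so only its derivative contributes.\<close>
  also have "\<dots> = (\<Sum>i<DIM('e). v (x i) * h i p)"
    by (intro sum.cong refl)
      (simp add: tangent_spaceD(2)[OF v xc h] tangent_diff[OF v x smooth_at_const] tangent_const[OF v])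
  finally show ?thesis by (simp add: h_p x_def)
qed

text \<open>A step function of the squared distance in a chart, extended by 0. The closed set
  \<open>K\<close> records why the extension is smooth: off \<open>K\<close> the function vanishes
  on an open set, which includes everything outside the chart.\<close>

lemma bump:
  assumes "open W" "p \<in> W"
  obtains \<eta> K where "\<eta> \<in> smooth_funs A" "\<And>q. \<eta> q \<ge> 0" "\<forall>\<^sub>F q in nhds p. \<eta> q = 1"
    "closed K" "K \<subseteq> W" "\<And>q. q \<notin> K \<Longrightarrow> \<eta> q = 0"
proof -
  obtain U \<phi> where U: "(U, \<phi>) \<in> A" "p \<in> U" by (rule chart_cover)
  obtain r where r: "r > 0" "cball (\<phi> p) r \<subseteq> \<phi> ` (U \<inter> W)"
    using chart_open_image[OF U(1) assms(1)] U assms open_contains_cball[of "\<phi> ` (U \<inter> W)"] by blast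
  define K where "K = inv_into U \<phi> ` cball (\<phi> p) r"
  \<comment> \<open>The argument of \<open>smooth_step\<close> is 2 at distance \<open>r\<close> and
    at most 1 within distance \<open>r / 2\<close>. Using the squared distance keeps it smooth at
    the centre.\<close>
  define h where "h x = smooth_step (2 / r\<^sup>2 * ((x - \<phi> p) \<bullet> (x - \<phi> p)))" for x
  define \<eta> where "\<eta> q = (if q \<in> U then h (\<phi> q) else 0)" for q
  have "compact K" unfolding K_def
    by (rule compact_continuous_image[OF continuous_on_subset[OF chart_props(6)[OF U(1)]]]) (use r in auto)
  \<comment> \<open>Closed in the whole manifold and not only in \<open>U\<close>, because the
    manifold is Hausdorff.\<close>
  then have cK: "closed K" by (rule compact_imp_closed)
  have KW: "K \<subseteq> U \<inter> W" using r chart_inv[OF U(1)] by (fastforce simp: K_def)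
  have out: "\<eta> q = 0" if "q \<notin> K" for q
  proof (cases "q \<in> U")
    case True
    then have "\<phi> q \<notin> cball (\<phi> p) r" using that chart_inv[OF U(1) True] unfolding K_def by (metis image_eqI)
    then have "r \<le> norm (\<phi> q - \<phi> p)" by (simp add: dist_norm norm_minus_commute)
    then have "r\<^sup>2 \<le> (\<phi> q - \<phi> p) \<bullet> (\<phi> q - \<phi> p)" using r by (simp add: power_mono power2_norm_eq_inner[symmetric])
    then have "2 \<le> 2 / r\<^sup>2 * ((\<phi> q - \<phi> p) \<bullet> (\<phi> q - \<phi> p))" using r by (simp add: field_simps)
    then show ?thesis by (simp add: \<eta>_def h_def smooth_step_eq_0)
  qed (simp add: \<eta>_def)
  have C_h: "C_inf_on UNIV h"
  proof -
    have "C_inf_on UNIV (\<lambda>x. x - \<phi> p)"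
      using C_inf_on_add[OF open_UNIV C_inf_on_ident C_inf_on_const[of _ "- \<phi> p"]] by simp
    then have "C_inf_on UNIV (\<lambda>x. (x - \<phi> p) \<bullet> (x - \<phi> p))"
      by (simp add: C_inf_on_def Ck_on_bounded_bilinear[OF open_UNIV bounded_bilinear_inner])
    from C_inf_on_compose[OF open_UNIV open_UNIV _ C_inf_on_smooth_step
        C_inf_on_mult[OF open_UNIV C_inf_on_const[of _ "2 / r\<^sup>2"] this]]
    show ?thesis by (simp add: h_def[abs_def])
  qed
  have "smooth_at A q \<eta>" for q
  proof (cases "q \<in> U")
    case True
    from smooth_at_chart_compose[OF U(1) True open_UNIV UNIV_I C_h] show ?thesis
      by (rule smooth_at_cong)
        (use chart_props(1)[OF U(1)] True in \<open>auto simp: \<eta>_def eventually_nhds intro!: exI[of _ U]\<close>)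
  next
    case False
    show ?thesis by (rule smooth_at_cong[OF smooth_at_const[of _ 0]])
        (use cK False KW out in \<open>auto simp: eventually_nhds intro!: exI[of _ "- K"]\<close>)
  qed
  moreover have "\<forall>\<^sub>F q in nhds p. \<eta> q = 1"
  proof -
    have "\<eta> q = 1" if "q \<in> U \<inter> \<phi> -` ball (\<phi> p) (r / 2)" for q
    proof -
      have "norm (\<phi> q - \<phi> p) \<le> r / 2" using that by (simp add: dist_norm norm_minus_commute)
      then have "(norm (\<phi> q - \<phi> p))\<^sup>2 \<le> (r / 2)\<^sup>2" by (intro power_mono) auto
      then have "2 / r\<^sup>2 * ((\<phi> q - \<phi> p) \<bullet> (\<phi> q - \<phi> p)) \<le> 1"
        using r unfolding power2_norm_eq_inner[symmetric]
        by (simp add: power_divide divide_le_eq) (use zero_le_power2[of "norm (\<phi> q - \<phi> p)"] in linarith)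
      then show ?thesis using that by (simp add: \<eta>_def h_def smooth_step_eq_1)
    qed
    then show ?thesis unfolding eventually_nhds
      using chart_open_preimage[OF U(1) open_ball, of "\<phi> p" "r / 2"] U r
      by (intro exI[of _ "U \<inter> \<phi> -` ball (\<phi> p) (r / 2)"]) auto
  qed
  ultimately show ?thesis using cK KW out
    by (intro that[of \<eta> K]) (auto intro: smooth_funsI simp: \<eta>_def h_def smooth_step_nonneg)
qed

text \<open>Near a point outside the closed set \<open>K\<close> the product is identically 0,
  whatever \<open>f\<close> is there.\<close>

lemma smooth_at_cutoff:
  assumes "\<eta> \<in> smooth_funs A" "closed K" "\<And>q. q \<notin> K \<Longrightarrow> \<eta> q = 0" "\<And>q. q \<in> K \<Longrightarrow> smooth_at A q f"
  shows "(\<lambda>q. \<eta> q * f q) \<in> smooth_funs A"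
proof (rule smooth_funsI)
  fix q
  show "smooth_at A q (\<lambda>q. \<eta> q * f q)"
  proof (cases "q \<in> K")
    case True
    then show ?thesis using assms by (intro smooth_at_mult) (auto simp: smooth_funs_iff)
  next
    case False
    show ?thesis by (rule smooth_at_cong[OF smooth_at_const[of _ 0]])
      (use assms False in \<open>auto simp: eventually_nhds intro!: exI[of _ "- K"]\<close>)
  qed
qed

text \<open>Lets global functions stand for germs; tangent vectors are then determined by their
  values on \<open>smooth_funs\<close>.\<close>

lemma smooth_at_extend:
  assumes "smooth_at A p f"
  obtains g where "g \<in> smooth_funs A" "\<forall>\<^sub>F q in nhds p. f q = g q"
proof -
  obtain W where W: "open W" "p \<in> W" "\<And>q. q \<in> W \<Longrightarrow> smooth_at A q f"
    using smooth_at_eventually[OF assms] unfolding eventually_nhds by blast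
  obtain \<eta> K where \<eta>: "\<eta> \<in> smooth_funs A" "\<forall>\<^sub>F q in nhds p. \<eta> q = 1"
    "closed K" "K \<subseteq> W" "\<And>q. q \<notin> K \<Longrightarrow> \<eta> q = 0"
    using bump[OF W(1,2)] by metis
  have "(\<lambda>q. \<eta> q * f q) \<in> smooth_funs A"
    by (rule smooth_at_cutoff[OF \<eta>(1,3,5)]) (use W \<eta> in auto)
  then show ?thesis using \<eta>(2) by (intro that) (auto elim: eventually_mono)
qed

end

section \<open>Vector bundles\<close>

lemma Rk_zero: "(\<lambda>i. 0) \<in> Rk k"
  and Rk_add: "c \<in> Rk k \<Longrightarrow> d \<in> Rk k \<Longrightarrow> (\<lambda>i. c i + d i) \<in> Rk k"
  and Rk_scale: "c \<in> Rk k \<Longrightarrow> (\<lambda>i. a * c i) \<in> Rk k"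
  and Rk_unit: "j < k \<Longrightarrow> (\<lambda>i. if i = j then 1 else 0) \<in> Rk k"
  and Rk_mono: "k \<le> l \<Longrightarrow> Rk k \<subseteq> Rk l"
  by (auto simp: Rk_def)

text \<open>Induction on the truncations of \<open>c\<close> to its first \<open>m\<close> entries;
  an element of \<open>Rk k\<close> equals its truncation at \<open>k\<close>.\<close>

lemma Rk_linear_expand:
  fixes L :: "(nat \<Rightarrow> real) \<Rightarrow> real"
  assumes add: "\<And>c d. c \<in> Rk k \<Longrightarrow> d \<in> Rk k \<Longrightarrow> L (\<lambda>i. c i + d i) = L c + L d"
    and scale: "\<And>a c. c \<in> Rk k \<Longrightarrow> L (\<lambda>i. a * c i) = a * L c"
    and c: "c \<in> Rk k"
  shows "L c = (\<Sum>j<k. c j * L (\<lambda>i. if i = j then 1 else 0))"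
proof -
  have main: "L (\<lambda>i. if i < m then c i else 0) = (\<Sum>j<m. c j * L (\<lambda>i. if i = j then 1 else 0))" if "m \<le> k" for m
    using that
  proof (induction m)
    case 0
    show ?case using scale[OF c, of 0] by simp
  next
    case (Suc m)
    have e: "(\<lambda>i. if i < Suc m then c i else 0) =
      (\<lambda>i. (if i < m then c i else 0) + c m * (if i = m then 1 else 0))" by (auto simp: fun_eq_iff less_Suc_eq)
    have "(\<lambda>i. if i < m then c i else 0) \<in> Rk k" using Suc.prems by (auto simp: Rk_def)
    from add[OF this Rk_scale[OF Rk_unit]] scale[OF Rk_unit, of m "c m"] Suc
    show ?case unfolding e by simp
  qed
  have "(\<lambda>i. if i < k then c i else 0) = c" using c by (auto simp: Rk_def fun_eq_iff)
  then show ?thesis using main[OF order_refl] by (simp only:)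
qed

definition linear_fibre_map :: "('m, 'v) vbundle \<Rightarrow> ('m, 'w) vbundle \<Rightarrow> ('m \<Rightarrow> 'v \<Rightarrow> 'w) \<Rightarrow> 'm \<Rightarrow> bool" where
  "linear_fibre_map E F h q \<longleftrightarrow> (\<forall>u\<in>fibre E q. h q u \<in> fibre F q \<and>
     (\<forall>v\<in>fibre E q. h q (vadd E q u v) = vadd F q (h q u) (h q v)) \<and>
     (\<forall>c. h q (vsmul E q c u) = vsmul F q c (h q u)))"

text \<open>As a function of \<open>q\<close> this is the local section with constant coordinates;
  the unit vectors give the local frame of the trivialization.\<close>

definition tinv :: "('m, 'v) vbundle \<Rightarrow> ('m \<Rightarrow> 'v \<Rightarrow> nat \<Rightarrow> real) \<Rightarrow> 'm \<Rightarrow> (nat \<Rightarrow> real) \<Rightarrow> 'v" where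
  "tinv E \<Phi> q = inv_into (fibre E q) (\<Phi> q)"

section \<open>Trivializations, their inverses and local frames\<close>

lemma local_trivD:
  assumes "local_triv E (U, k, \<Phi>)" "q \<in> U"
  shows "open U" "bij_betw (\<Phi> q) (fibre E q) (Rk k)"
    "vzero E q \<in> fibre E q" "\<Phi> q (vzero E q) = (\<lambda>i. 0)"
    "u \<in> fibre E q \<Longrightarrow> v \<in> fibre E q \<Longrightarrow> vadd E q u v \<in> fibre E q"
    "u \<in> fibre E q \<Longrightarrow> v \<in> fibre E q \<Longrightarrow> \<Phi> q (vadd E q u v) = (\<lambda>i. \<Phi> q u i + \<Phi> q v i)"
    "u \<in> fibre E q \<Longrightarrow> vsmul E q a u \<in> fibre E q"
    "u \<in> fibre E q \<Longrightarrow> \<Phi> q (vsmul E q a u) = (\<lambda>i. a * \<Phi> q u i)"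
  using assms unfolding local_triv_def by auto

lemma triv_Rk: "local_triv E (U, k, \<Phi>) \<Longrightarrow> q \<in> U \<Longrightarrow> u \<in> fibre E q \<Longrightarrow> \<Phi> q u \<in> Rk k"
  using local_trivD(2) bij_betwE by blast

lemma triv_eqI:
  "local_triv E (U, k, \<Phi>) \<Longrightarrow> q \<in> U \<Longrightarrow> u \<in> fibre E q \<Longrightarrow> v \<in> fibre E q \<Longrightarrow> \<Phi> q u = \<Phi> q v \<Longrightarrow> u = v"
  using local_trivD(2) bij_betw_imp_inj_on inj_onD by metis

lemma tinv_fibre: "local_triv E (U, k, \<Phi>) \<Longrightarrow> q \<in> U \<Longrightarrow> c \<in> Rk k \<Longrightarrow> tinv E \<Phi> q c \<in> fibre E q"
  unfolding tinv_def using local_trivD(2) bij_betw_imp_surj_on inv_into_into by metis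

lemma triv_tinv: "local_triv E (U, k, \<Phi>) \<Longrightarrow> q \<in> U \<Longrightarrow> c \<in> Rk k \<Longrightarrow> \<Phi> q (tinv E \<Phi> q c) = c"
  unfolding tinv_def using local_trivD(2) bij_betw_imp_surj_on f_inv_into_f by metis

lemma tinv_triv: "local_triv E (U, k, \<Phi>) \<Longrightarrow> q \<in> U \<Longrightarrow> u \<in> fibre E q \<Longrightarrow> tinv E \<Phi> q (\<Phi> q u) = u"
  unfolding tinv_def using local_trivD(2) bij_betw_inv_into_left by metis

lemma tinv_add:
  assumes "local_triv E (U, k, \<Phi>)" "q \<in> U" "c \<in> Rk k" "d \<in> Rk k"
  shows "tinv E \<Phi> q (\<lambda>i. c i + d i) = vadd E q (tinv E \<Phi> q c) (tinv E \<Phi> q d)"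
  using assms by (intro triv_eqI[OF assms(1,2)]) (auto simp: tinv_fibre triv_tinv local_trivD Rk_add)

lemma tinv_scale:
  assumes "local_triv E (U, k, \<Phi>)" "q \<in> U" "c \<in> Rk k"
  shows "tinv E \<Phi> q (\<lambda>i. a * c i) = vsmul E q a (tinv E \<Phi> q c)"
  using assms by (intro triv_eqI[OF assms(1,2)]) (auto simp: tinv_fibre triv_tinv local_trivD Rk_scale)

lemma tinv_zero:
  assumes "local_triv E (U, k, \<Phi>)" "q \<in> U"
  shows "tinv E \<Phi> q (\<lambda>i. 0) = vzero E q"
  using tinv_triv[OF assms local_trivD(3)[OF assms]] local_trivD(4)[OF assms] by simp

lemma linear_fibre_map_expand:
  assumes t: "local_triv E (U, k, \<Phi>)" "q \<in> U" and t': "local_triv F (V, l, \<Psi>)" "q \<in> V"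
    and h: "linear_fibre_map E F h q" and u: "u \<in> fibre E q"
  shows "\<Psi> q (h q u) i = (\<Sum>j<k. \<Phi> q u j * \<Psi> q (h q (tinv E \<Phi> q (\<lambda>i. if i = j then 1 else 0))) i)"
proof -
  have "\<Psi> q (h q (tinv E \<Phi> q (\<Phi> q u))) i =
      (\<Sum>j<k. \<Phi> q u j * \<Psi> q (h q (tinv E \<Phi> q (\<lambda>i. if i = j then 1 else 0))) i)"
  proof (rule Rk_linear_expand[where L = "\<lambda>c. \<Psi> q (h q (tinv E \<Phi> q c)) i"])
    show "\<Phi> q u \<in> Rk k" by (rule triv_Rk[OF t u])
  qed (use h tinv_fibre[OF t] in \<open>auto simp: tinv_add[OF t] tinv_scale[OF t] linear_fibre_map_def
        local_trivD(6,8)[OF t']\<close>)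
  then show ?thesis by (simp add: tinv_triv[OF t u])
qed

text \<open>The map in the trivializations of \<open>quotient_bundle\<close>. Elements of one coset
  differ only in the coordinates below \<open>k\<close>, so the choice of the representative does
  not matter.\<close>

definition qtriv :: "('m \<Rightarrow> 'v \<Rightarrow> nat \<Rightarrow> real) \<Rightarrow> nat \<Rightarrow> 'm \<Rightarrow> 'v set \<Rightarrow> nat \<Rightarrow> real" where
  "qtriv \<Phi> k q C i = \<Phi> q (SOME u. u \<in> C) (i + k)"

text \<open>A right inverse of dropping the first \<open>k\<close> coordinates: zeros are put in
  their place.\<close>

definition qshift :: "nat \<Rightarrow> (nat \<Rightarrow> real) \<Rightarrow> nat \<Rightarrow> real" where
  "qshift k c i = (if i < k then 0 else c (i - k))"

context smooth_mfd begin

text \<open>In the local frame the coordinates of \<open>h q (s q)\<close> are sums of coordinates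
  of \<open>s\<close> times matrix entries of \<open>h\<close>, all of them smooth at
  \<open>p\<close>.\<close>

lemma smooth_fibre_map:
  assumes t: "local_triv E (U, k, \<Phi>)" and t': "local_triv F (V, l, \<Psi>)" and p: "p \<in> U" "p \<in> V"
    and h: "\<And>q. q \<in> U \<inter> V \<Longrightarrow> linear_fibre_map E F h q"
    and sm: "\<And>c i. c \<in> Rk k \<Longrightarrow> smooth_at A p (\<lambda>q. \<Psi> q (h q (tinv E \<Phi> q c)) i)"
    and s: "\<And>q. q \<in> U \<inter> V \<Longrightarrow> s q \<in> fibre E q" and ss: "\<And>i. smooth_at A p (\<lambda>q. \<Phi> q (s q) i)"
  shows "smooth_at A p (\<lambda>q. \<Psi> q (h q (s q)) i)"
proof (rule smooth_at_cong)
  show "smooth_at A p (\<lambda>q. \<Sum>j<k. \<Phi> q (s q) j * \<Psi> q (h q (tinv E \<Phi> q (\<lambda>i. if i = j then 1 else 0))) i)"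
    by (intro smooth_at_intros ss sm Rk_unit) auto
  have "open (U \<inter> V)" using local_trivD(1)[OF t p(1)] local_trivD(1)[OF t' p(2)] by blast
  then have "\<forall>\<^sub>F q in nhds p. q \<in> U \<inter> V" by (rule eventually_nhds_in_open) (use p in auto)
  then show "\<forall>\<^sub>F q in nhds p. (\<Sum>j<k. \<Phi> q (s q) j * \<Psi> q (h q (tinv E \<Phi> q (\<lambda>i. if i = j then 1 else 0))) i) = \<Psi> q (h q (s q)) i"
    by (rule eventually_mono) (use linear_fibre_map_expand[OF t _ t' _ h s] in auto)
qed

lemma smooth_transition_iff:
  assumes "open U" "open V"
  shows "smooth_transition A E (U, k, \<Phi>) (V, l, \<Psi>) \<longleftrightarrow>
    (\<forall>c\<in>Rk k. \<forall>i. \<forall>p\<in>U \<inter> V. smooth_at A p (\<lambda>q. \<Psi> q (tinv E \<Phi> q c) i))"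
  using assms by (simp add: smooth_transition_def tinv_def smooth_on_iff open_Int)

lemma smooth_transition_section:
  assumes t: "local_triv E (U, k, \<Phi>)" and t': "local_triv E (V, l, \<Psi>)"
    and tr: "smooth_transition A E (U, k, \<Phi>) (V, l, \<Psi>)" and p: "p \<in> U" "p \<in> V"
    and s: "\<And>q. q \<in> U \<inter> V \<Longrightarrow> s q \<in> fibre E q" and ss: "\<And>i. smooth_at A p (\<lambda>q. \<Phi> q (s q) i)"
  shows "smooth_at A p (\<lambda>q. \<Psi> q (s q) i)"
proof (rule smooth_fibre_map[OF t t' p _ _ s ss, where h = "\<lambda>q u. u"])
  show "linear_fibre_map E E (\<lambda>q u. u) q" for q by (simp add: linear_fibre_map_def)
  show "smooth_at A p (\<lambda>q. \<Psi> q (tinv E \<Phi> q c) i)" if "c \<in> Rk k" for c i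
    using tr that p local_trivD(1)[OF t p(1)] local_trivD(1)[OF t' p(2)] smooth_transition_iff by blast
qed auto

lemma vector_bundle_local_triv: "vector_bundle A E \<Longrightarrow> t \<in> trivs E \<Longrightarrow> local_triv E t"
  by (simp add: vector_bundle_def)

lemma vector_bundle_smooth_triv: "vector_bundle A E \<Longrightarrow> t \<in> trivs E \<Longrightarrow> smooth_triv A E t"
  by (simp add: vector_bundle_def smooth_triv_def)

lemma vector_bundle_cover:
  assumes "vector_bundle A E"
  obtains U k \<Phi> where "(U, k, \<Phi>) \<in> trivs E" "p \<in> U"
  using assms unfolding vector_bundle_def by (blast intro: that)

lemma smooth_triv_local_triv: "smooth_triv A E t \<Longrightarrow> local_triv E t"
  by (simp add: smooth_triv_def)

lemma local_triv_open: "local_triv E (U, k, \<Phi>) \<Longrightarrow> open U"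
  by (simp add: local_triv_def)

text \<open>Near a point, pass through a member of the atlas: both transitions to and from it are
  smooth by definition of the maximal atlas.\<close>

lemma smooth_triv_transition:
  assumes E: "vector_bundle A E" and t: "smooth_triv A E (U, k, \<Phi>)" and t': "smooth_triv A E (V, l, \<Psi>)"
  shows "smooth_transition A E (U, k, \<Phi>) (V, l, \<Psi>)"
  unfolding smooth_transition_iff[OF local_triv_open[OF smooth_triv_local_triv[OF t]]
    local_triv_open[OF smooth_triv_local_triv[OF t']]]
proof (intro ballI allI)
  fix c i p assume c: "c \<in> Rk k" and p: "p \<in> U \<inter> V"
  obtain W m \<Theta> where w: "(W, m, \<Theta>) \<in> trivs E" "p \<in> W" by (rule vector_bundle_cover[OF E])
  have lw: "local_triv E (W, m, \<Theta>)" using vector_bundle_local_triv[OF E w(1)] .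
  note lt = smooth_triv_local_triv[OF t] and lt' = smooth_triv_local_triv[OF t']
  have 1: "smooth_at A p (\<lambda>q. \<Theta> q (tinv E \<Phi> q c) i)" for i
    using t w c p smooth_transition_iff[OF local_triv_open[OF lt] local_triv_open[OF lw]]
    unfolding smooth_triv_def by blast
  \<comment> \<open>Values in the fibres are required on all of \<open>W \<inter> V\<close> and not
    only near \<open>p\<close>, hence the zero vector off \<open>U\<close>.\<close>
  define s where "s q = (if q \<in> U then tinv E \<Phi> q c else vzero E q)" for q
  have s: "s q \<in> fibre E q" if "q \<in> W \<inter> V" for q
    using tinv_fibre[OF lt _ c] local_trivD(3)[OF lt'] that by (auto simp: s_def)
  have ev: "\<forall>\<^sub>F q in nhds p. q \<in> U" using eventually_nhds_in_open[OF local_triv_open[OF lt]] p by blast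
  have "smooth_at A p (\<lambda>q. \<Theta> q (s q) i)" for i
    by (rule smooth_at_cong[OF 1[of i]]) (use ev in \<open>auto simp: s_def elim: eventually_mono\<close>)
  then have "smooth_at A p (\<lambda>q. \<Psi> q (s q) i)"
    using t' w p unfolding smooth_triv_def
    by (intro smooth_transition_section[OF lw lt' _ _ _ s]) auto
  then show "smooth_at A p (\<lambda>q. \<Psi> q (tinv E \<Phi> q c) i)"
    by (rule smooth_at_cong) (use ev in \<open>auto simp: s_def elim: eventually_mono\<close>)
qed

section \<open>Smooth sections and bundle maps\<close>

lemma section_fibre: "s \<in> smooth_sections A E \<Longrightarrow> s q \<in> fibre E q"
  by (simp add: smooth_sections_def)

lemma section_smooth:
  assumes E: "vector_bundle A E" and s: "s \<in> smooth_sections A E"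
    and t: "smooth_triv A E (U, k, \<Phi>)" and p: "p \<in> U"
  shows "smooth_at A p (\<lambda>q. \<Phi> q (s q) i)"
proof -
  obtain W m \<Theta> where w: "(W, m, \<Theta>) \<in> trivs E" "p \<in> W" by (rule vector_bundle_cover[OF E])
  have lw: "local_triv E (W, m, \<Theta>)" using vector_bundle_local_triv[OF E w(1)] .
  have "smooth_at A p (\<lambda>q. \<Theta> q (s q) i)" for i
    using s w smooth_on_iff[OF local_triv_open[OF lw]] unfolding smooth_sections_def by blast
  then show ?thesis using t w p section_fibre[OF s] unfolding smooth_triv_def
    by (intro smooth_transition_section[OF lw smooth_triv_local_triv[OF t]]) auto
qed

text \<open>Smooth transitions carry smoothness from the one trivialization given near
  \<open>p\<close> to the whole atlas. That trivialization can be chosen to suit the section, for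
  instance adapted to a subbundle.\<close>

lemma smooth_sectionI:
  assumes E: "vector_bundle A E" and s: "\<And>q. s q \<in> fibre E q"
    and loc: "\<And>p. \<exists>U k \<Phi>. smooth_triv A E (U, k, \<Phi>) \<and> p \<in> U \<and> (\<forall>i. smooth_at A p (\<lambda>q. \<Phi> q (s q) i))"
  shows "s \<in> smooth_sections A E"
proof -
  have "smooth_on A W (\<lambda>q. \<Theta> q (s q) i)" if w: "(W, m, \<Theta>) \<in> trivs E" for W m \<Theta> i
  proof -
    note lw = vector_bundle_local_triv[OF E w]
    show ?thesis unfolding smooth_on_iff[OF local_triv_open[OF lw]]
    proof
      fix p assume p: "p \<in> W"
      obtain U k \<Phi> where t: "smooth_triv A E (U, k, \<Phi>)" "p \<in> U" "\<And>i. smooth_at A p (\<lambda>q. \<Phi> q (s q) i)"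
        using loc[of p] by blast
      show "smooth_at A p (\<lambda>q. \<Theta> q (s q) i)"
        using smooth_transition_section[OF smooth_triv_local_triv[OF t(1)] lw _ t(2) p s t(3)]
          t(1) w unfolding smooth_triv_def by blast
    qed
  qed
  with s show ?thesis unfolding smooth_sections_def by blast
qed

text \<open>At a point outside \<open>U\<close>, a trivialization restricted to the complement of
  \<open>K\<close> sees only zero vectors.\<close>

lemma cutoff_section:
  assumes E: "vector_bundle A E" and t: "smooth_triv A E (U, k, \<Phi>)"
    and \<eta>: "\<eta> \<in> smooth_funs A" "closed K" "K \<subseteq> U" "\<And>q. q \<notin> K \<Longrightarrow> \<eta> q = 0"
    and a: "\<And>q. q \<in> U \<Longrightarrow> a q \<in> Rk k" "\<And>q i. q \<in> U \<Longrightarrow> smooth_at A q (\<lambda>q. a q i)"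
  shows "(\<lambda>q. if q \<in> U then tinv E \<Phi> q (\<lambda>i. \<eta> q * a q i) else vzero E q) \<in> smooth_sections A E" (is "?s \<in> _")
proof (rule smooth_sectionI[OF E])
  note lt = smooth_triv_local_triv[OF t]
  fix p
  obtain W m \<Theta> where w: "(W, m, \<Theta>) \<in> trivs E" "p \<in> W" by (rule vector_bundle_cover[OF E])
  note lw = vector_bundle_local_triv[OF E w(1)]
  show "?s p \<in> fibre E p"
    using tinv_fibre[OF lt] a Rk_scale local_trivD(3)[OF lw w(2)] by auto
  show "\<exists>U k \<Phi>. smooth_triv A E (U, k, \<Phi>) \<and> p \<in> U \<and> (\<forall>i. smooth_at A p (\<lambda>q. \<Phi> q (?s q) i))"
  proof (cases "p \<in> U")
    case True
    have ev: "\<forall>\<^sub>F q in nhds p. q \<in> U" using eventually_nhds_in_open[OF local_triv_open[OF lt] True] .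
    have "smooth_at A p (\<lambda>q. \<Phi> q (?s q) i)" for i
    proof (rule smooth_at_cong)
      show "smooth_at A p (\<lambda>q. \<eta> q * a q i)" using \<eta>(1) a True by (intro smooth_at_mult) (auto simp: smooth_funs_iff)
      show "\<forall>\<^sub>F q in nhds p. \<eta> q * a q i = \<Phi> q (?s q) i"
        using ev by (rule eventually_mono) (simp add: triv_tinv[OF lt] Rk_scale a)
    qed
    with True t show ?thesis by blast
  next
    case False
    have o: "open (W - K)" using local_triv_open[OF lw] \<eta>(2) by auto
    have "smooth_at A p (\<lambda>q. \<Theta> q (?s q) i)" for i
    proof (rule smooth_at_cong[OF smooth_at_const[of _ 0]])
      have "\<forall>\<^sub>F q in nhds p. q \<in> W - K" using eventually_nhds_in_open[OF o] w False \<eta>(3) by blast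
      then show "\<forall>\<^sub>F q in nhds p. 0 = \<Theta> q (?s q) i"
        by (rule eventually_mono) (use \<eta>(4) in \<open>auto simp: tinv_zero[OF lt] local_trivD(4)[OF lw]\<close>)
    qed
    with w vector_bundle_smooth_triv[OF E] show ?thesis by blast
  qed
qed

lemma extend_section:
  assumes E: "vector_bundle A E" and t: "smooth_triv A E (U, k, \<Phi>)" and p: "p \<in> U" and c: "c \<in> Rk k"
  obtains s where "s \<in> smooth_sections A E" "\<forall>\<^sub>F q in nhds p. s q = tinv E \<Phi> q c"
    "\<And>q. q \<in> U \<Longrightarrow> \<exists>a. s q = tinv E \<Phi> q (\<lambda>i. a * c i)" "\<And>q. q \<notin> U \<Longrightarrow> s q = vzero E q"
proof -
  note o = local_triv_open[OF smooth_triv_local_triv[OF t]]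
  obtain \<eta> K where \<eta>: "\<eta> \<in> smooth_funs A" "\<forall>\<^sub>F q in nhds p. \<eta> q = 1" "closed K" "K \<subseteq> U" "\<And>q. q \<notin> K \<Longrightarrow> \<eta> q = 0"
    using bump[OF o p] by metis
  define s where "s q = (if q \<in> U then tinv E \<Phi> q (\<lambda>i. \<eta> q * c i) else vzero E q)" for q
  have "s \<in> smooth_sections A E" unfolding s_def[abs_def]
    by (rule cutoff_section[OF E t \<eta>(1,3,4,5)]) (use c smooth_at_const in auto)
  moreover have "\<forall>\<^sub>F q in nhds p. s q = tinv E \<Phi> q c"
    using \<eta>(2) eventually_nhds_in_open[OF o p] by eventually_elim (simp add: s_def)
  ultimately show ?thesis by (rule that) (auto simp: s_def)
qed

lemma section_through:
  assumes E: "vector_bundle A E" and u: "u \<in> fibre E p"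
  obtains s where "s \<in> smooth_sections A E" "s p = u"
proof -
  obtain W m \<Theta> where w: "(W, m, \<Theta>) \<in> trivs E" "p \<in> W" by (rule vector_bundle_cover[OF E])
  note lw = vector_bundle_local_triv[OF E w(1)]
  obtain s where "s \<in> smooth_sections A E" "\<forall>\<^sub>F q in nhds p. s q = tinv E \<Theta> q (\<Theta> p u)"
    using extend_section[OF E vector_bundle_smooth_triv[OF E w(1)] w(2) triv_Rk[OF lw w(2) u]] by metis
  then show ?thesis using that tinv_triv[OF lw w(2) u] eventually_nhds_x_imp_x by fastforce
qed

lemma vb_closed:
  assumes E: "vector_bundle A E"
  shows "vzero E q \<in> fibre E q"
    "u \<in> fibre E q \<Longrightarrow> v \<in> fibre E q \<Longrightarrow> vadd E q u v \<in> fibre E q"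
    "u \<in> fibre E q \<Longrightarrow> vsmul E q a u \<in> fibre E q"
proof -
  obtain W m \<Theta> where w: "(W, m, \<Theta>) \<in> trivs E" "q \<in> W" by (rule vector_bundle_cover[OF E])
  note l = local_trivD[OF vector_bundle_local_triv[OF E w(1)] w(2)]
  show "vzero E q \<in> fibre E q"
    "u \<in> fibre E q \<Longrightarrow> v \<in> fibre E q \<Longrightarrow> vadd E q u v \<in> fibre E q"
    "u \<in> fibre E q \<Longrightarrow> vsmul E q a u \<in> fibre E q"
    using l by blast+
qed

text \<open>A trivialization is injective on the fibre and respects the operations, so each law is
  inherited from sequences of reals.\<close>

lemma vb_laws:
  assumes E: "vector_bundle A E"
  shows "u \<in> fibre E q \<Longrightarrow> v \<in> fibre E q \<Longrightarrow> w \<in> fibre E q \<Longrightarrow> vadd E q (vadd E q u v) w = vadd E q u (vadd E q v w)"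
    "u \<in> fibre E q \<Longrightarrow> v \<in> fibre E q \<Longrightarrow> vadd E q u v = vadd E q v u"
    "u \<in> fibre E q \<Longrightarrow> vadd E q u (vzero E q) = u"
    "u \<in> fibre E q \<Longrightarrow> vadd E q u (vsmul E q (- 1) u) = vzero E q"
    "u \<in> fibre E q \<Longrightarrow> v \<in> fibre E q \<Longrightarrow> vsmul E q a (vadd E q u v) = vadd E q (vsmul E q a u) (vsmul E q a v)"
proof -
  obtain W m \<Theta> where w: "(W, m, \<Theta>) \<in> trivs E" "q \<in> W" by (rule vector_bundle_cover[OF E])
  note lt = vector_bundle_local_triv[OF E w(1)]
  note l = local_trivD[OF lt w(2)] and eqI = triv_eqI[OF lt w(2)]
  show "u \<in> fibre E q \<Longrightarrow> v \<in> fibre E q \<Longrightarrow> w \<in> fibre E q \<Longrightarrow> vadd E q (vadd E q u v) w = vadd E q u (vadd E q v w)"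
    "u \<in> fibre E q \<Longrightarrow> v \<in> fibre E q \<Longrightarrow> vadd E q u v = vadd E q v u"
    "u \<in> fibre E q \<Longrightarrow> vadd E q u (vzero E q) = u"
    "u \<in> fibre E q \<Longrightarrow> vadd E q u (vsmul E q (- 1) u) = vzero E q"
    "u \<in> fibre E q \<Longrightarrow> v \<in> fibre E q \<Longrightarrow> vsmul E q a (vadd E q u v) = vadd E q (vsmul E q a u) (vsmul E q a v)"
    by (rule eqI; simp add: l algebra_simps)+
qed

lemma smooth_sections_sadd:
  assumes E: "vector_bundle A E" and s: "s \<in> smooth_sections A E" and t: "t \<in> smooth_sections A E"
  shows "sadd E s t \<in> smooth_sections A E"
proof (rule smooth_sectionI[OF E])
  show "sadd E s t q \<in> fibre E q" for q
    using vb_closed(2)[OF E section_fibre[OF s] section_fibre[OF t]] by (simp add: sadd_def)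
  fix p
  obtain W m \<Theta> where w: "(W, m, \<Theta>) \<in> trivs E" "p \<in> W" by (rule vector_bundle_cover[OF E])
  note sw = vector_bundle_smooth_triv[OF E w(1)]
  note lw = smooth_triv_local_triv[OF sw]
  have "smooth_at A p (\<lambda>q. \<Theta> q (sadd E s t q) i)" for i
  proof (rule smooth_at_cong)
    show "smooth_at A p (\<lambda>q. \<Theta> q (s q) i + \<Theta> q (t q) i)"
      by (intro smooth_at_add section_smooth[OF E _ sw w(2)] s t)
    show "\<forall>\<^sub>F q in nhds p. \<Theta> q (s q) i + \<Theta> q (t q) i = \<Theta> q (sadd E s t q) i"
      by (rule eventually_mono[OF eventually_nhds_in_open[OF local_triv_open[OF lw] w(2)]])
        (simp add: sadd_def local_trivD(6)[OF lw] section_fibre[OF s] section_fibre[OF t])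
  qed
  with sw w show "\<exists>U k \<Phi>. smooth_triv A E (U, k, \<Phi>) \<and> p \<in> U \<and> (\<forall>i. smooth_at A p (\<lambda>q. \<Phi> q (sadd E s t q) i))"
    by blast
qed

lemma smooth_sections_smul:
  assumes E: "vector_bundle A E" and f: "f \<in> smooth_funs A" and s: "s \<in> smooth_sections A E"
  shows "smul E f s \<in> smooth_sections A E"
proof (rule smooth_sectionI[OF E])
  show "smul E f s q \<in> fibre E q" for q
    using vb_closed(3)[OF E section_fibre[OF s]] by (simp add: smul_def)
  fix p
  obtain W m \<Theta> where w: "(W, m, \<Theta>) \<in> trivs E" "p \<in> W" by (rule vector_bundle_cover[OF E])
  note sw = vector_bundle_smooth_triv[OF E w(1)]
  note lw = smooth_triv_local_triv[OF sw]
  have "smooth_at A p (\<lambda>q. \<Theta> q (smul E f s q) i)" for i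
  proof (rule smooth_at_cong)
    show "smooth_at A p (\<lambda>q. f q * \<Theta> q (s q) i)"
      by (intro smooth_at_mult section_smooth[OF E _ sw w(2)] s smooth_at_smooth_funs[OF f])
    show "\<forall>\<^sub>F q in nhds p. f q * \<Theta> q (s q) i = \<Theta> q (smul E f s q) i"
      by (rule eventually_mono[OF eventually_nhds_in_open[OF local_triv_open[OF lw] w(2)]])
        (simp add: smul_def local_trivD(8)[OF lw] section_fibre[OF s])
  qed
  with sw w show "\<exists>U k \<Phi>. smooth_triv A E (U, k, \<Phi>) \<and> p \<in> U \<and> (\<forall>i. smooth_at A p (\<lambda>q. \<Phi> q (smul E f s q) i))"
    by blast
qed

lemma bundle_map_iff:
  "vector_bundle A E \<Longrightarrow> vector_bundle A F \<Longrightarrow> bundle_map A E F h \<longleftrightarrow> (\<forall>q. linear_fibre_map E F h q) \<and>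
     (\<forall>(U, k, \<Phi>)\<in>trivs E. \<forall>(V, l, \<Psi>)\<in>trivs F. \<forall>c\<in>Rk k. \<forall>i.
        \<forall>p\<in>U \<inter> V. smooth_at A p (\<lambda>q. \<Psi> q (h q (tinv E \<Phi> q c)) i))"
proof -
  assume E: "vector_bundle A E" and F: "vector_bundle A F"
  have "smooth_on A (U \<inter> V) f \<longleftrightarrow> (\<forall>p\<in>U \<inter> V. smooth_at A p f)"
    if "(U, k, \<Phi>) \<in> trivs E" "(V, l, \<Psi>) \<in> trivs F" for U k \<Phi> V l \<Psi> f
    using that vector_bundle_local_triv[OF E] vector_bundle_local_triv[OF F]
    by (intro smooth_on_iff open_Int) (blast intro: local_triv_open)+
  then show ?thesis
    unfolding bundle_map_def linear_fibre_map_def tinv_def by (intro arg_cong2[of _ _ _ _ "(\<and>)"] ball_cong refl) auto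
qed

text \<open>Local sections with constant coordinates agree near a point with global sections, so
  preserving global smooth sections already makes the matrix entries smooth.\<close>

lemma bundle_mapI:
  assumes E: "vector_bundle A E" and F: "vector_bundle A F" and h: "\<And>q. linear_fibre_map E F h q"
    and s: "\<And>s. s \<in> smooth_sections A E \<Longrightarrow> (\<lambda>q. h q (s q)) \<in> smooth_sections A F"
  shows "bundle_map A E F h"
proof -
  have "smooth_at A p (\<lambda>q. \<Psi> q (h q (tinv E \<Phi> q c)) i)"
    if t: "(U, k, \<Phi>) \<in> trivs E" "(V, l, \<Psi>) \<in> trivs F" "c \<in> Rk k" "p \<in> U \<inter> V" for U k \<Phi> V l \<Psi> c i p
  proof -
    obtain s where s': "s \<in> smooth_sections A E" "\<forall>\<^sub>F q in nhds p. s q = tinv E \<Phi> q c"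
      using extend_section[OF E vector_bundle_smooth_triv[OF E t(1)] _ t(3)] t(4) by (metis IntD1)
    have "smooth_at A p (\<lambda>q. \<Psi> q (h q (s q)) i)"
      using section_smooth[OF F s[OF s'(1)] vector_bundle_smooth_triv[OF F t(2)]] t(4) by blast
    then show ?thesis by (rule smooth_at_cong) (use s'(2) in \<open>auto elim: eventually_mono\<close>)
  qed
  then show ?thesis using h unfolding bundle_map_iff[OF E F] by blast
qed

subsection \<open>Subbundles\<close>

lemma adapted_trivD:
  assumes "adapted_triv A E F k (U, n, \<Phi>)"
  shows "smooth_triv A E (U, n, \<Phi>)" "local_triv E (U, n, \<Phi>)" "k \<le> n" "open U" "q \<in> U \<Longrightarrow> \<Phi> q ` F q = Rk k"
proof -
  show t: "smooth_triv A E (U, n, \<Phi>)" and "k \<le> n" and "q \<in> U \<Longrightarrow> \<Phi> q ` F q = Rk k"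
    using assms by (auto simp: adapted_triv_def)
  then show "local_triv E (U, n, \<Phi>)" by (simp add: smooth_triv_local_triv)
  then show "open U" by (rule local_triv_open)
qed

text \<open>\<open>adapted_triv\<close> speaks of the image of \<open>F q\<close> only; injectivity
  of \<open>\<Phi> q\<close> on the fibre turns this into a test of membership.\<close>

lemma adapted_mem_iff:
  assumes F: "subbundle A E F" and t: "adapted_triv A E F k (U, n, \<Phi>)" and q: "q \<in> U" and u: "u \<in> fibre E q"
  shows "u \<in> F q \<longleftrightarrow> \<Phi> q u \<in> Rk k"
proof
  assume "\<Phi> q u \<in> Rk k"
  then obtain w where "w \<in> F q" "\<Phi> q u = \<Phi> q w" using adapted_trivD(5)[OF t q] by blast
  then show "u \<in> F q" using triv_eqI[OF adapted_trivD(2)[OF t] q u] F unfolding subbundle_def by blast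
qed (use adapted_trivD(5)[OF t q] in blast)

lemma subbundle_cover:
  assumes "subbundle A E F"
  obtains U n \<Phi> k where "adapted_triv A E F k (U, n, \<Phi>)" "p \<in> U"
  using assms unfolding subbundle_def by metis

lemma subbundle_fibre: "subbundle A E F \<Longrightarrow> u \<in> F q \<Longrightarrow> u \<in> fibre E q"
  unfolding subbundle_def by blast

lemma subbundle_closed:
  assumes F: "subbundle A E F"
  shows "vzero E q \<in> F q" "u \<in> F q \<Longrightarrow> v \<in> F q \<Longrightarrow> vadd E q u v \<in> F q" "u \<in> F q \<Longrightarrow> vsmul E q a u \<in> F q"
proof -
  obtain U n \<Phi> k where t: "adapted_triv A E F k (U, n, \<Phi>)" "q \<in> U" by (rule subbundle_cover[OF F])
  note m = adapted_mem_iff[OF F t] and l = local_trivD[OF adapted_trivD(2)[OF t(1)] t(2)] and f = subbundle_fibre[OF F]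
  show "vzero E q \<in> F q" using m l Rk_zero by simp
  show "vadd E q u v \<in> F q" if "u \<in> F q" "v \<in> F q"
    using that f[of _ q] l m[of u] m[of v] Rk_add by (subst m) auto
  show "vsmul E q a u \<in> F q" if "u \<in> F q"
    using that f[of _ q] l m[of u] Rk_scale by (subst m) auto
qed

lemma sub_bundle_triv:
  assumes F: "subbundle A E F" and t: "adapted_triv A E F k (U, n, \<Phi>)"
  shows "local_triv (sub_bundle A E F) (U, k, \<Phi>)"
    "q \<in> U \<Longrightarrow> c \<in> Rk k \<Longrightarrow> tinv (sub_bundle A E F) \<Phi> q c = tinv E \<Phi> q c"
proof -
  note lt = adapted_trivD(2)[OF t]
  have "bij_betw (\<Phi> q) (F q) (Rk k)" if "q \<in> U" for q
    using adapted_trivD(5)[OF t that] local_trivD(2)[OF lt that] subbundle_fibre[OF F]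
    unfolding bij_betw_def by (auto intro: inj_on_subset)
  then show lt': "local_triv (sub_bundle A E F) (U, k, \<Phi>)"
    using subbundle_closed[OF F] local_trivD[OF lt] adapted_trivD(4)[OF t] subbundle_fibre[OF F]
    unfolding local_triv_def by (auto simp: sub_bundle_def)
  show "tinv (sub_bundle A E F) \<Phi> q c = tinv E \<Phi> q c" if "q \<in> U" "c \<in> Rk k"
  proof (rule triv_eqI[OF lt that(1)])
    show "tinv (sub_bundle A E F) \<Phi> q c \<in> fibre E q"
      using tinv_fibre[OF lt' that] subbundle_fibre[OF F] by (simp add: sub_bundle_def)
    have "c \<in> Rk n" using that(2) Rk_mono[OF adapted_trivD(3)[OF t]] by blast
    then show "tinv E \<Phi> q c \<in> fibre E q" "\<Phi> q (tinv (sub_bundle A E F) \<Phi> q c) = \<Phi> q (tinv E \<Phi> q c)"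
      using tinv_fibre[OF lt that(1)] triv_tinv[OF lt that(1)] triv_tinv[OF lt' that] by auto
  qed
qed

lemma trivs_sub_bundle: "(U, k, \<Phi>) \<in> trivs (sub_bundle A E F) \<longleftrightarrow> (\<exists>n. adapted_triv A E F k (U, n, \<Phi>))"
  by (auto simp: sub_bundle_def)

lemma vector_bundle_sub_bundle:
  assumes E: "vector_bundle A E" and F: "subbundle A E F"
  shows "vector_bundle A (sub_bundle A E F)"
proof -
  have "smooth_transition A (sub_bundle A E F) (U, k, \<Phi>) (V, l, \<Psi>)"
    if t: "(U, k, \<Phi>) \<in> trivs (sub_bundle A E F)" and t': "(V, l, \<Psi>) \<in> trivs (sub_bundle A E F)" for U k \<Phi> V l \<Psi>
  proof -
    obtain n m where a: "adapted_triv A E F k (U, n, \<Phi>)" "adapted_triv A E F l (V, m, \<Psi>)"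
      using t t' trivs_sub_bundle by blast
    have tr: "smooth_transition A E (U, n, \<Phi>) (V, m, \<Psi>)"
      using smooth_triv_transition[OF E] a adapted_trivD(1) by blast
    note o = adapted_trivD(4)[OF a(1)] adapted_trivD(4)[OF a(2)]
    show ?thesis unfolding smooth_transition_iff[OF o]
    proof (intro ballI allI)
      fix c i p assume c: "c \<in> Rk k" and p: "p \<in> U \<inter> V"
      have "c \<in> Rk n" using c Rk_mono[OF adapted_trivD(3)[OF a(1)]] by blast
      then have "smooth_at A p (\<lambda>q. \<Psi> q (tinv E \<Phi> q c) i)"
        using tr p unfolding smooth_transition_iff[OF o] by blast
      then show "smooth_at A p (\<lambda>q. \<Psi> q (tinv (sub_bundle A E F) \<Phi> q c) i)"
        by (rule smooth_at_cong)
          (rule eventually_mono[OF eventually_nhds_in_open[OF o(1)]],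
            use p sub_bundle_triv(2)[OF F a(1) _ c] in auto)
    qed
  qed
  moreover have "local_triv (sub_bundle A E F) t" if "t \<in> trivs (sub_bundle A E F)" for t
    using that sub_bundle_triv(1)[OF F] by (cases t) (auto simp: trivs_sub_bundle)
  moreover have "(\<Union>(U, k, \<Phi>)\<in>trivs (sub_bundle A E F). U) = UNIV"
  proof -
    have "p \<in> (\<Union>(U, k, \<Phi>)\<in>trivs (sub_bundle A E F). U)" for p
    proof -
      obtain U n \<Phi> k where "adapted_triv A E F k (U, n, \<Phi>)" "p \<in> U" by (rule subbundle_cover[OF F])
      then show ?thesis using trivs_sub_bundle[of U k \<Phi> E F] by blast
    qed
    then show ?thesis by blast
  qed
  ultimately show ?thesis unfolding vector_bundle_def by (simp add: split_paired_all Ball_def)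
qed

text \<open>In an adapted trivialization both bundles use the same coordinate functions.\<close>

lemma smooth_sections_sub_bundle:
  assumes E: "vector_bundle A E" and F: "subbundle A E F"
  shows "s \<in> smooth_sections A (sub_bundle A E F) \<longleftrightarrow> s \<in> smooth_sections A E \<and> (\<forall>q. s q \<in> F q)"
proof safe
  note S = vector_bundle_sub_bundle[OF E F]
  assume s: "s \<in> smooth_sections A (sub_bundle A E F)"
  then show m: "s q \<in> F q" for q using section_fibre[OF s, of q] by (simp add: sub_bundle_def)
  show "s \<in> smooth_sections A E"
  proof (rule smooth_sectionI[OF E])
    show "s q \<in> fibre E q" for q using m subbundle_fibre[OF F] by blast
    fix p
    obtain U n \<Phi> k where t: "adapted_triv A E F k (U, n, \<Phi>)" "p \<in> U" by (rule subbundle_cover[OF F])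
    then have "(U, k, \<Phi>) \<in> trivs (sub_bundle A E F)" using trivs_sub_bundle by blast
    then show "\<exists>U k \<Phi>. smooth_triv A E (U, k, \<Phi>) \<and> p \<in> U \<and> (\<forall>i. smooth_at A p (\<lambda>q. \<Phi> q (s q) i))"
      using section_smooth[OF S s vector_bundle_smooth_triv[OF S] t(2)] t adapted_trivD(1) by blast
  qed
next
  assume s: "s \<in> smooth_sections A E" "\<forall>q. s q \<in> F q"
  have "smooth_on A U (\<lambda>q. \<Phi> q (s q) i)" if t: "adapted_triv A E F k (U, n, \<Phi>)" for U k n \<Phi> i
    unfolding smooth_on_iff[OF adapted_trivD(4)[OF t]] using section_smooth[OF E s(1) adapted_trivD(1)[OF t]] by blast
  with s show "s \<in> smooth_sections A (sub_bundle A E F)"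
    by (auto simp: smooth_sections_def sub_bundle_def)
qed

text \<open>Makes conditions on sections with values in \<open>F\<close>, such as the bracket
  condition on \<open>P\<close>, available at single vectors of \<open>F p\<close>.\<close>

lemma subbundle_section_through:
  assumes E: "vector_bundle A E" and F: "subbundle A E F" and u: "u \<in> F p"
  obtains s where "s \<in> smooth_sections A E" "\<And>q. s q \<in> F q" "s p = u"
  using section_through[OF vector_bundle_sub_bundle[OF E F], of u p] u
    smooth_sections_sub_bundle[OF E F] by (simp add: sub_bundle_def) metis

subsection \<open>Quotient bundles\<close>

context
  fixes E :: "('m, 'v) vbundle" and F
  assumes E: "vector_bundle A E" and F: "subbundle A E F"
begin

lemma coset_self: "u \<in> fibre E q \<Longrightarrow> u \<in> coset E F q u"
  using vb_laws(3)[OF E] subbundle_closed(1)[OF F] unfolding coset_def by force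

lemma coset_eq_iff:
  assumes u: "u \<in> fibre E q" and v: "v \<in> fibre E q"
  shows "coset E F q u = coset E F q v \<longleftrightarrow> (\<exists>w\<in>F q. v = vadd E q u w)"
proof
  assume "coset E F q u = coset E F q v"
  then show "\<exists>w\<in>F q. v = vadd E q u w" using coset_self[OF v] unfolding coset_def by blast
next
  assume "\<exists>w\<in>F q. v = vadd E q u w"
  then obtain w where w: "w \<in> F q" "v = vadd E q u w" by blast
  note f = subbundle_fibre[OF F] and c = subbundle_closed[OF F, where q = q] and l = vb_laws[OF E]
  define w' where "w' = vsmul E q (- 1) w"
  have w': "w' \<in> F q" "vadd E q w w' = vzero E q" using w c l(4) f by (auto simp: w'_def)
  have "vadd E q u x = vadd E q v (vadd E q w' x)" if "x \<in> F q" for x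
  proof -
    have "vadd E q v (vadd E q w' x) = vadd E q u (vadd E q w (vadd E q w' x))"
      unfolding w(2) using w w' that u f vb_closed(2)[OF E] by (intro l(1)) auto
    also have "vadd E q w (vadd E q w' x) = vadd E q (vadd E q w w') x"
      using w w' that f by (intro l(1)[symmetric]) auto
    also have "\<dots> = x" unfolding w'(2) using l(2,3) that f vb_closed(1)[OF E] by metis
    finally show ?thesis by simp
  qed
  moreover have "vadd E q v x = vadd E q u (vadd E q w x)" if "x \<in> F q" for x
    unfolding w(2) using w that u f by (intro l(1)) auto
  ultimately show "coset E F q u = coset E F q v"
    unfolding coset_def using c(2)[OF w'(1)] c(2)[OF w(1)] by blast
qed

lemma vadd_vzero_left: "u \<in> fibre E q \<Longrightarrow> vadd E q (vzero E q) u = u"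
  using vb_laws(2)[OF E vb_closed(1)[OF E]] vb_laws(3)[OF E] by simp

lemma coset_zero: "coset E F q (vzero E q) = F q"
proof -
  have "vadd E q (vzero E q) w = w" if "w \<in> F q" for w
    using vadd_vzero_left subbundle_fibre[OF F that] by simp
  then have "(\<lambda>w. vadd E q (vzero E q) w) ` F q = F q" by (simp cong: image_cong)
  then show ?thesis by (simp add: coset_def setcompr_eq_image)
qed

lemma coset_eq_zero_iff: "u \<in> fibre E q \<Longrightarrow> coset E F q u = F q \<longleftrightarrow> u \<in> F q"
  using coset_eq_iff[OF vb_closed(1)[OF E], of u q] vadd_vzero_left subbundle_fibre[OF F]
  by (auto simp: coset_zero)

lemma quotient_vadd:
  assumes u: "u \<in> fibre E q" and v: "v \<in> fibre E q"
  shows "vadd (quotient_bundle A E F) q (coset E F q u) (coset E F q v) = coset E F q (vadd E q u v)"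
proof -
  note f = subbundle_fibre[OF F] and l = vb_laws[OF E] and cl = vb_closed(2)[OF E]
  have eq: "vadd E q (vadd E q u w) (vadd E q v w') = vadd E q (vadd E q u v) (vadd E q w w')"
    if w: "w \<in> F q" "w' \<in> F q" for w w'
  proof -
    note fw = f[OF w(1)] f[OF w(2)]
    have "vadd E q w (vadd E q v w') = vadd E q v (vadd E q w w')"
      using l(1)[OF fw(1) v fw(2)] l(1)[OF v fw] l(2)[OF fw(1) v] by simp
    then show ?thesis using l(1)[OF u fw(1) cl[OF v fw(2)]] l(1)[OF u v cl[OF fw]] by simp
  qed
  have "vadd E q (vadd E q u v) w = vadd E q (vadd E q u (vzero E q)) (vadd E q v w)" if "w \<in> F q" for w
    using l(1)[OF u v f[OF that]] l(3)[OF u] by simp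
  note split_eq = this
  show ?thesis
  proof (intro equalityI subsetI)
    fix x assume "x \<in> vadd (quotient_bundle A E F) q (coset E F q u) (coset E F q v)"
    then obtain w w' where w: "w \<in> F q" "w' \<in> F q" "x = vadd E q (vadd E q u w) (vadd E q v w')"
      unfolding quotient_bundle_def coset_def by auto
    then show "x \<in> coset E F q (vadd E q u v)"
      using eq subbundle_closed(2)[OF F] unfolding coset_def by blast
  next
    fix x assume "x \<in> coset E F q (vadd E q u v)"
    then obtain w where "w \<in> F q" "x = vadd E q (vadd E q u v) w" unfolding coset_def by blast
    then show "x \<in> vadd (quotient_bundle A E F) q (coset E F q u) (coset E F q v)"
      using split_eq subbundle_closed(1)[OF F] unfolding quotient_bundle_def coset_def vbundle.simps by blast
  qed
qed

lemma quotient_vsmul: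
  assumes u: "u \<in> fibre E q"
  shows "vsmul (quotient_bundle A E F) q a (coset E F q u) = coset E F q (vsmul E q a u)"
proof -
  note f = subbundle_fibre[OF F] and l = vb_laws[OF E] and cl = vb_closed[OF E]
  have eq: "vadd E q (vsmul E q a (vadd E q u w)) w' = vadd E q (vsmul E q a u) (vadd E q (vsmul E q a w) w')"
    if w: "w \<in> F q" "w' \<in> F q" for w w'
    using l(1)[OF cl(3)[OF u] cl(3)[OF f[OF w(1)]] f[OF w(2)]] l(5)[OF u f[OF w(1)]] by simp
  show ?thesis
  proof (intro equalityI subsetI)
    fix x assume "x \<in> vsmul (quotient_bundle A E F) q a (coset E F q u)"
    then obtain w w' where w: "w \<in> F q" "w' \<in> F q" "x = vadd E q (vsmul E q a (vadd E q u w)) w'"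
      unfolding quotient_bundle_def coset_def by auto
    then show "x \<in> coset E F q (vsmul E q a u)"
      using eq subbundle_closed[OF F] unfolding coset_def by blast
  next
    fix x assume "x \<in> coset E F q (vsmul E q a u)"
    then show "x \<in> vsmul (quotient_bundle A E F) q a (coset E F q u)"
      using coset_self[OF u] unfolding quotient_bundle_def coset_def by auto
  qed
qed

lemma quotient_fields: "fibre (quotient_bundle A E F) q = coset E F q ` fibre E q" "vzero (quotient_bundle A E F) = F"
  by (simp_all add: quotient_bundle_def)

lemma linear_fibre_map_coset: "linear_fibre_map E (quotient_bundle A E F) (coset E F) q"
  by (simp add: linear_fibre_map_def quotient_fields quotient_vadd quotient_vsmul)

lemma trivs_quotient: "trivs (quotient_bundle A E F) = {(U, n - k, qtriv \<Phi> k) | U n \<Phi> k. adapted_triv A E F k (U, n, \<Phi>)}"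
  by (simp add: quotient_bundle_def qtriv_def[abs_def])

text \<open>The chosen representative is \<open>u\<close> plus some \<open>w\<close> in
  \<open>F q\<close>, and the coordinates of \<open>w\<close> vanish from index \<open>k\<close>
  on.\<close>

lemma qtriv_coset:
  assumes t: "adapted_triv A E F k (U, n, \<Phi>)" and q: "q \<in> U" and u: "u \<in> fibre E q"
  shows "qtriv \<Phi> k q (coset E F q u) i = \<Phi> q u (i + k)"
proof -
  have "(SOME v. v \<in> coset E F q u) \<in> coset E F q u" using coset_self[OF u] by (rule someI)
  then obtain w where w: "w \<in> F q" "(SOME v. v \<in> coset E F q u) = vadd E q u w" unfolding coset_def by blast
  have "\<Phi> q w \<in> Rk k" using w(1) adapted_trivD(5)[OF t q] by blast
  then show ?thesis using local_trivD(6)[OF adapted_trivD(2)[OF t] q u] subbundle_fibre[OF F w(1)] w(2)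
    by (simp add: qtriv_def Rk_def)
qed

lemma qshift_Rk: "c \<in> Rk (n - k) \<Longrightarrow> qshift k c \<in> Rk n"
  by (auto simp: Rk_def qshift_def)

lemma quotient_triv:
  assumes t: "adapted_triv A E F k (U, n, \<Phi>)"
  shows "local_triv (quotient_bundle A E F) (U, n - k, qtriv \<Phi> k)"
    "q \<in> U \<Longrightarrow> c \<in> Rk (n - k) \<Longrightarrow> tinv (quotient_bundle A E F) (qtriv \<Phi> k) q c = coset E F q (tinv E \<Phi> q (qshift k c))"
proof -
  note lt = adapted_trivD(2)[OF t] and qc = qtriv_coset[OF t]
  have bij: "bij_betw (qtriv \<Phi> k q) (coset E F q ` fibre E q) (Rk (n - k))" if q: "q \<in> U" for q
    unfolding bij_betw_def
  proof
    show "inj_on (qtriv \<Phi> k q) (coset E F q ` fibre E q)"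
    proof (rule inj_onI, clarify)
      fix u v assume u: "u \<in> fibre E q" and v: "v \<in> fibre E q"
        and eq: "qtriv \<Phi> k q (coset E F q u) = qtriv \<Phi> k q (coset E F q v)"
      \<comment> \<open>The difference \<open>v - u\<close>: equal values of \<open>qtriv\<close>
        make its coordinates vanish from \<open>k\<close> on, hence it lies in
        \<open>F q\<close>.\<close>
      define w where "w = vadd E q v (vsmul E q (- 1) u)"
      have w: "w \<in> fibre E q" using u v vb_closed[OF E] by (simp add: w_def)
      have uw: "v = vadd E q u w"
        by (rule triv_eqI[OF lt q]) (use u v w vb_closed[OF E] in \<open>auto simp: w_def local_trivD[OF lt q]\<close>)
      have z: "\<Phi> q w (i + k) = 0" for i
        using fun_cong[OF eq, of i] qc[OF q u] qc[OF q v] u v vb_closed[OF E] by (simp add: w_def local_trivD[OF lt q])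
      have "\<Phi> q w j = 0" if "k \<le> j" for j using z[of "j - k"] that by simp
      then have "\<Phi> q w \<in> Rk k" by (simp add: Rk_def)
      then have "w \<in> F q" using adapted_mem_iff[OF F t q w] by blast
      with uw show "coset E F q u = coset E F q v" using coset_eq_iff[OF u v] by blast
    qed
    show "qtriv \<Phi> k q ` coset E F q ` fibre E q = Rk (n - k)"
    proof (intro equalityI subsetI)
      fix c assume "c \<in> qtriv \<Phi> k q ` coset E F q ` fibre E q"
      then obtain u where u: "u \<in> fibre E q" "c = qtriv \<Phi> k q (coset E F q u)" by blast
      then show "c \<in> Rk (n - k)" using triv_Rk[OF lt q u(1)] qc[OF q u(1)] by (auto simp: Rk_def)
    next
      fix c assume c: "c \<in> Rk (n - k)"
      have "qtriv \<Phi> k q (coset E F q (tinv E \<Phi> q (qshift k c))) = c"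
        using qc[OF q tinv_fibre[OF lt q qshift_Rk[OF c]]] triv_tinv[OF lt q qshift_Rk[OF c]]
        by (auto simp: qshift_def)
      then show "c \<in> qtriv \<Phi> k q ` coset E F q ` fibre E q"
        using tinv_fibre[OF lt q qshift_Rk[OF c]] by (metis imageI)
    qed
  qed
  show lt': "local_triv (quotient_bundle A E F) (U, n - k, qtriv \<Phi> k)"
    unfolding local_triv_def prod.case
  proof (intro conjI ballI allI)
    show "open U" by (rule adapted_trivD(4)[OF t])
    fix q assume q: "q \<in> U"
    show "bij_betw (qtriv \<Phi> k q) (fibre (quotient_bundle A E F) q) (Rk (n - k))"
      using bij[OF q] by (simp add: quotient_fields)
    show "vzero (quotient_bundle A E F) q \<in> fibre (quotient_bundle A E F) q"
      using vb_closed(1)[OF E] coset_zero by (auto simp: quotient_fields)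
    show "qtriv \<Phi> k q (vzero (quotient_bundle A E F) q) = (\<lambda>i. 0)"
      using qc[OF q vb_closed(1)[OF E]] local_trivD(4)[OF lt q] by (auto simp: quotient_fields coset_zero)
    fix C assume C: "C \<in> fibre (quotient_bundle A E F) q"
    then obtain u where u: "u \<in> fibre E q" "C = coset E F q u" by (auto simp: quotient_fields)
    show "vsmul (quotient_bundle A E F) q c C \<in> fibre (quotient_bundle A E F) q" for c
      using u vb_closed(3)[OF E] by (simp add: quotient_vsmul quotient_fields)
    show "qtriv \<Phi> k q (vsmul (quotient_bundle A E F) q c C) = (\<lambda>i. c * qtriv \<Phi> k q C i)" for c
      using u vb_closed(3)[OF E] by (auto simp: quotient_vsmul qc[OF q] local_trivD[OF lt q])
    fix D assume D: "D \<in> fibre (quotient_bundle A E F) q"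
    then obtain v where v: "v \<in> fibre E q" "D = coset E F q v" by (auto simp: quotient_fields)
    show "vadd (quotient_bundle A E F) q C D \<in> fibre (quotient_bundle A E F) q"
      using u v vb_closed(2)[OF E] by (simp add: quotient_vadd quotient_fields)
    show "qtriv \<Phi> k q (vadd (quotient_bundle A E F) q C D) = (\<lambda>i. qtriv \<Phi> k q C i + qtriv \<Phi> k q D i)"
      using u v vb_closed(2)[OF E] by (auto simp: quotient_vadd qc[OF q] local_trivD[OF lt q])
  qed
  show "tinv (quotient_bundle A E F) (qtriv \<Phi> k) q c = coset E F q (tinv E \<Phi> q (qshift k c))"
    if q: "q \<in> U" and c: "c \<in> Rk (n - k)"
  proof (rule triv_eqI[OF lt' q tinv_fibre[OF lt' q c]])
    show "coset E F q (tinv E \<Phi> q (qshift k c)) \<in> fibre (quotient_bundle A E F) q"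
      using tinv_fibre[OF lt q qshift_Rk[OF c]] by (auto simp: quotient_fields)
    show "qtriv \<Phi> k q (tinv (quotient_bundle A E F) (qtriv \<Phi> k) q c) = qtriv \<Phi> k q (coset E F q (tinv E \<Phi> q (qshift k c)))"
      using qc[OF q tinv_fibre[OF lt q qshift_Rk[OF c]]] triv_tinv[OF lt q qshift_Rk[OF c]] triv_tinv[OF lt' q c]
      by (auto simp: qshift_def)
  qed
qed

text \<open>A transition of the quotient is a transition of \<open>E\<close> applied to
  \<open>qshift k c\<close> and read from index \<open>l\<close> on, so its smoothness is
  inherited.\<close>

lemma vector_bundle_quotient: "vector_bundle A (quotient_bundle A E F)"
proof -
  have "smooth_transition A (quotient_bundle A E F) (U, n - k, qtriv \<Phi> k) (V, m - l, qtriv \<Psi> l)"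
    if a: "adapted_triv A E F k (U, n, \<Phi>)" "adapted_triv A E F l (V, m, \<Psi>)" for U n k \<Phi> V m l \<Psi>
  proof -
    have tr: "smooth_transition A E (U, n, \<Phi>) (V, m, \<Psi>)"
      using smooth_triv_transition[OF E] a adapted_trivD(1) by blast
    note o = adapted_trivD(4)[OF a(1)] adapted_trivD(4)[OF a(2)]
    show ?thesis unfolding smooth_transition_iff[OF o]
    proof (intro ballI allI)
      fix c i p assume c: "c \<in> Rk (n - k)" and p: "p \<in> U \<inter> V"
      have "smooth_at A p (\<lambda>q. \<Psi> q (tinv E \<Phi> q (qshift k c)) (i + l))"
        using tr p qshift_Rk[OF c] unfolding smooth_transition_iff[OF o] by blast
      then show "smooth_at A p (\<lambda>q. qtriv \<Psi> l q (tinv (quotient_bundle A E F) (qtriv \<Phi> k) q c) i)"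
      proof (rule smooth_at_cong)
        have "\<forall>\<^sub>F q in nhds p. q \<in> U \<inter> V" using eventually_nhds_in_open[OF open_Int[OF o] p] .
        then show "\<forall>\<^sub>F q in nhds p. \<Psi> q (tinv E \<Phi> q (qshift k c)) (i + l) =
            qtriv \<Psi> l q (tinv (quotient_bundle A E F) (qtriv \<Phi> k) q c) i"
          by (rule eventually_mono)
            (use quotient_triv(2)[OF a(1) _ c] qtriv_coset[OF a(2)] tinv_fibre[OF adapted_trivD(2)[OF a(1)] _ qshift_Rk[OF c]] in auto)
      qed
    qed
  qed
  moreover have "(\<Union>(U, k, \<Phi>)\<in>trivs (quotient_bundle A E F). U) = UNIV"
  proof -
    have "p \<in> (\<Union>(U, k, \<Phi>)\<in>trivs (quotient_bundle A E F). U)" for p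
    proof -
      obtain U n \<Phi> k where "adapted_triv A E F k (U, n, \<Phi>)" "p \<in> U" by (rule subbundle_cover[OF F])
      then show ?thesis unfolding trivs_quotient by blast
    qed
    then show ?thesis by blast
  qed
  ultimately show ?thesis unfolding vector_bundle_def trivs_quotient
    using quotient_triv(1) by blast
qed

lemma coset_section:
  assumes s: "s \<in> smooth_sections A E"
  shows "(\<lambda>q. coset E F q (s q)) \<in> smooth_sections A (quotient_bundle A E F)"
proof (rule smooth_sectionI[OF vector_bundle_quotient])
  show "coset E F q (s q) \<in> fibre (quotient_bundle A E F) q" for q
    using section_fibre[OF s] by (simp add: quotient_fields)
  fix p
  obtain U n \<Phi> k where t: "adapted_triv A E F k (U, n, \<Phi>)" "p \<in> U" by (rule subbundle_cover[OF F])
  then have tq: "smooth_triv A (quotient_bundle A E F) (U, n - k, qtriv \<Phi> k)"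
    by (intro vector_bundle_smooth_triv[OF vector_bundle_quotient]) (auto simp: trivs_quotient)
  have "smooth_at A p (\<lambda>q. qtriv \<Phi> k q (coset E F q (s q)) i)" for i
    by (rule smooth_at_cong[OF section_smooth[OF E s adapted_trivD(1)[OF t(1)] t(2), of "i + k"]])
      (rule eventually_mono[OF eventually_nhds_in_open[OF adapted_trivD(4)[OF t(1)] t(2)]],
        simp add: qtriv_coset[OF t(1)] section_fibre[OF s])
  with tq t show "\<exists>U k \<Phi>. smooth_triv A (quotient_bundle A E F) (U, k, \<Phi>) \<and> p \<in> U \<and>
      (\<forall>i. smooth_at A p (\<lambda>q. \<Phi> q (coset E F q (s q)) i))" by blast
qed

lemma bundle_map_coset: "bundle_map A E (quotient_bundle A E F) (coset E F)"
  by (rule bundle_mapI[OF E vector_bundle_quotient linear_fibre_map_coset coset_section])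

text \<open>Over an adapted trivialization, the lift with zero in the first \<open>k\<close>
  coordinates is smooth; the cutoff makes it global. The result is \<open>\<eta> q\<close> times a
  representative of \<open>S q\<close>, the form needed for summation with a partition of
  unity.\<close>

lemma cutoff_lift:
  assumes S: "S \<in> smooth_sections A (quotient_bundle A E F)" and t: "adapted_triv A E F k (U, n, \<Phi>)"
    and \<eta>: "\<eta> \<in> smooth_funs A" "closed K" "K \<subseteq> U" "\<And>q. q \<notin> K \<Longrightarrow> \<eta> q = 0"
  obtains s where "s \<in> smooth_sections A E" "\<And>q. q \<notin> K \<Longrightarrow> s q = vzero E q"
    "\<And>q. q \<in> U \<Longrightarrow> \<exists>u\<in>fibre E q. coset E F q u = S q \<and> s q = vsmul E q (\<eta> q) u"
proof -
  have tq: "(U, n - k, qtriv \<Phi> k) \<in> trivs (quotient_bundle A E F)" using t by (auto simp: trivs_quotient)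
  note sq = vector_bundle_smooth_triv[OF vector_bundle_quotient tq]
  note lq = smooth_triv_local_triv[OF sq] and lt = adapted_trivD(2)[OF t]
  define a where "a q = qshift k (qtriv \<Phi> k q (S q))" for q
  have Rq: "qtriv \<Phi> k q (S q) \<in> Rk (n - k)" if "q \<in> U" for q
    using triv_Rk[OF lq that section_fibre[OF S]] .
  have a: "a q \<in> Rk n" if "q \<in> U" for q
    using qshift_Rk[OF Rq[OF that]] by (simp add: a_def)
  have a': "smooth_at A q (\<lambda>q. a q i)" if "q \<in> U" for q i
    using section_smooth[OF vector_bundle_quotient S sq that] smooth_at_const[of q 0]
    by (cases "i < k") (simp_all add: a_def qshift_def)
  define s where "s q = (if q \<in> U then tinv E \<Phi> q (\<lambda>i. \<eta> q * a q i) else vzero E q)" for q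
  have "s \<in> smooth_sections A E" unfolding s_def[abs_def]
    by (rule cutoff_section[OF E adapted_trivD(1)[OF t] \<eta> a a'])
  moreover have "s q = vzero E q" if "q \<notin> K" for q
    using \<eta>(4)[OF that] tinv_zero[OF lt] by (auto simp: s_def)
  moreover have "\<exists>u\<in>fibre E q. coset E F q u = S q \<and> s q = vsmul E q (\<eta> q) u" if q: "q \<in> U" for q
  proof (intro bexI conjI)
    show "tinv E \<Phi> q (a q) \<in> fibre E q" by (rule tinv_fibre[OF lt q a[OF q]])
    show "coset E F q (tinv E \<Phi> q (a q)) = S q"
      using quotient_triv(2)[OF t q Rq[OF q]] tinv_triv[OF lq q section_fibre[OF S]] by (simp add: a_def)
    show "s q = vsmul E q (\<eta> q) (tinv E \<Phi> q (a q))"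
      using q tinv_scale[OF lt q a[OF q]] by (simp add: s_def)
  qed
  ultimately show ?thesis by (rule that)
qed

end

end

section \<open>Vector fields and one-forms\<close>

context smooth_mfd begin

section \<open>Linear algebra in the tangent and cotangent spaces\<close>

lemma tangent_eqI:
  assumes "u \<in> tangent_space A p" "v \<in> tangent_space A p" "\<And>f. f \<in> smooth_funs A \<Longrightarrow> u f = v f"
  shows "u = v"
proof
  fix f
  show "u f = v f"
  proof (cases "smooth_at A p f")
    case True
    then obtain g where "g \<in> smooth_funs A" "\<forall>\<^sub>F q in nhds p. f q = g q" by (rule smooth_at_extend)
    then show ?thesis using assms tangent_spaceD(4)[OF _ True] by metis
  qed (simp add: tangent_spaceD(5)[OF assms(1)] tangent_spaceD(5)[OF assms(2)])
qed

lemma cot_D: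
  assumes "\<alpha> \<in> cotangent_space A p"
  shows "u \<in> tangent_space A p \<Longrightarrow> v \<in> tangent_space A p \<Longrightarrow> \<alpha> (\<lambda>f. u f + v f) = \<alpha> u + \<alpha> v"
    "v \<in> tangent_space A p \<Longrightarrow> \<alpha> (\<lambda>f. c * v f) = c * \<alpha> v"
    "v \<notin> tangent_space A p \<Longrightarrow> \<alpha> v = 0"
  using assms unfolding cotangent_space_def by blast+

lemma cot_zero_vec: "\<alpha> \<in> cotangent_space A p \<Longrightarrow> \<alpha> (\<lambda>f. 0) = 0"
  using cot_D(2)[of \<alpha> p "\<lambda>f. 0" 0] tangent_zero by simp

lemma cot_sum:
  assumes "\<alpha> \<in> cotangent_space A p" "\<And>i. i \<in> I \<Longrightarrow> v i \<in> tangent_space A p"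
  shows "\<alpha> (\<lambda>f. \<Sum>i\<in>I. c i * v i f) = (\<Sum>i\<in>I. c i * \<alpha> (v i))"
  using assms(2)
proof (induction I rule: infinite_finite_induct)
  case (insert i I)
  then show ?case
    using cot_D(1)[OF assms(1) tangent_scale[of "v i" p "c i"] tangent_sum_closed[of I v p c]] cot_D(2)[OF assms(1)]
    by simp
qed (auto simp: cot_zero_vec[OF assms(1)])

lemma cotI:
  assumes "\<And>u v. u \<in> tangent_space A p \<Longrightarrow> v \<in> tangent_space A p \<Longrightarrow> \<alpha> (\<lambda>f. u f + v f) = \<alpha> u + \<alpha> v"
    "\<And>v c. v \<in> tangent_space A p \<Longrightarrow> \<alpha> (\<lambda>f. c * v f) = c * \<alpha> v"
    "\<And>v. v \<notin> tangent_space A p \<Longrightarrow> \<alpha> v = 0"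
  shows "\<alpha> \<in> cotangent_space A p"
  using assms unfolding cotangent_space_def by blast

lemma cot_eqI:
  assumes "\<alpha> \<in> cotangent_space A p" "\<beta> \<in> cotangent_space A p" "\<And>v. v \<in> tangent_space A p \<Longrightarrow> \<alpha> v = \<beta> v"
  shows "\<alpha> = \<beta>"
  using assms cot_D(3) by (metis ext)

lemma cot_zero: "(\<lambda>v. 0) \<in> cotangent_space A p"
  and cot_plus: "\<alpha> \<in> cotangent_space A p \<Longrightarrow> \<beta> \<in> cotangent_space A p \<Longrightarrow> (\<lambda>v. \<alpha> v + \<beta> v) \<in> cotangent_space A p"
  and cot_scale: "\<alpha> \<in> cotangent_space A p \<Longrightarrow> (\<lambda>v. c * \<alpha> v) \<in> cotangent_space A p"
  by (rule cotI; simp add: cot_D algebra_simps)+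

lemma cot_minus: "\<alpha> \<in> cotangent_space A p \<Longrightarrow> \<beta> \<in> cotangent_space A p \<Longrightarrow> (\<lambda>v. \<alpha> v - \<beta> v) \<in> cotangent_space A p"
  using cot_plus[OF _ cot_scale[of _ p "- 1"]] by simp

lemma cot_sum_closed:
  "(\<And>i. i \<in> I \<Longrightarrow> \<alpha> i \<in> cotangent_space A p) \<Longrightarrow> (\<lambda>v. \<Sum>i\<in>I. c i * \<alpha> i v) \<in> cotangent_space A p"
proof (induction I rule: infinite_finite_induct)
  case (insert i I)
  then show ?case using cot_plus[OF cot_scale[of "\<alpha> i" p "c i"]] by simp
qed (auto simp: cot_zero)

lemma differential_apply: "v \<in> tangent_space A p \<Longrightarrow> differential A f p v = v f"
  by (simp add: differential_def)

lemma differential_cot: "differential A f p \<in> cotangent_space A p"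
  by (rule cotI) (auto simp: differential_def tangent_plus tangent_scale)

lemma cot_expand:
  assumes "\<kappa> \<in> A" "q \<in> fst \<kappa>" "\<alpha> \<in> cotangent_space A q" "v \<in> tangent_space A q"
  shows "\<alpha> v = (\<Sum>i<DIM('e). v (coord_fun \<kappa> i) * \<alpha> (coord_vec A \<kappa> i q))"
proof -
  have cv: "coord_vec A \<kappa> i q \<in> tangent_space A q" for i by (rule coord_vec_tangent[OF assms(1,2)])
  have "v = (\<lambda>f. \<Sum>i<DIM('e). v (coord_fun \<kappa> i) * coord_vec A \<kappa> i q f)"
    by (rule tangent_eqI[OF assms(4) tangent_sum_closed[OF cv]])
      (rule tangent_expand[OF assms(1,2,4) smooth_at_smooth_funs])
  then have "\<alpha> v = \<alpha> (\<lambda>f. \<Sum>i<DIM('e). v (coord_fun \<kappa> i) * coord_vec A \<kappa> i q f)" by (rule arg_cong)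
  also have "\<dots> = (\<Sum>i<DIM('e). v (coord_fun \<kappa> i) * \<alpha> (coord_vec A \<kappa> i q))" by (rule cot_sum[OF assms(3) cv])
  finally show ?thesis .
qed

section \<open>The tangent and cotangent bundles as vector bundles\<close>

definition TM_triv :: "('m, 'e) chart \<Rightarrow> 'm \<Rightarrow> 'm tvec \<Rightarrow> nat \<Rightarrow> real" where
  "TM_triv \<kappa> q v i = (if i < DIM('e) then v (coord_fun \<kappa> i) else 0)"

definition cotM_triv :: "('m, 'e) chart \<Rightarrow> 'm \<Rightarrow> 'm covec \<Rightarrow> nat \<Rightarrow> real" where
  "cotM_triv \<kappa> q \<alpha> i = (if i < DIM('e) then \<alpha> (coord_vec A \<kappa> i q) else 0)"

lemma trivs_TM: "trivs (TM A) = {(fst \<kappa>, DIM('e), TM_triv \<kappa>) | \<kappa>. \<kappa> \<in> A}"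
  by (simp add: TM_def TM_triv_def[abs_def])

lemma trivs_cotM: "trivs (cotM A) = {(fst \<kappa>, DIM('e), cotM_triv \<kappa>) | \<kappa>. \<kappa> \<in> A}"
  by (simp add: cotM_def cotM_triv_def[abs_def])

lemma TM_simps: "fibre (TM A) = tangent_space A" "vadd (TM A) q u v = (\<lambda>f. u f + v f)"
  "vsmul (TM A) q c v = (\<lambda>f. c * v f)" "vzero (TM A) q = (\<lambda>f. 0)"
  by (simp_all add: TM_def)

lemma cotM_simps: "fibre (cotM A) = cotangent_space A" "vadd (cotM A) q \<alpha> \<beta> = (\<lambda>v. \<alpha> v + \<beta> v)"
  "vsmul (cotM A) q c \<alpha> = (\<lambda>v. c * \<alpha> v)" "vzero (cotM A) q = (\<lambda>v. 0)"
  by (simp_all add: cotM_def)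

lemma chart_open: "\<kappa> \<in> A \<Longrightarrow> open (fst \<kappa>)"
  using chart_props(1) by (metis prod.collapse)

lemma sum_delta_coord:
  "(\<Sum>i<DIM('e). c i * (if i = j then 1 else 0)) = (if j < DIM('e) then c j else (0::real))"
  by (simp add: sum.delta if_distrib cong: if_cong)

text \<open>Injectivity comes from \<open>tangent_expand\<close>, surjectivity from the duality of
  coordinate vectors and coordinate functions.\<close>

lemma TM_local_triv:
  assumes "\<kappa> \<in> A"
  shows "local_triv (TM A) (fst \<kappa>, DIM('e), TM_triv \<kappa>)"
    "q \<in> fst \<kappa> \<Longrightarrow> c \<in> Rk DIM('e) \<Longrightarrow> tinv (TM A) (TM_triv \<kappa>) q c = (\<lambda>f. \<Sum>i<DIM('e). c i * coord_vec A \<kappa> i q f)"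
proof -
  have cl: "(\<lambda>f. \<Sum>i<DIM('e). c i * coord_vec A \<kappa> i q f) \<in> tangent_space A q" if "q \<in> fst \<kappa>" for q c
    by (rule tangent_sum_closed) (rule coord_vec_tangent[OF assms that])
  have val: "TM_triv \<kappa> q (\<lambda>f. \<Sum>i<DIM('e). c i * coord_vec A \<kappa> i q f) = c"
    if q: "q \<in> fst \<kappa>" and c: "c \<in> Rk DIM('e)" for q c
  proof
    fix j
    have "(\<Sum>i<DIM('e). c i * coord_vec A \<kappa> i q (coord_fun \<kappa> j)) = (\<Sum>i<DIM('e). c i * (if i = j then 1 else 0))" if "j < DIM('e)"
      using coord_vec_coord_fun[OF assms q _ that] by (intro sum.cong) auto
    then show "TM_triv \<kappa> q (\<lambda>f. \<Sum>i<DIM('e). c i * coord_vec A \<kappa> i q f) j = c j"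
      using c unfolding sum_delta_coord by (auto simp: TM_triv_def Rk_def)
  qed
  have bij: "bij_betw (TM_triv \<kappa> q) (tangent_space A q) (Rk DIM('e))" if q: "q \<in> fst \<kappa>" for q
    unfolding bij_betw_def
  proof
    show "inj_on (TM_triv \<kappa> q) (tangent_space A q)"
    proof (rule inj_onI)
      fix u v assume u: "u \<in> tangent_space A q" and v: "v \<in> tangent_space A q" and eq: "TM_triv \<kappa> q u = TM_triv \<kappa> q v"
      have "u (coord_fun \<kappa> i) = v (coord_fun \<kappa> i)" if "i < DIM('e)" for i
        using fun_cong[OF eq, of i] that by (simp add: TM_triv_def)
      then show "u = v"
        by (intro tangent_eqI[OF u v]) (simp add: tangent_expand[OF assms q] u v smooth_at_smooth_funs)
    qed
    show "TM_triv \<kappa> q ` tangent_space A q = Rk DIM('e)"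
    proof (intro equalityI subsetI)
      fix c :: "nat \<Rightarrow> real" assume c: "c \<in> Rk DIM('e)"
      show "c \<in> TM_triv \<kappa> q ` tangent_space A q"
        by (rule image_eqI[where f = "TM_triv \<kappa> q", OF val[OF q c, symmetric]]) (rule cl[OF q])
    qed (auto simp: TM_triv_def Rk_def)
  qed
  show lt: "local_triv (TM A) (fst \<kappa>, DIM('e), TM_triv \<kappa>)"
    using bij chart_open[OF assms] by (auto simp: local_triv_def TM_simps tangent_zero tangent_plus tangent_scale TM_triv_def)
  show "tinv (TM A) (TM_triv \<kappa>) q c = (\<lambda>f. \<Sum>i<DIM('e). c i * coord_vec A \<kappa> i q f)"
    if "q \<in> fst \<kappa>" "c \<in> Rk DIM('e)"
    by (rule triv_eqI[OF lt that(1) tinv_fibre[OF lt that]]) (simp_all add: TM_simps cl[OF that(1)] val[OF that] triv_tinv[OF lt that])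
qed

text \<open>The differentials of the coordinates are the frame dual to the coordinate vectors;
  injectivity comes from \<open>cot_expand\<close>.\<close>

lemma cotM_local_triv:
  assumes "\<kappa> \<in> A"
  shows "local_triv (cotM A) (fst \<kappa>, DIM('e), cotM_triv \<kappa>)"
    "q \<in> fst \<kappa> \<Longrightarrow> c \<in> Rk DIM('e) \<Longrightarrow> tinv (cotM A) (cotM_triv \<kappa>) q c = (\<lambda>v. \<Sum>i<DIM('e). c i * differential A (coord_fun \<kappa> i) q v)"
proof -
  have cl: "(\<lambda>v. \<Sum>i<DIM('e). c i * differential A (coord_fun \<kappa> i) q v) \<in> cotangent_space A q" for q c
    by (rule cot_sum_closed) (rule differential_cot)
  have val: "cotM_triv \<kappa> q (\<lambda>v. \<Sum>i<DIM('e). c i * differential A (coord_fun \<kappa> i) q v) = c"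
    if q: "q \<in> fst \<kappa>" and c: "c \<in> Rk DIM('e)" for q c
  proof
    fix j
    have "(\<Sum>i<DIM('e). c i * differential A (coord_fun \<kappa> i) q (coord_vec A \<kappa> j q)) = (\<Sum>i<DIM('e). c i * (if i = j then 1 else 0))" if "j < DIM('e)"
      using coord_vec_coord_fun[OF assms q that] coord_vec_tangent[OF assms q] that by (intro sum.cong) (auto simp: differential_apply)
    then show "cotM_triv \<kappa> q (\<lambda>v. \<Sum>i<DIM('e). c i * differential A (coord_fun \<kappa> i) q v) j = c j"
      using c unfolding sum_delta_coord by (auto simp: cotM_triv_def Rk_def)
  qed
  have bij: "bij_betw (cotM_triv \<kappa> q) (cotangent_space A q) (Rk DIM('e))" if q: "q \<in> fst \<kappa>" for q
    unfolding bij_betw_def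
  proof
    show "inj_on (cotM_triv \<kappa> q) (cotangent_space A q)"
    proof (rule inj_onI)
      fix \<alpha> \<beta> assume a: "\<alpha> \<in> cotangent_space A q" and b: "\<beta> \<in> cotangent_space A q" and eq: "cotM_triv \<kappa> q \<alpha> = cotM_triv \<kappa> q \<beta>"
      have "\<alpha> (coord_vec A \<kappa> i q) = \<beta> (coord_vec A \<kappa> i q)" if "i < DIM('e)" for i
        using fun_cong[OF eq, of i] that by (simp add: cotM_triv_def)
      then show "\<alpha> = \<beta>"
        by (intro cot_eqI[OF a b]) (simp add: cot_expand[OF assms q] a b)
    qed
    show "cotM_triv \<kappa> q ` cotangent_space A q = Rk DIM('e)"
    proof (intro equalityI subsetI)
      fix c :: "nat \<Rightarrow> real" assume c: "c \<in> Rk DIM('e)"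
      show "c \<in> cotM_triv \<kappa> q ` cotangent_space A q"
        by (rule image_eqI[where f = "cotM_triv \<kappa> q", OF val[OF q c, symmetric]]) (rule cl)
    qed (auto simp: cotM_triv_def Rk_def)
  qed
  show lt: "local_triv (cotM A) (fst \<kappa>, DIM('e), cotM_triv \<kappa>)"
    using bij chart_open[OF assms] by (auto simp: local_triv_def cotM_simps cot_zero cot_plus cot_scale cotM_triv_def)
  show "tinv (cotM A) (cotM_triv \<kappa>) q c = (\<lambda>v. \<Sum>i<DIM('e). c i * differential A (coord_fun \<kappa> i) q v)"
    if "q \<in> fst \<kappa>" "c \<in> Rk DIM('e)"
    by (rule triv_eqI[OF lt that(1) tinv_fibre[OF lt that]]) (simp_all add: cotM_simps cl val[OF that] triv_tinv[OF lt that])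
qed

lemma chart_cover': obtains \<kappa> where "\<kappa> \<in> A" "p \<in> fst \<kappa>"
  using chart_cover[of p] by (metis fst_conv)

text \<open>The matrix entries of a transition are the derivatives of the coordinates of one chart
  along the coordinate vectors of the other.\<close>

lemma vector_bundle_TM: "vector_bundle A (TM A)"
proof -
  have "smooth_transition A (TM A) (fst \<kappa>, DIM('e), TM_triv \<kappa>) (fst \<mu>, DIM('e), TM_triv \<mu>)"
    if "\<kappa> \<in> A" "\<mu> \<in> A" for \<kappa> \<mu>
    unfolding smooth_transition_iff[OF chart_open[OF that(1)] chart_open[OF that(2)]]
  proof (intro ballI allI)
    fix c i p assume c: "c \<in> Rk DIM('e)" and p: "p \<in> fst \<kappa> \<inter> fst \<mu>"
    have "smooth_at A p (\<lambda>q. TM_triv \<mu> q (\<lambda>f. \<Sum>i<DIM('e). c i * coord_vec A \<kappa> i q f) i)"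
      using p smooth_at_const[of p 0] unfolding TM_triv_def
      by (cases "i < DIM('e)") (auto intro!: smooth_at_intros smooth_at_coord_vec smooth_at_coord_fun that)
    then show "smooth_at A p (\<lambda>q. TM_triv \<mu> q (tinv (TM A) (TM_triv \<kappa>) q c) i)"
      by (rule smooth_at_cong)
        (rule eventually_mono[OF eventually_nhds_in_open[OF chart_open[OF that(1)]]],
          use p TM_local_triv(2)[OF that(1) _ c] in auto)
  qed
  moreover have "(\<Union>(U, k, \<Phi>)\<in>trivs (TM A). U) = UNIV"
  proof -
    have "p \<in> (\<Union>(U, k, \<Phi>)\<in>trivs (TM A). U)" for p
    proof -
      obtain \<kappa> where "\<kappa> \<in> A" "p \<in> fst \<kappa>" by (rule chart_cover')
      then show ?thesis unfolding trivs_TM by blast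
    qed
    then show ?thesis by blast
  qed
  ultimately show ?thesis unfolding vector_bundle_def trivs_TM using TM_local_triv(1) by blast
qed

lemma vector_bundle_cotM: "vector_bundle A (cotM A)"
proof -
  have "smooth_transition A (cotM A) (fst \<kappa>, DIM('e), cotM_triv \<kappa>) (fst \<mu>, DIM('e), cotM_triv \<mu>)"
    if "\<kappa> \<in> A" "\<mu> \<in> A" for \<kappa> \<mu>
    unfolding smooth_transition_iff[OF chart_open[OF that(1)] chart_open[OF that(2)]]
  proof (intro ballI allI)
    fix c i p assume c: "c \<in> Rk DIM('e)" and p: "p \<in> fst \<kappa> \<inter> fst \<mu>"
    have "smooth_at A p (\<lambda>q. if i < DIM('e) then \<Sum>j<DIM('e). c j * coord_vec A \<mu> i q (coord_fun \<kappa> j) else 0)"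
      using p smooth_at_const[of p 0]
      by (cases "i < DIM('e)") (auto intro!: smooth_at_intros smooth_at_coord_vec smooth_at_coord_fun that)
    then show "smooth_at A p (\<lambda>q. cotM_triv \<mu> q (tinv (cotM A) (cotM_triv \<kappa>) q c) i)"
    proof (rule smooth_at_cong)
      have "\<forall>\<^sub>F q in nhds p. q \<in> fst \<kappa> \<inter> fst \<mu>"
        by (rule eventually_nhds_in_open[OF open_Int[OF chart_open[OF that(1)] chart_open[OF that(2)]] p])
      then show "\<forall>\<^sub>F q in nhds p. (if i < DIM('e) then \<Sum>j<DIM('e). c j * coord_vec A \<mu> i q (coord_fun \<kappa> j) else 0) =
          cotM_triv \<mu> q (tinv (cotM A) (cotM_triv \<kappa>) q c) i"
        by (rule eventually_mono)
          (auto simp: cotM_local_triv(2)[OF that(1) _ c] cotM_triv_def differential_apply coord_vec_tangent[OF that(2)])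
    qed
  qed
  moreover have "(\<Union>(U, k, \<Phi>)\<in>trivs (cotM A). U) = UNIV"
  proof -
    have "p \<in> (\<Union>(U, k, \<Phi>)\<in>trivs (cotM A). U)" for p
    proof -
      obtain \<kappa> where "\<kappa> \<in> A" "p \<in> fst \<kappa>" by (rule chart_cover')
      then show ?thesis unfolding trivs_cotM by blast
    qed
    then show ?thesis by blast
  qed
  ultimately show ?thesis unfolding vector_bundle_def trivs_cotM using cotM_local_triv(1) by blast
qed

lemma TM_smooth_triv: "\<kappa> \<in> A \<Longrightarrow> smooth_triv A (TM A) (fst \<kappa>, DIM('e), TM_triv \<kappa>)"
  by (rule vector_bundle_smooth_triv[OF vector_bundle_TM]) (use trivs_TM in blast)

lemma cotM_smooth_triv: "\<kappa> \<in> A \<Longrightarrow> smooth_triv A (cotM A) (fst \<kappa>, DIM('e), cotM_triv \<kappa>)"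
  by (rule vector_bundle_smooth_triv[OF vector_bundle_cotM]) (use trivs_cotM in blast)

section \<open>Vector fields and one-forms tested on global objects\<close>

lemma vf_tangent: "X \<in> vector_fields A \<Longrightarrow> X p \<in> tangent_space A p"
  using section_fibre[of X "TM A"] by (simp add: TM_simps)

lemma form_cot: "\<alpha> \<in> one_forms A \<Longrightarrow> \<alpha> p \<in> cotangent_space A p"
  using section_fibre[of \<alpha> "cotM A"] by (simp add: cotM_simps)

lemma vf_smooth_at:
  assumes X: "X \<in> vector_fields A" and f: "smooth_at A p f"
  shows "smooth_at A p (\<lambda>q. X q f)"
proof -
  obtain \<kappa> where \<kappa>: "\<kappa> \<in> A" "p \<in> fst \<kappa>" by (rule chart_cover')
  have "smooth_at A p (\<lambda>q. X q (coord_fun \<kappa> i))" if "i < DIM('e)" for i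
    using section_smooth[OF vector_bundle_TM X TM_smooth_triv[OF \<kappa>(1)] \<kappa>(2), of i] that by (simp add: TM_triv_def)
  then have "smooth_at A p (\<lambda>q. \<Sum>i<DIM('e). X q (coord_fun \<kappa> i) * coord_vec A \<kappa> i q f)"
    by (intro smooth_at_intros smooth_at_coord_vec[OF \<kappa> f]) auto
  then show ?thesis
  proof (rule smooth_at_cong)
    show "\<forall>\<^sub>F q in nhds p. (\<Sum>i<DIM('e). X q (coord_fun \<kappa> i) * coord_vec A \<kappa> i q f) = X q f"
      using smooth_at_eventually[OF f] eventually_nhds_in_open[OF chart_open[OF \<kappa>(1)] \<kappa>(2)]
      by eventually_elim (rule tangent_expand[OF \<kappa>(1) _ vf_tangent[OF X], symmetric])
  qed
qed

lemma vf_smooth: "X \<in> vector_fields A \<Longrightarrow> f \<in> smooth_funs A \<Longrightarrow> (\<lambda>q. X q f) \<in> smooth_funs A"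
  by (simp add: smooth_funs_iff vf_smooth_at)

text \<open>The coordinates of \<open>X\<close> are its values on coordinate functions, which are
  only local. A global function with the same germ at \<open>p\<close> also has the same germ at all
  nearby points \<open>q\<close>, where \<open>X q\<close> is evaluated.\<close>

lemma vfI:
  assumes t: "\<And>p. X p \<in> tangent_space A p" and s: "\<And>f. f \<in> smooth_funs A \<Longrightarrow> (\<lambda>q. X q f) \<in> smooth_funs A"
  shows "X \<in> vector_fields A"
proof (rule smooth_sectionI[OF vector_bundle_TM])
  show "X q \<in> fibre (TM A) q" for q using t by (simp add: TM_simps)
  fix p
  obtain \<kappa> where \<kappa>: "\<kappa> \<in> A" "p \<in> fst \<kappa>" by (rule chart_cover')
  have "smooth_at A p (\<lambda>q. TM_triv \<kappa> q (X q) i)" for i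
  proof (cases "i < DIM('e)")
    case True
    note c = smooth_at_coord_fun[OF \<kappa>, of i]
    obtain g where g: "g \<in> smooth_funs A" "\<forall>\<^sub>F q in nhds p. coord_fun \<kappa> i q = g q" using smooth_at_extend[OF c] .
    have "smooth_at A p (\<lambda>q. X q g)" using s[OF g(1)] by (rule smooth_at_smooth_funs)
    moreover have "\<forall>\<^sub>F q in nhds p. X q g = TM_triv \<kappa> q (X q) i"
      using eventually_eventually[THEN iffD2, OF g(2)] smooth_at_eventually[OF c]
    proof eventually_elim
      case (elim q)
      show ?case using tangent_spaceD(4)[OF t elim(2,1)] True by (simp add: TM_triv_def)
    qed
    ultimately show ?thesis by (rule smooth_at_cong)
  next
    case False
    then show ?thesis by (simp add: TM_triv_def smooth_at_const)
  qed
  with TM_smooth_triv[OF \<kappa>(1)] \<kappa>(2)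
  show "\<exists>U k \<Phi>. smooth_triv A (TM A) (U, k, \<Phi>) \<and> p \<in> U \<and> (\<forall>i. smooth_at A p (\<lambda>q. \<Phi> q (X q) i))" by blast
qed

lemma form_coord_smooth:
  assumes "\<alpha> \<in> one_forms A" "\<kappa> \<in> A" "p \<in> fst \<kappa>" "i < DIM('e)"
  shows "smooth_at A p (\<lambda>q. \<alpha> q (coord_vec A \<kappa> i q))"
  using section_smooth[OF vector_bundle_cotM assms(1) cotM_smooth_triv[OF assms(2)] assms(3), of i] assms(4)
  by (simp add: cotM_triv_def)

lemma form_smooth:
  assumes a: "\<alpha> \<in> one_forms A" and X: "X \<in> vector_fields A"
  shows "(\<lambda>q. \<alpha> q (X q)) \<in> smooth_funs A"
proof (rule smooth_funsI)
  fix p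
  obtain \<kappa> where \<kappa>: "\<kappa> \<in> A" "p \<in> fst \<kappa>" by (rule chart_cover')
  have "smooth_at A p (\<lambda>q. \<Sum>i<DIM('e). X q (coord_fun \<kappa> i) * \<alpha> q (coord_vec A \<kappa> i q))"
    by (intro smooth_at_intros vf_smooth_at[OF X] smooth_at_coord_fun[OF \<kappa>] form_coord_smooth[OF a \<kappa>]) auto
  then show "smooth_at A p (\<lambda>q. \<alpha> q (X q))"
  proof (rule smooth_at_cong)
    show "\<forall>\<^sub>F q in nhds p. (\<Sum>i<DIM('e). X q (coord_fun \<kappa> i) * \<alpha> q (coord_vec A \<kappa> i q)) = \<alpha> q (X q)"
      using eventually_nhds_in_open[OF chart_open[OF \<kappa>(1)] \<kappa>(2)]
      by eventually_elim (rule cot_expand[OF \<kappa>(1) _ form_cot[OF a] vf_tangent[OF X], symmetric])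
  qed
qed

text \<open>Dual to \<open>vfI\<close>: near \<open>p\<close> the coordinate vectors agree with
  global fields, so the coordinates of \<open>\<alpha>\<close> are values on global fields.\<close>

lemma formI:
  assumes t: "\<And>p. \<alpha> p \<in> cotangent_space A p" and s: "\<And>X. X \<in> vector_fields A \<Longrightarrow> (\<lambda>q. \<alpha> q (X q)) \<in> smooth_funs A"
  shows "\<alpha> \<in> one_forms A"
proof (rule smooth_sectionI[OF vector_bundle_cotM])
  show "\<alpha> q \<in> fibre (cotM A) q" for q using t by (simp add: cotM_simps)
  fix p
  obtain \<kappa> where \<kappa>: "\<kappa> \<in> A" "p \<in> fst \<kappa>" by (rule chart_cover')
  have "smooth_at A p (\<lambda>q. cotM_triv \<kappa> q (\<alpha> q) i)" for i
  proof (cases "i < DIM('e)")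
    case True
    define c where "c = (\<lambda>j. if j = i then 1 else 0 :: real)"
    have c: "c \<in> Rk DIM('e)" unfolding c_def by (rule Rk_unit[OF True])
    obtain X where X: "X \<in> vector_fields A" "\<forall>\<^sub>F q in nhds p. X q = tinv (TM A) (TM_triv \<kappa>) q c"
      using extend_section[OF vector_bundle_TM TM_smooth_triv[OF \<kappa>(1)] \<kappa>(2) c] by metis
    have "\<forall>\<^sub>F q in nhds p. \<alpha> q (X q) = cotM_triv \<kappa> q (\<alpha> q) i"
      using X(2) eventually_nhds_in_open[OF chart_open[OF \<kappa>(1)] \<kappa>(2)]
    proof eventually_elim
      case (elim q)
      have "(\<lambda>f. \<Sum>j<DIM('e). c j * coord_vec A \<kappa> j q f) = coord_vec A \<kappa> i q"
        using True by (simp add: c_def sum.delta if_distrib[of "\<lambda>x. x * _"] cong: if_cong)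
      then show ?case using elim True TM_local_triv(2)[OF \<kappa>(1) elim(2) c] by (simp add: cotM_triv_def)
    qed
    with smooth_at_smooth_funs[OF s[OF X(1)]] show ?thesis by (rule smooth_at_cong)
  next
    case False
    then show ?thesis by (simp add: cotM_triv_def smooth_at_const)
  qed
  with cotM_smooth_triv[OF \<kappa>(1)] \<kappa>(2)
  show "\<exists>U k \<Phi>. smooth_triv A (cotM A) (U, k, \<Phi>) \<and> p \<in> U \<and> (\<forall>i. smooth_at A p (\<lambda>q. \<Phi> q (\<alpha> q) i))" by blast
qed

lemma vf_through:
  assumes "v \<in> tangent_space A p"
  obtains X where "X \<in> vector_fields A" "X p = v"
  using section_through[OF vector_bundle_TM, of v p] assms by (auto simp: TM_simps)

lemma form_eqI:
  assumes "\<alpha> p \<in> cotangent_space A p" "\<beta> p \<in> cotangent_space A p" "\<And>Y. Y \<in> vector_fields A \<Longrightarrow> \<alpha> p (Y p) = \<beta> p (Y p)"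
  shows "\<alpha> p = \<beta> p"
  by (rule cot_eqI[OF assms(1,2)]) (metis assms(3) vf_through)

lemma differential_form: "f \<in> smooth_funs A \<Longrightarrow> differential A f \<in> one_forms A"
  by (rule formI) (simp_all add: differential_cot differential_apply vf_tangent vf_smooth)

lemma vf_add: "X \<in> vector_fields A \<Longrightarrow> Y \<in> vector_fields A \<Longrightarrow> (\<lambda>q f. X q f + Y q f) \<in> vector_fields A"
  using smooth_sections_sadd[OF vector_bundle_TM] by (simp add: sadd_def TM_simps)

lemma vf_smul: "h \<in> smooth_funs A \<Longrightarrow> X \<in> vector_fields A \<Longrightarrow> (\<lambda>q f. h q * X q f) \<in> vector_fields A"
  using smooth_sections_smul[OF vector_bundle_TM] by (simp add: smul_def TM_simps)

lemma form_add: "\<alpha> \<in> one_forms A \<Longrightarrow> \<beta> \<in> one_forms A \<Longrightarrow> (\<lambda>q v. \<alpha> q v + \<beta> q v) \<in> one_forms A"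
  using smooth_sections_sadd[OF vector_bundle_cotM] by (simp add: sadd_def cotM_simps)

lemma form_smul: "h \<in> smooth_funs A \<Longrightarrow> \<alpha> \<in> one_forms A \<Longrightarrow> (\<lambda>q v. h q * \<alpha> q v) \<in> one_forms A"
  using smooth_sections_smul[OF vector_bundle_cotM] by (simp add: smul_def cotM_simps)

lemma smooth_funs_intros:
  "(\<lambda>q. c) \<in> smooth_funs A"
  "f \<in> smooth_funs A \<Longrightarrow> g \<in> smooth_funs A \<Longrightarrow> (\<lambda>q. f q + g q) \<in> smooth_funs A"
  "f \<in> smooth_funs A \<Longrightarrow> g \<in> smooth_funs A \<Longrightarrow> (\<lambda>q. f q - g q) \<in> smooth_funs A"
  "f \<in> smooth_funs A \<Longrightarrow> g \<in> smooth_funs A \<Longrightarrow> (\<lambda>q. f q * g q) \<in> smooth_funs A"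
  by (simp_all add: smooth_funs_iff smooth_at_intros)

lemma vf_zero: "(\<lambda>q f. 0) \<in> vector_fields A"
  by (rule vfI) (simp_all add: tangent_zero smooth_funs_intros)

lemma form_zero: "(\<lambda>q v. 0) \<in> one_forms A"
  by (rule formI) (simp_all add: cot_zero smooth_funs_intros)

lemma form_sum: "(\<And>i. i \<in> I \<Longrightarrow> \<alpha> i \<in> one_forms A) \<Longrightarrow> (\<lambda>q v. \<Sum>i\<in>I. \<alpha> i q v) \<in> one_forms A"
  by (induction I rule: infinite_finite_induct) (simp_all add: form_zero form_add)

lemma vf_sum: "(\<And>i. i \<in> I \<Longrightarrow> X i \<in> vector_fields A) \<Longrightarrow> (\<lambda>q f. \<Sum>i\<in>I. X i q f) \<in> vector_fields A"
  by (induction I rule: infinite_finite_induct) (simp_all add: vf_zero vf_add)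

text \<open>With a bump function \<open>\<eta>\<close> at \<open>p\<close>, split \<open>X = \<eta>\<^sup>2 X + (1 - \<eta>\<^sup>2) X\<close>, where \<open>\<eta>\<^sup>2 X\<close> is a combination of
  the global vector fields \<open>\<eta> \<partial>\<^sub>i\<close> with the global coefficients \<open>\<eta> X(x\<^sub>i)\<close>.\<close>

lemma tensorial_vanishes:
  fixes T :: "('m \<Rightarrow> 'm tvec) \<Rightarrow> real"
  assumes add: "\<And>X Y. X \<in> vector_fields A \<Longrightarrow> Y \<in> vector_fields A \<Longrightarrow> T (\<lambda>q f. X q f + Y q f) = T X + T Y"
    and smul: "\<And>h X. h \<in> smooth_funs A \<Longrightarrow> X \<in> vector_fields A \<Longrightarrow> T (\<lambda>q f. h q * X q f) = h p * T X"
    and X: "X \<in> vector_fields A" and zero: "X p = (\<lambda>f. 0)"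
  shows "T X = 0"
proof -
  obtain \<kappa> where \<kappa>: "\<kappa> \<in> A" "p \<in> fst \<kappa>" by (rule chart_cover')
  obtain \<eta> K where \<eta>: "\<eta> \<in> smooth_funs A" "\<forall>\<^sub>F q in nhds p. \<eta> q = 1" "closed K" "K \<subseteq> fst \<kappa>" "\<And>q. q \<notin> K \<Longrightarrow> \<eta> q = 0"
    using bump[OF chart_open[OF \<kappa>(1)] \<kappa>(2)] by metis
  have \<eta>p: "\<eta> p = 1" using eventually_nhds_x_imp_x[OF \<eta>(2)] .
  define E where "E i q f = \<eta> q * coord_vec A \<kappa> i q f" for i q f
  define a where "a i q = \<eta> q * X q (coord_fun \<kappa> i)" for i q
  have E: "E i \<in> vector_fields A" for i
  proof (rule vfI)
    \<comment> \<open>Off \<open>K\<close> the coordinate vector need not be tangent, but there the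
      factor \<open>\<eta> q\<close> is 0.\<close>
    show "E i q \<in> tangent_space A q" for q
      using tangent_scale[OF coord_vec_tangent[OF \<kappa>(1), of q i], of "\<eta> q"] tangent_zero \<eta>(4,5)
      by (cases "q \<in> K") (auto simp: E_def[abs_def])
    show "(\<lambda>q. E i q f) \<in> smooth_funs A" if "f \<in> smooth_funs A" for f
      unfolding E_def using \<eta>(4) that
      by (intro smooth_at_cutoff[OF \<eta>(1,3,5)] smooth_at_coord_vec[OF \<kappa>(1)]) (auto simp: smooth_funs_iff)
  qed
  have a: "a i \<in> smooth_funs A" for i
    unfolding a_def[abs_def] using \<eta>(4)
    by (intro smooth_at_cutoff[OF \<eta>(1,3,5)] vf_smooth_at[OF X] smooth_at_coord_fun[OF \<kappa>(1)]) auto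
  have aE: "(\<lambda>q f. a i q * E i q f) \<in> vector_fields A" for i by (rule vf_smul[OF a E])
  have T_sum: "T (\<lambda>q f. \<Sum>i\<in>I. a i q * E i q f) = 0" for I :: "nat set"
  proof (induction I rule: infinite_finite_induct)
    case (insert i I)
    then show ?case using add[OF aE[of i] vf_sum[where I = I and X = "\<lambda>i q f. a i q * E i q f", OF aE]] smul[OF a E, of i i] zero by (simp add: a_def)
  qed (use smul[OF smooth_funs_intros(1) vf_zero, of 0] in auto)
  have \<eta>2: "(\<lambda>q. \<eta> q * \<eta> q) \<in> smooth_funs A" "(\<lambda>q. 1 - \<eta> q * \<eta> q) \<in> smooth_funs A"
    by (intro smooth_funs_intros \<eta>)+
  have "(\<lambda>q f. \<eta> q * \<eta> q * X q f) = (\<lambda>q f. \<Sum>i<DIM('e). a i q * E i q f)"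
  proof (intro ext)
    fix q f
    show "\<eta> q * \<eta> q * X q f = (\<Sum>i<DIM('e). a i q * E i q f)"
    proof (cases "q \<in> K")
      case True
      then have q: "q \<in> fst \<kappa>" using \<eta>(4) by blast
      show ?thesis
      \<comment> \<open>The expansion in coordinate vectors is for smooth germs; on other functions
        both sides are 0 by convention.\<close>
      proof (cases "smooth_at A q f")
        case True
        then show ?thesis
          using tangent_expand[OF \<kappa>(1) q vf_tangent[OF X] True] by (simp add: a_def E_def sum_distrib_left mult_ac)
      next
        case False
        then show ?thesis using tangent_spaceD(5)[OF vf_tangent[OF X] False] tangent_spaceD(5)[OF coord_vec_tangent[OF \<kappa>(1) q] False]
          by (simp add: E_def)
      qed
    qed (simp add: \<eta>(5) a_def)
  qed
  then have "T (\<lambda>q f. \<eta> q * \<eta> q * X q f) = 0" using T_sum by simp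
  moreover have "T (\<lambda>q f. (1 - \<eta> q * \<eta> q) * X q f) = 0" using smul[OF \<eta>2(2) X] \<eta>p by simp
  moreover have "T X = T (\<lambda>q f. \<eta> q * \<eta> q * X q f) + T (\<lambda>q f. (1 - \<eta> q * \<eta> q) * X q f)"
    using add[OF vf_smul[OF \<eta>2(1) X] vf_smul[OF \<eta>2(2) X]] by (simp add: algebra_simps)
  ultimately show ?thesis by simp
qed

text \<open>By \<open>tensorial_vanishes\<close>, \<open>T X\<close> depends only on
  \<open>X p\<close>. Every tangent vector is the value of a global field, so \<open>T\<close>
  descends to the tangent space at \<open>p\<close>.\<close>

lemma tensorial_covector:
  fixes T :: "('m \<Rightarrow> 'm tvec) \<Rightarrow> real"
  assumes add: "\<And>X Y. X \<in> vector_fields A \<Longrightarrow> Y \<in> vector_fields A \<Longrightarrow> T (\<lambda>q f. X q f + Y q f) = T X + T Y"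
    and smul: "\<And>h X. h \<in> smooth_funs A \<Longrightarrow> X \<in> vector_fields A \<Longrightarrow> T (\<lambda>q f. h q * X q f) = h p * T X"
  obtains \<gamma> where "\<gamma> \<in> cotangent_space A p" "\<And>X. X \<in> vector_fields A \<Longrightarrow> \<gamma> (X p) = T X"
proof -
  have eq: "T X = T Y" if X: "X \<in> vector_fields A" and Y: "Y \<in> vector_fields A" and p: "X p = Y p" for X Y
  proof -
    have mY: "(\<lambda>q f. (- 1) * Y q f) \<in> vector_fields A" by (rule vf_smul[OF smooth_funs_intros(1) Y])
    have "T (\<lambda>q f. X q f + (- 1) * Y q f) = 0"
      by (rule tensorial_vanishes[OF add smul vf_add[OF X mY]]) (simp_all add: p)
    then show ?thesis using add[OF X mY] smul[OF smooth_funs_intros(1) Y, of "- 1"] by simp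
  qed
  define \<gamma> where "\<gamma> v = (if v \<in> tangent_space A p then T (SOME X. X \<in> vector_fields A \<and> X p = v) else 0)" for v
  have \<gamma>: "\<gamma> (X p) = T X" if X: "X \<in> vector_fields A" for X
  proof -
    have "\<exists>Y. Y \<in> vector_fields A \<and> Y p = X p" using X by blast
    from someI_ex[OF this] show ?thesis using eq[OF _ X] vf_tangent[OF X] by (simp add: \<gamma>_def)
  qed
  have "\<gamma> \<in> cotangent_space A p"
  proof (rule cotI)
    fix u v assume "u \<in> tangent_space A p" "v \<in> tangent_space A p"
    then obtain X Y where XY: "X \<in> vector_fields A" "X p = u" "Y \<in> vector_fields A" "Y p = v" by (metis vf_through)
    then show "\<gamma> (\<lambda>f. u f + v f) = \<gamma> u + \<gamma> v"
      using \<gamma>[OF vf_add[OF XY(1,3)]] \<gamma>[OF XY(1)] \<gamma>[OF XY(3)] add[OF XY(1,3)] by simp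
  next
    fix v c assume "v \<in> tangent_space A p"
    then obtain X where X: "X \<in> vector_fields A" "X p = v" by (metis vf_through)
    then show "\<gamma> (\<lambda>f. c * v f) = c * \<gamma> v"
      using \<gamma>[OF vf_smul[OF smooth_funs_intros(1) X(1)], of c] \<gamma>[OF X(1)] smul[OF smooth_funs_intros(1) X(1), of c] by simp
  qed (simp add: \<gamma>_def)
  then show ?thesis using \<gamma> that by blast
qed

text \<open>Since \<open>\<eta>\<^sup>2 dx\<^sub>i = \<eta> d(\<eta> x\<^sub>i) - \<eta> x\<^sub>i d\<eta>\<close>, the form \<open>\<eta>\<^sup>3 \<alpha>\<close> is a combination of differentials of global functions.\<close>

lemma tensorial_form_vanishes:
  fixes T :: "('m \<Rightarrow> 'm covec) \<Rightarrow> real"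
  assumes add: "\<And>\<alpha> \<beta>. \<alpha> \<in> one_forms A \<Longrightarrow> \<beta> \<in> one_forms A \<Longrightarrow> T (\<lambda>q v. \<alpha> q v + \<beta> q v) = T \<alpha> + T \<beta>"
    and smul: "\<And>h \<alpha>. h \<in> smooth_funs A \<Longrightarrow> \<alpha> \<in> one_forms A \<Longrightarrow> T (\<lambda>q v. h q * \<alpha> q v) = h p * T \<alpha>"
    and exact: "\<And>g. g \<in> smooth_funs A \<Longrightarrow> T (differential A g) = 0"
    and a: "\<alpha> \<in> one_forms A"
  shows "T \<alpha> = 0"
proof -
  obtain \<kappa> where \<kappa>: "\<kappa> \<in> A" "p \<in> fst \<kappa>" by (rule chart_cover')
  obtain \<eta> K where \<eta>: "\<eta> \<in> smooth_funs A" "\<forall>\<^sub>F q in nhds p. \<eta> q = 1" "closed K" "K \<subseteq> fst \<kappa>" "\<And>q. q \<notin> K \<Longrightarrow> \<eta> q = 0"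
    using bump[OF chart_open[OF \<kappa>(1)] \<kappa>(2)] by metis
  have \<eta>p: "\<eta> p = 1" using eventually_nhds_x_imp_x[OF \<eta>(2)] .
  define x where "x i q = \<eta> q * coord_fun \<kappa> i q" for i q
  define c where "c i q = \<eta> q * \<alpha> q (coord_vec A \<kappa> i q)" for i q
  define b where "b i q v = c i q * (\<eta> q * differential A (x i) q v + (- x i q) * differential A \<eta> q v)" for i q v
  have x: "x i \<in> smooth_funs A" for i
    unfolding x_def[abs_def] using \<eta>(4) by (intro smooth_at_cutoff[OF \<eta>(1,3,5)] smooth_at_coord_fun[OF \<kappa>(1)]) auto
  have c: "c i \<in> smooth_funs A" if "i < DIM('e)" for i
    unfolding c_def[abs_def] using \<eta>(4) that by (intro smooth_at_cutoff[OF \<eta>(1,3,5)] form_coord_smooth[OF a \<kappa>(1)]) auto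
  have mx: "(\<lambda>q. - x i q) \<in> smooth_funs A" for i using smooth_funs_intros(3)[OF smooth_funs_intros(1)[of 0] x] by simp
  note forms = form_smul[OF \<eta>(1) differential_form[OF x]] form_smul[OF mx differential_form[OF \<eta>(1)]]
  have b: "b i \<in> one_forms A" and Tb: "T (b i) = 0" if "i < DIM('e)" for i
  proof -
    show "b i \<in> one_forms A" unfolding b_def[abs_def] by (intro form_smul[OF c[OF that]] form_add forms)
    have "T (b i) = c i p * T (\<lambda>q v. \<eta> q * differential A (x i) q v + (- x i q) * differential A \<eta> q v)"
      unfolding b_def[abs_def] by (rule smul[OF c[OF that] form_add[OF forms]])
    also have "T (\<lambda>q v. \<eta> q * differential A (x i) q v + (- x i q) * differential A \<eta> q v) = 0"
      using add[OF forms, of i i] smul[OF \<eta>(1) differential_form[OF x], of i] smul[OF mx differential_form[OF \<eta>(1)], of i]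
        exact[OF x, of i] exact[OF \<eta>(1)] by simp
    finally show "T (b i) = 0" by simp
  qed
  have T_sum: "T (\<lambda>q v. \<Sum>i\<in>I. b i q v) = 0" if "I \<subseteq> {..<DIM('e)}" for I
    using that
  proof (induction I rule: infinite_finite_induct)
    case (insert i I)
    then show ?case using add[OF b[of i] form_sum[of I b]] b Tb[of i] by auto
  qed (use smul[OF smooth_funs_intros(1) form_zero, of 0] in auto)
  have \<eta>3: "(\<lambda>q. \<eta> q * (\<eta> q * \<eta> q)) \<in> smooth_funs A" "(\<lambda>q. 1 - \<eta> q * (\<eta> q * \<eta> q)) \<in> smooth_funs A"
    by (intro smooth_funs_intros \<eta>)+
  have "(\<lambda>q v. \<eta> q * (\<eta> q * \<eta> q) * \<alpha> q v) = (\<lambda>q v. \<Sum>i<DIM('e). b i q v)"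
  proof (intro ext)
    fix q v
    consider "q \<notin> K" | "v \<notin> tangent_space A q" | "q \<in> K" "v \<in> tangent_space A q" by blast
    then show "\<eta> q * (\<eta> q * \<eta> q) * \<alpha> q v = (\<Sum>i<DIM('e). b i q v)"
    proof cases
      case 3
      then have q: "q \<in> fst \<kappa>" using \<eta>(4) by blast
      have "differential A (x i) q v = v \<eta> * coord_fun \<kappa> i q + \<eta> q * v (coord_fun \<kappa> i)" for i
        using tangent_spaceD(2)[OF 3(2) smooth_at_smooth_funs[OF \<eta>(1)] smooth_at_coord_fun[OF \<kappa>(1) q]]
        by (simp add: differential_apply[OF 3(2)] x_def[abs_def])
      then have "b i q v = \<eta> q * (\<eta> q * \<eta> q) * (v (coord_fun \<kappa> i) * \<alpha> q (coord_vec A \<kappa> i q))" for i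
        by (simp add: b_def c_def x_def differential_apply[OF 3(2)] algebra_simps)
      then show ?thesis using cot_expand[OF \<kappa>(1) q form_cot[OF a] 3(2)] by (simp add: sum_distrib_left)
    qed (simp_all add: b_def c_def \<eta>(5) differential_def cot_D(3)[OF form_cot[OF a]])
  qed
  then have "T (\<lambda>q v. \<eta> q * (\<eta> q * \<eta> q) * \<alpha> q v) = 0" using T_sum[of "{..<DIM('e)}"] by simp
  moreover have "T (\<lambda>q v. (1 - \<eta> q * (\<eta> q * \<eta> q)) * \<alpha> q v) = 0" using smul[OF \<eta>3(2) a] \<eta>p by simp
  moreover have "T \<alpha> = T (\<lambda>q v. \<eta> q * (\<eta> q * \<eta> q) * \<alpha> q v) + T (\<lambda>q v. (1 - \<eta> q * (\<eta> q * \<eta> q)) * \<alpha> q v)"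
    using add[OF form_smul[OF \<eta>3(1) a] form_smul[OF \<eta>3(2) a]] by (simp add: algebra_simps)
  ultimately show ?thesis by simp
qed

end

section \<open>Lie brackets and Lie derivatives of vector fields and forms\<close>

context smooth_mfd begin

text \<open>Every germ has a global representative, so sums and products are only checked on
  \<open>smooth_funs\<close>; homogeneity is the product rule with a constant. This suits
  \<open>lie_bracket\<close>, where the function is differentiated twice.\<close>

lemma tangentI_global:
  assumes add: "\<And>f g. f \<in> smooth_funs A \<Longrightarrow> g \<in> smooth_funs A \<Longrightarrow> v (\<lambda>x. f x + g x) = v f + v g"
    and mult: "\<And>f g. f \<in> smooth_funs A \<Longrightarrow> g \<in> smooth_funs A \<Longrightarrow> v (\<lambda>x. f x * g x) = v f * g p + f p * v g"
    and germ: "\<And>f g. smooth_at A p f \<Longrightarrow> smooth_at A p g \<Longrightarrow> \<forall>\<^sub>F x in nhds p. f x = g x \<Longrightarrow> v f = v g"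
    and out: "\<And>f. \<not> smooth_at A p f \<Longrightarrow> v f = 0"
    and const: "\<And>c. v (\<lambda>x. c) = 0"
  shows "v \<in> tangent_space A p"
proof -
  have rep: "\<exists>f'\<in>smooth_funs A. (\<forall>\<^sub>F x in nhds p. f x = f' x) \<and> v f = v f' \<and> f p = f' p" if f: "smooth_at A p f" for f
  proof -
    obtain f' where f': "f' \<in> smooth_funs A" "\<forall>\<^sub>F x in nhds p. f x = f' x" by (rule smooth_at_extend[OF f])
    then show ?thesis using germ[OF f smooth_at_smooth_funs[OF f'(1)] f'(2)] eventually_nhds_x_imp_x[OF f'(2)] by blast
  qed
  have sum: "v (\<lambda>x. f x + g x) = v f + v g" and prod: "v (\<lambda>x. f x * g x) = v f * g p + f p * v g"
    if f: "smooth_at A p f" and g: "smooth_at A p g" for f g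
  proof -
    obtain f' where f': "f' \<in> smooth_funs A" "\<forall>\<^sub>F x in nhds p. f x = f' x" "v f = v f'" "f p = f' p" using rep[OF f] by blast
    obtain g' where g': "g' \<in> smooth_funs A" "\<forall>\<^sub>F x in nhds p. g x = g' x" "v g = v g'" "g p = g' p" using rep[OF g] by blast
    have e: "\<forall>\<^sub>F x in nhds p. f x + g x = f' x + g' x" "\<forall>\<^sub>F x in nhds p. f x * g x = f' x * g' x"
      using f'(2) g'(2) by (eventually_elim, simp)+
    note s = smooth_at_smooth_funs[OF smooth_funs_intros(2)[OF f'(1) g'(1)]]
      smooth_at_smooth_funs[OF smooth_funs_intros(4)[OF f'(1) g'(1)]]
    show "v (\<lambda>x. f x + g x) = v f + v g"
      using germ[OF smooth_at_add[OF f g] s(1) e(1)] add[OF f'(1) g'(1)] f'(3) g'(3) by simp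
    show "v (\<lambda>x. f x * g x) = v f * g p + f p * v g"
      using germ[OF smooth_at_mult[OF f g] s(2) e(2)] mult[OF f'(1) g'(1)] f'(3,4) g'(3,4) by simp
  qed
  show ?thesis unfolding tangent_space_def mem_Collect_eq
  proof (intro conjI allI impI)
    fix f c assume "smooth_at A p f"
    from prod[OF smooth_at_const[of p c] this] show "v (\<lambda>x. c * f x) = c * v f" by (simp add: const)
  qed (fact sum prod germ out)+
qed

lemma lie_bracket_apply:
  "f \<in> smooth_funs A \<Longrightarrow> lie_bracket A X Y p f = X p (\<lambda>q. Y q f) - Y p (\<lambda>q. X q f)"
  by (simp add: lie_bracket_def smooth_at_smooth_funs)

lemma vf_comp_add:
  "X \<in> vector_fields A \<Longrightarrow> f \<in> smooth_funs A \<Longrightarrow> g \<in> smooth_funs A \<Longrightarrow> X q (\<lambda>x. f x + g x) = X q f + X q g"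
  by (rule tangent_spaceD(1)[OF vf_tangent]) (auto intro: smooth_at_smooth_funs)

lemma vf_comp_mult:
  "X \<in> vector_fields A \<Longrightarrow> f \<in> smooth_funs A \<Longrightarrow> g \<in> smooth_funs A \<Longrightarrow> X q (\<lambda>x. f x * g x) = X q f * g q + f q * X q g"
  by (rule tangent_spaceD(2)[OF vf_tangent]) (auto intro: smooth_at_smooth_funs)

lemma lie_bracket_tangent:
  assumes X: "X \<in> vector_fields A" and Y: "Y \<in> vector_fields A"
  shows "lie_bracket A X Y p \<in> tangent_space A p"
proof (rule tangentI_global)
  fix f g assume f: "f \<in> smooth_funs A" and g: "g \<in> smooth_funs A"
  note s = vf_smooth[OF X f] vf_smooth[OF X g] vf_smooth[OF Y f] vf_smooth[OF Y g]
  show "lie_bracket A X Y p (\<lambda>x. f x + g x) = lie_bracket A X Y p f + lie_bracket A X Y p g"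
    using f g s
    by (simp add: lie_bracket_apply smooth_funs_intros vf_comp_add[OF X] vf_comp_add[OF Y])
  \<comment> \<open>The mixed products \<open>X f * Y g\<close> and \<open>Y f * X g\<close> cancel
    in the commutator.\<close>
  show "lie_bracket A X Y p (\<lambda>x. f x * g x) = lie_bracket A X Y p f * g p + f p * lie_bracket A X Y p g"
    using f g s
    by (simp add: lie_bracket_apply smooth_funs_intros vf_comp_mult[OF X] vf_comp_mult[OF Y]
        vf_comp_add[OF X] vf_comp_add[OF Y] algebra_simps)
next
  fix f g assume f: "smooth_at A p f" and g: "smooth_at A p g" and ev: "\<forall>\<^sub>F x in nhds p. f x = g x"
  \<comment> \<open>The function \<open>Z q f\<close> of \<open>q\<close> is differentiated once
    more, so \<open>f\<close> and \<open>g\<close> have to be compared as germs at all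
    \<open>q\<close> near \<open>p\<close>.\<close>
  have e: "\<forall>\<^sub>F q in nhds p. Z q f = Z q g" if Z: "Z \<in> vector_fields A" for Z
    using eventually_eventually[THEN iffD2, OF ev] smooth_at_eventually[OF f]
  proof eventually_elim
    case (elim q)
    show ?case using tangent_spaceD(4)[OF vf_tangent[OF Z] elim(2,1)] .
  qed
  show "lie_bracket A X Y p f = lie_bracket A X Y p g"
    using tangent_spaceD(4)[OF vf_tangent[OF X] vf_smooth_at[OF Y f] e[OF Y]]
      tangent_spaceD(4)[OF vf_tangent[OF Y] vf_smooth_at[OF X f] e[OF X]] f g
    by (simp add: lie_bracket_def)
next
  fix c :: real
  have "(\<lambda>q. Z q (\<lambda>x. c)) = (\<lambda>q. 0)" if "Z \<in> vector_fields A" for Z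
    using tangent_const[OF vf_tangent[OF that]] by simp
  with X Y show "lie_bracket A X Y p (\<lambda>x. c) = 0"
    by (simp add: lie_bracket_apply smooth_funs_intros tangent_const[OF vf_tangent])
qed (simp add: lie_bracket_def)

lemma lie_bracket_vf:
  assumes X: "X \<in> vector_fields A" and Y: "Y \<in> vector_fields A"
  shows "lie_bracket A X Y \<in> vector_fields A"
proof (rule vfI)
  show "(\<lambda>q. lie_bracket A X Y q f) \<in> smooth_funs A" if "f \<in> smooth_funs A" for f
    using vf_smooth[OF X vf_smooth[OF Y that]] vf_smooth[OF Y vf_smooth[OF X that]] that
    by (simp add: lie_bracket_apply smooth_funs_intros)
qed (rule lie_bracket_tangent[OF X Y])

lemma lie_bracket_skew: "lie_bracket A Y X p = (\<lambda>f. (- 1) * lie_bracket A X Y p f)"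
  by (simp add: lie_bracket_def fun_eq_iff)

lemma lie_bracket_add_right:
  assumes X: "X \<in> vector_fields A" and Y: "Y \<in> vector_fields A" and Z: "Z \<in> vector_fields A"
  shows "lie_bracket A X (\<lambda>q f. Y q f + Z q f) p = (\<lambda>f. lie_bracket A X Y p f + lie_bracket A X Z p f)"
proof (rule tangent_eqI[where p = p])
  fix f assume f: "f \<in> smooth_funs A"
  show "lie_bracket A X (\<lambda>q f. Y q f + Z q f) p f = lie_bracket A X Y p f + lie_bracket A X Z p f"
    using f by (simp add: lie_bracket_apply vf_comp_add[OF X vf_smooth[OF Y f] vf_smooth[OF Z f]])
qed (intro tangent_plus lie_bracket_tangent vf_add X Y Z)+

lemma lie_bracket_smul_right:
  assumes X: "X \<in> vector_fields A" and Y: "Y \<in> vector_fields A" and h: "h \<in> smooth_funs A"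
  shows "lie_bracket A X (\<lambda>q f. h q * Y q f) p = (\<lambda>f. h p * lie_bracket A X Y p f + X p h * Y p f)"
proof (rule tangent_eqI[where p = p])
  fix f assume f: "f \<in> smooth_funs A"
  show "lie_bracket A X (\<lambda>q f. h q * Y q f) p f = h p * lie_bracket A X Y p f + X p h * Y p f"
    using f by (simp add: lie_bracket_apply vf_comp_mult[OF X h vf_smooth[OF Y f]] algebra_simps)
qed (intro tangent_plus tangent_scale lie_bracket_tangent vf_smul h X Y vf_tangent)+

lemma lie_bracket_smul_left:
  assumes X: "X \<in> vector_fields A" and Y: "Y \<in> vector_fields A" and h: "h \<in> smooth_funs A"
  shows "lie_bracket A (\<lambda>q f. h q * X q f) Y p = (\<lambda>f. h p * lie_bracket A X Y p f + (- Y p h) * X p f)"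
  using lie_bracket_smul_right[OF Y X h, of p]
  by (simp add: lie_bracket_skew[of "\<lambda>q f. h q * X q f" Y] lie_bracket_skew[of X Y] fun_eq_iff algebra_simps)

lemma lie_bracket_add_left:
  assumes X: "X \<in> vector_fields A" and Y: "Y \<in> vector_fields A" and Z: "Z \<in> vector_fields A"
  shows "lie_bracket A (\<lambda>q f. X q f + Z q f) Y p = (\<lambda>f. lie_bracket A X Y p f + lie_bracket A Z Y p f)"
  using lie_bracket_add_right[OF Y X Z, of p]
  by (simp add: lie_bracket_skew[of "\<lambda>q f. X q f + Z q f" Y] lie_bracket_skew[of X Y] lie_bracket_skew[of Z Y] fun_eq_iff)

text \<open>In \<open>T (h Y)\<close> the term \<open>X h * \<beta>(Y)\<close> from differentiating
  \<open>h * \<beta>(Y)\<close> cancels the one from \<open>[X, h Y]\<close>. So the defining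
  expression is tensorial in \<open>Y\<close>, and exactly one covector satisfies the definite
  description.\<close>

lemma lie_derivative:
  assumes X: "X \<in> vector_fields A" and b: "\<beta> \<in> one_forms A"
  shows "lie_derivative A X \<beta> p \<in> cotangent_space A p"
    "Y \<in> vector_fields A \<Longrightarrow> lie_derivative A X \<beta> p (Y p) = X p (\<lambda>q. \<beta> q (Y q)) - \<beta> p (lie_bracket A X Y p)"
proof -
  define T where "T Y = X p (\<lambda>q. \<beta> q (Y q)) - \<beta> p (lie_bracket A X Y p)" for Y
  have add: "T (\<lambda>q f. Y q f + Z q f) = T Y + T Z" if Y: "Y \<in> vector_fields A" and Z: "Z \<in> vector_fields A" for Y Z
    using cot_D(1)[OF form_cot[OF b] vf_tangent[OF Y] vf_tangent[OF Z]]
      vf_comp_add[OF X form_smooth[OF b Y] form_smooth[OF b Z]]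
      cot_D(1)[OF form_cot[OF b] lie_bracket_tangent[OF X Y] lie_bracket_tangent[OF X Z]]
    by (simp add: T_def lie_bracket_add_right[OF X Y Z])
  have smul: "T (\<lambda>q f. h q * Y q f) = h p * T Y" if h: "h \<in> smooth_funs A" and Y: "Y \<in> vector_fields A" for h Y
    using cot_D(2)[OF form_cot[OF b] vf_tangent[OF Y]] cot_D(2)[OF form_cot[OF b] lie_bracket_tangent[OF X Y]]
      vf_comp_mult[OF X h form_smooth[OF b Y], of p]
      cot_D(1)[OF form_cot[OF b] tangent_scale[OF lie_bracket_tangent[OF X Y]] tangent_scale[OF vf_tangent[OF Y]], of p "h p" "X p h"]
    by (simp add: T_def lie_bracket_smul_right[OF X Y h] algebra_simps)
  obtain \<gamma> where \<gamma>: "\<gamma> \<in> cotangent_space A p" "\<And>Y. Y \<in> vector_fields A \<Longrightarrow> \<gamma> (Y p) = T Y"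
    using tensorial_covector[of T p, OF add smul] by blast
  have "lie_derivative A X \<beta> p = \<gamma>" unfolding lie_derivative_def
  proof (rule the_equality)
    show "\<gamma> \<in> cotangent_space A p \<and> (\<forall>Y\<in>vector_fields A. \<gamma> (Y p) = X p (\<lambda>q. \<beta> q (Y q)) - \<beta> p (lie_bracket A X Y p))"
      using \<gamma> by (simp add: T_def)
    fix \<delta> assume "\<delta> \<in> cotangent_space A p \<and> (\<forall>Y\<in>vector_fields A. \<delta> (Y p) = X p (\<lambda>q. \<beta> q (Y q)) - \<beta> p (lie_bracket A X Y p))"
    then show "\<delta> = \<gamma>"
      using form_eqI[of "\<lambda>_. \<delta>" p "\<lambda>_. \<gamma>"] \<gamma> by (simp add: T_def)
  qed
  with \<gamma> show "lie_derivative A X \<beta> p \<in> cotangent_space A p"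
    "Y \<in> vector_fields A \<Longrightarrow> lie_derivative A X \<beta> p (Y p) = X p (\<lambda>q. \<beta> q (Y q)) - \<beta> p (lie_bracket A X Y p)"
    by (simp_all add: T_def)
qed

end

section \<open>The cotangent Lie algebroid of a Poisson manifold\<close>

locale poisson_mfd = smooth_mfd A
  for A :: "('m::{t2_space,second_countable_topology}, 'e::euclidean_space) chart set" +
  fixes \<pi> :: "'m \<Rightarrow> 'm covec \<Rightarrow> 'm covec \<Rightarrow> real"
  assumes poisson: "poisson A \<pi>"
begin

section \<open>The bivector field and the map \<open>sharp\<close>\<close>

lemma bivector: "bivector_field A \<pi>"
  using poisson by (simp add: poisson_def)

lemma pi_self: "\<alpha> \<in> cotangent_space A p \<Longrightarrow> \<pi> p \<alpha> \<alpha> = 0"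
  using bivector unfolding bivector_field_def by blast

lemma pi_add:
  assumes "\<alpha> \<in> cotangent_space A p" "\<beta> \<in> cotangent_space A p" "\<gamma> \<in> cotangent_space A p"
  shows "\<pi> p (\<lambda>v. \<alpha> v + \<beta> v) \<gamma> = \<pi> p \<alpha> \<gamma> + \<pi> p \<beta> \<gamma>"
    "\<pi> p \<gamma> (\<lambda>v. \<alpha> v + \<beta> v) = \<pi> p \<gamma> \<alpha> + \<pi> p \<gamma> \<beta>"
  using bivector assms unfolding bivector_field_def by blast+

lemma pi_scale:
  assumes "\<alpha> \<in> cotangent_space A p" "\<beta> \<in> cotangent_space A p"
  shows "\<pi> p (\<lambda>v. c * \<alpha> v) \<beta> = c * \<pi> p \<alpha> \<beta>" "\<pi> p \<beta> (\<lambda>v. c * \<alpha> v) = c * \<pi> p \<beta> \<alpha>"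
  using bivector assms unfolding bivector_field_def by blast+

text \<open>Polarization of
  \<open>\<pi>(\<alpha> + \<beta>, \<alpha> + \<beta>) = 0\<close>.\<close>

lemma pi_skew:
  assumes a: "\<alpha> \<in> cotangent_space A p" and b: "\<beta> \<in> cotangent_space A p"
  shows "\<pi> p \<beta> \<alpha> = - \<pi> p \<alpha> \<beta>"
  using pi_self[OF cot_plus[OF a b]] pi_add(1)[OF a b cot_plus[OF a b]]
    pi_add(2)[OF a b a] pi_add(2)[OF a b b] pi_self[OF a] pi_self[OF b] by simp

lemma pi_sum_right:
  assumes a: "\<alpha> \<in> cotangent_space A p" and b: "\<And>i. i \<in> I \<Longrightarrow> \<beta> i \<in> cotangent_space A p"
  shows "\<pi> p \<alpha> (\<lambda>v. \<Sum>i\<in>I. c i * \<beta> i v) = (\<Sum>i\<in>I. c i * \<pi> p \<alpha> (\<beta> i))"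
  using b
proof (induction I rule: infinite_finite_induct)
  case (insert i I)
  then show ?case
    using pi_add(2)[OF cot_scale[of "\<beta> i" p "c i"] cot_sum_closed[of I \<beta> p c] a]
      pi_scale(2)[of "\<beta> i" p \<alpha> "c i"] a by simp
qed (use pi_scale(2)[OF cot_zero a, of 0] in auto)

lemma cot_expand_differential:
  assumes "\<kappa> \<in> A" "q \<in> fst \<kappa>" "\<alpha> \<in> cotangent_space A q"
  shows "\<alpha> = (\<lambda>v. \<Sum>i<DIM('e). \<alpha> (coord_vec A \<kappa> i q) * differential A (coord_fun \<kappa> i) q v)"
  by (rule cot_eqI[OF assms(3) cot_sum_closed[OF differential_cot]])
    (simp add: cot_expand[OF assms] differential_apply mult.commute)

lemma pi_expand:
  assumes k: "\<kappa> \<in> A" "q \<in> fst \<kappa>" and a: "\<alpha> \<in> cotangent_space A q" and b: "\<beta> \<in> cotangent_space A q"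
  shows "\<pi> q \<alpha> \<beta> = (\<Sum>i<DIM('e). \<beta> (coord_vec A \<kappa> i q) * \<pi> q \<alpha> (differential A (coord_fun \<kappa> i) q))"
  by (subst cot_expand_differential[OF k b]) (rule pi_sum_right[OF a differential_cot])

lemma differential_rules:
  assumes f: "smooth_at A p f" and g: "smooth_at A p g"
  shows "differential A (\<lambda>x. f x + g x) p = (\<lambda>v. differential A f p v + differential A g p v)"
    "differential A (\<lambda>x. f x * g x) p = (\<lambda>v. g p * differential A f p v + f p * differential A g p v)"
  using tangent_spaceD(1,2)[OF _ f g] by (auto simp: differential_def fun_eq_iff mult.commute)

text \<open>The vector sought is the derivation that sends \<open>f\<close> to
  \<open>\<pi>(\<alpha>, df)\<close>. It has the right pairing with differentials of coordinates,
  and these span the cotangent space.\<close>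

lemma sharp:
  assumes a: "\<alpha> \<in> cotangent_space A p"
  shows "sharp A \<pi> p \<alpha> \<in> tangent_space A p"
    "\<beta> \<in> cotangent_space A p \<Longrightarrow> \<beta> (sharp A \<pi> p \<alpha>) = \<pi> p \<alpha> \<beta>"
proof -
  define v where "v f = (if smooth_at A p f then \<pi> p \<alpha> (differential A f p) else 0)" for f
  note d = differential_cot
  have v: "v \<in> tangent_space A p" unfolding tangent_space_def mem_Collect_eq
  proof (intro conjI allI impI)
    fix f g assume f: "smooth_at A p f" and g: "smooth_at A p g"
    show "v (\<lambda>x. f x + g x) = v f + v g"
      using f g by (simp add: v_def smooth_at_add differential_rules[OF f g] pi_add(2)[OF d d a])
    show "v (\<lambda>x. f x * g x) = v f * g p + f p * v g"
      using f g pi_add(2)[OF cot_scale[OF d] cot_scale[OF d] a, of "g p" f "f p" g] pi_scale(2)[OF d a]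
      by (simp add: v_def smooth_at_mult differential_rules[OF f g])
  next
    fix f c assume f: "smooth_at A p f"
    have "differential A (\<lambda>x. c * f x) p = (\<lambda>u. c * differential A f p u)"
      using tangent_spaceD(3)[OF _ f] by (auto simp: differential_def fun_eq_iff)
    then show "v (\<lambda>x. c * f x) = c * v f"
      using f pi_scale(2)[OF d a] smooth_at_mult[OF smooth_at_const f] by (simp add: v_def)
  next
    fix f g assume f: "smooth_at A p f" and g: "smooth_at A p g" and e: "\<forall>\<^sub>F x in nhds p. f x = g x"
    have "differential A f p = differential A g p"
      using tangent_spaceD(4)[OF _ f e] by (auto simp: differential_def fun_eq_iff)
    then show "v f = v g" using f g by (simp add: v_def)
  qed (simp add: v_def)
  have b: "\<beta> v = \<pi> p \<alpha> \<beta>" if b: "\<beta> \<in> cotangent_space A p" for \<beta>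
  proof -
    obtain \<kappa> where \<kappa>: "\<kappa> \<in> A" "p \<in> fst \<kappa>" by (rule chart_cover')
    show ?thesis unfolding pi_expand[OF \<kappa> a b] cot_expand[OF \<kappa> b v]
      using smooth_at_coord_fun[OF \<kappa>] by (simp add: v_def mult.commute)
  qed
  have "sharp A \<pi> p \<alpha> = v" unfolding sharp_def
  proof (rule the_equality)
    fix u assume u: "u \<in> tangent_space A p \<and> (\<forall>\<beta>\<in>cotangent_space A p. \<beta> u = \<pi> p \<alpha> \<beta>)"
    show "u = v"
    proof (rule tangent_eqI)
      fix f
      show "u f = v f" using u b d[of f p] v differential_apply by metis
    qed (use u v in auto)
  qed (use v b in auto)
  with v b show "sharp A \<pi> p \<alpha> \<in> tangent_space A p"
    "\<beta> \<in> cotangent_space A p \<Longrightarrow> \<beta> (sharp A \<pi> p \<alpha>) = \<pi> p \<alpha> \<beta>" by simp_all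
qed

lemma sharp_apply: "\<alpha> \<in> cotangent_space A p \<Longrightarrow> sharp A \<pi> p \<alpha> f = \<pi> p \<alpha> (differential A f p)"
  using sharp(2)[OF _ differential_cot, of \<alpha> p f] sharp(1) differential_apply by metis

lemma sharp_add:
  assumes a: "\<alpha> \<in> cotangent_space A p" and b: "\<beta> \<in> cotangent_space A p"
  shows "sharp A \<pi> p (\<lambda>v. \<alpha> v + \<beta> v) = (\<lambda>f. sharp A \<pi> p \<alpha> f + sharp A \<pi> p \<beta> f)"
  using pi_add(1)[OF a b differential_cot] by (simp add: sharp_apply cot_plus a b fun_eq_iff)

lemma sharp_smul:
  assumes a: "\<alpha> \<in> cotangent_space A p"
  shows "sharp A \<pi> p (\<lambda>v. c * \<alpha> v) = (\<lambda>f. c * sharp A \<pi> p \<alpha> f)"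
  using pi_scale(1)[OF a differential_cot] by (simp add: sharp_apply cot_scale a fun_eq_iff)

text \<open>Smoothness is given for the components on coordinate differentials.
  \<open>pi_expand\<close> expands the second argument; skew symmetry brings the first one into that
  position.\<close>

lemma pi_smooth:
  assumes a: "\<alpha> \<in> one_forms A" and b: "\<beta> \<in> one_forms A"
  shows "(\<lambda>q. \<pi> q (\<alpha> q) (\<beta> q)) \<in> smooth_funs A"
proof (rule smooth_funsI)
  fix p
  obtain \<kappa> where \<kappa>: "\<kappa> \<in> A" "p \<in> fst \<kappa>" by (rule chart_cover')
  note o = eventually_nhds_in_open[OF chart_open[OF \<kappa>(1)] \<kappa>(2)] and d = differential_cot
  have c: "smooth_at A p (\<lambda>q. \<pi> q (differential A (coord_fun \<kappa> i) q) (differential A (coord_fun \<kappa> j) q))"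
    if "i < DIM('e)" "j < DIM('e)" for i j
    using bivector that \<kappa> smooth_on_iff[OF chart_open[OF \<kappa>(1)]] unfolding bivector_field_def by blast
  have ac: "smooth_at A p (\<lambda>q. \<pi> q (\<alpha> q) (differential A (coord_fun \<kappa> j) q))" if j: "j < DIM('e)" for j
  proof (rule smooth_at_cong)
    show "smooth_at A p (\<lambda>q. - (\<Sum>i<DIM('e). \<alpha> q (coord_vec A \<kappa> i q) *
        \<pi> q (differential A (coord_fun \<kappa> j) q) (differential A (coord_fun \<kappa> i) q)))"
      by (intro smooth_at_intros form_coord_smooth[OF a \<kappa>] c j) auto
    show "\<forall>\<^sub>F q in nhds p. - (\<Sum>i<DIM('e). \<alpha> q (coord_vec A \<kappa> i q) *
        \<pi> q (differential A (coord_fun \<kappa> j) q) (differential A (coord_fun \<kappa> i) q)) =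
        \<pi> q (\<alpha> q) (differential A (coord_fun \<kappa> j) q)"
      using o
    proof eventually_elim
      case (elim q)
      show ?case using pi_skew[OF d form_cot[OF a]] pi_expand[OF \<kappa>(1) elim d form_cot[OF a]] by simp
    qed
  qed
  show "smooth_at A p (\<lambda>q. \<pi> q (\<alpha> q) (\<beta> q))"
  proof (rule smooth_at_cong)
    show "smooth_at A p (\<lambda>q. \<Sum>i<DIM('e). \<beta> q (coord_vec A \<kappa> i q) * \<pi> q (\<alpha> q) (differential A (coord_fun \<kappa> i) q))"
      by (intro smooth_at_intros form_coord_smooth[OF b \<kappa>] ac) auto
    show "\<forall>\<^sub>F q in nhds p. (\<Sum>i<DIM('e). \<beta> q (coord_vec A \<kappa> i q) * \<pi> q (\<alpha> q) (differential A (coord_fun \<kappa> i) q)) = \<pi> q (\<alpha> q) (\<beta> q)"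
      using o by eventually_elim (rule pi_expand[OF \<kappa>(1) _ form_cot[OF a] form_cot[OF b], symmetric])
  qed
qed

section \<open>The bracket of one-forms and its Leibniz rules\<close>

definition ham :: "('m \<Rightarrow> 'm covec) \<Rightarrow> 'm \<Rightarrow> 'm tvec" where
  "ham \<alpha> = (\<lambda>q. sharp A \<pi> q (\<alpha> q))"

definition pair :: "('m \<Rightarrow> 'm covec) \<Rightarrow> ('m \<Rightarrow> 'm covec) \<Rightarrow> 'm \<Rightarrow> real" where
  "pair \<alpha> \<beta> = (\<lambda>q. \<pi> q (\<alpha> q) (\<beta> q))"

definition fb :: "('m \<Rightarrow> 'm covec) \<Rightarrow> ('m \<Rightarrow> 'm covec) \<Rightarrow> 'm \<Rightarrow> 'm covec" where
  "fb = form_bracket A \<pi>"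

lemma pair_smooth: "\<alpha> \<in> one_forms A \<Longrightarrow> \<beta> \<in> one_forms A \<Longrightarrow> pair \<alpha> \<beta> \<in> smooth_funs A"
  unfolding pair_def by (rule pi_smooth)

lemma ham_apply: "\<alpha> \<in> one_forms A \<Longrightarrow> ham \<alpha> q f = pair \<alpha> (differential A f) q"
  by (simp add: ham_def pair_def sharp_apply form_cot)

lemma form_ham: "\<alpha> \<in> one_forms A \<Longrightarrow> \<beta> \<in> one_forms A \<Longrightarrow> \<beta> q (ham \<alpha> q) = pair \<alpha> \<beta> q"
  by (simp add: ham_def pair_def sharp(2) form_cot)

lemma pair_skew: "\<alpha> \<in> one_forms A \<Longrightarrow> \<beta> \<in> one_forms A \<Longrightarrow> pair \<beta> \<alpha> = (\<lambda>q. - pair \<alpha> \<beta> q)"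
  unfolding pair_def by (intro ext pi_skew form_cot)

lemma ham_vf: "\<alpha> \<in> one_forms A \<Longrightarrow> ham \<alpha> \<in> vector_fields A"
proof (rule vfI)
  assume a: "\<alpha> \<in> one_forms A"
  show "ham \<alpha> p \<in> tangent_space A p" for p unfolding ham_def by (rule sharp(1)[OF form_cot[OF a]])
  show "(\<lambda>q. ham \<alpha> q f) \<in> smooth_funs A" if "f \<in> smooth_funs A" for f
    using pair_smooth[OF a differential_form[OF that]] by (simp add: ham_apply[OF a])
qed

lemma ham_add: "\<alpha> \<in> one_forms A \<Longrightarrow> \<beta> \<in> one_forms A \<Longrightarrow> ham (\<lambda>q v. \<alpha> q v + \<beta> q v) = (\<lambda>q f. ham \<alpha> q f + ham \<beta> q f)"
  by (simp add: ham_def sharp_add form_cot)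

lemma ham_smul: "\<alpha> \<in> one_forms A \<Longrightarrow> ham (\<lambda>q v. h q * \<alpha> q v) = (\<lambda>q f. h q * ham \<alpha> q f)"
  by (simp add: ham_def sharp_smul form_cot)

lemma pair_add_right:
  "\<alpha> \<in> one_forms A \<Longrightarrow> \<beta> \<in> one_forms A \<Longrightarrow> \<gamma> \<in> one_forms A \<Longrightarrow> pair \<alpha> (\<lambda>q v. \<beta> q v + \<gamma> q v) = (\<lambda>q. pair \<alpha> \<beta> q + pair \<alpha> \<gamma> q)"
  unfolding pair_def by (intro ext pi_add(2) form_cot)

lemma pair_smul_right:
  "\<alpha> \<in> one_forms A \<Longrightarrow> \<beta> \<in> one_forms A \<Longrightarrow> pair \<alpha> (\<lambda>q v. h q * \<beta> q v) = (\<lambda>q. h q * pair \<alpha> \<beta> q)"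
  unfolding pair_def by (intro ext pi_scale(2) form_cot)

lemma fb_cot:
  assumes a: "\<alpha> \<in> one_forms A" and b: "\<beta> \<in> one_forms A"
  shows "fb \<alpha> \<beta> p \<in> cotangent_space A p"
  using cot_minus[OF cot_minus[OF lie_derivative(1)[OF ham_vf[OF a] b] lie_derivative(1)[OF ham_vf[OF b] a]] differential_cot]
  unfolding fb_def form_bracket_def[abs_def] ham_def .

text \<open>Evaluated on global fields, the rules for the bracket of forms reduce to those for
  brackets of vector fields.\<close>

lemma fb_eval:
  assumes a: "\<alpha> \<in> one_forms A" and b: "\<beta> \<in> one_forms A" and Y: "Y \<in> vector_fields A"
  shows "fb \<alpha> \<beta> p (Y p) = ham \<alpha> p (\<lambda>q. \<beta> q (Y q)) - \<beta> p (lie_bracket A (ham \<alpha>) Y p)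
     - ham \<beta> p (\<lambda>q. \<alpha> q (Y q)) + \<alpha> p (lie_bracket A (ham \<beta>) Y p) - Y p (pair \<alpha> \<beta>)"
  using lie_derivative(2)[OF ham_vf[OF a] b Y] lie_derivative(2)[OF ham_vf[OF b] a Y]
    differential_apply[OF vf_tangent[OF Y]]
  unfolding fb_def form_bracket_def by (simp add: ham_def[symmetric] pair_def[symmetric])

lemma fb_form:
  assumes a: "\<alpha> \<in> one_forms A" and b: "\<beta> \<in> one_forms A"
  shows "fb \<alpha> \<beta> \<in> one_forms A"
proof (rule formI)
  fix Y assume Y: "Y \<in> vector_fields A"
  have "(\<lambda>q. (ham \<alpha> q (\<lambda>q. \<beta> q (Y q)) - \<beta> q (lie_bracket A (ham \<alpha>) Y q))
     - (ham \<beta> q (\<lambda>q. \<alpha> q (Y q)) - \<alpha> q (lie_bracket A (ham \<beta>) Y q)) - Y q (pair \<alpha> \<beta>)) \<in> smooth_funs A"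
    using vf_smooth[OF ham_vf[OF a] form_smooth[OF b Y]] form_smooth[OF b lie_bracket_vf[OF ham_vf[OF a] Y]]
      vf_smooth[OF ham_vf[OF b] form_smooth[OF a Y]] form_smooth[OF a lie_bracket_vf[OF ham_vf[OF b] Y]]
      vf_smooth[OF Y pair_smooth[OF a b]]
    by (rule smooth_funs_intros(3)[OF smooth_funs_intros(3)[OF smooth_funs_intros(3) smooth_funs_intros(3)]])
  then show "(\<lambda>q. fb \<alpha> \<beta> q (Y q)) \<in> smooth_funs A"
    by (simp add: fb_eval[OF a b Y] algebra_simps)
qed (rule fb_cot[OF a b])

lemma fb_skew:
  assumes a: "\<alpha> \<in> one_forms A" and b: "\<beta> \<in> one_forms A"
  shows "fb \<beta> \<alpha> = (\<lambda>q v. (- 1) * fb \<alpha> \<beta> q v)"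
proof
  fix p
  show "fb \<beta> \<alpha> p = (\<lambda>v. (- 1) * fb \<alpha> \<beta> p v)"
  proof (rule form_eqI)
    fix Y assume Y: "Y \<in> vector_fields A"
    have "Y p (\<lambda>q. - pair \<alpha> \<beta> q) = - Y p (pair \<alpha> \<beta>)"
      by (rule tangent_minus[OF vf_tangent[OF Y] smooth_at_smooth_funs[OF pair_smooth[OF a b]]])
    then show "fb \<beta> \<alpha> p (Y p) = (- 1) * fb \<alpha> \<beta> p (Y p)"
      by (simp add: fb_eval[OF a b Y] fb_eval[OF b a Y] pair_skew[OF a b])
  qed (intro cot_scale fb_cot a b)+
qed

lemma fb_add_right:
  assumes a: "\<alpha> \<in> one_forms A" and b: "\<beta> \<in> one_forms A" and c: "\<gamma> \<in> one_forms A"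
  shows "fb \<alpha> (\<lambda>q v. \<beta> q v + \<gamma> q v) = (\<lambda>q v. fb \<alpha> \<beta> q v + fb \<alpha> \<gamma> q v)"
proof
  fix p
  show "fb \<alpha> (\<lambda>q v. \<beta> q v + \<gamma> q v) p = (\<lambda>v. fb \<alpha> \<beta> p v + fb \<alpha> \<gamma> p v)"
  proof (rule form_eqI)
    fix Y assume Y: "Y \<in> vector_fields A"
    note vf = ham_vf[OF a] ham_vf[OF b] ham_vf[OF c]
    show "fb \<alpha> (\<lambda>q v. \<beta> q v + \<gamma> q v) p (Y p) = fb \<alpha> \<beta> p (Y p) + fb \<alpha> \<gamma> p (Y p)"
      using vf_comp_add[OF vf(1) form_smooth[OF b Y] form_smooth[OF c Y], of p]
        vf_comp_add[OF Y pair_smooth[OF a b] pair_smooth[OF a c], of p]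
        cot_D(1)[OF form_cot[OF a] lie_bracket_tangent[OF vf(2) Y] lie_bracket_tangent[OF vf(3) Y], of p]
      by (simp add: fb_eval[OF a b Y] fb_eval[OF a c Y] fb_eval[OF a form_add[OF b c] Y] ham_add[OF b c]
        lie_bracket_add_left[OF vf(2) Y vf(3)] pair_add_right[OF a b c])
  qed (intro cot_plus fb_cot form_add a b c)+
qed

text \<open>Beyond the expected terms, \<open>Y h * \<pi>(\<alpha>, \<beta>)\<close> arises twice:
  from \<open>[h \<sharp>\<beta>, Y]\<close> and from \<open>d(h \<pi>(\<alpha>, \<beta>))\<close>.
  The two cancel because
  \<open>\<alpha>(\<sharp>\<beta>) = - \<pi>(\<alpha>, \<beta>)\<close>.\<close>

lemma fb_leibniz:
  assumes a: "\<alpha> \<in> one_forms A" and b: "\<beta> \<in> one_forms A" and h: "h \<in> smooth_funs A"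
  shows "fb \<alpha> (\<lambda>q v. h q * \<beta> q v) = (\<lambda>q v. h q * fb \<alpha> \<beta> q v + ham \<alpha> q h * \<beta> q v)"
proof
  fix p
  show "fb \<alpha> (\<lambda>q v. h q * \<beta> q v) p = (\<lambda>v. h p * fb \<alpha> \<beta> p v + ham \<alpha> p h * \<beta> p v)"
  proof (rule form_eqI)
    fix Y assume Y: "Y \<in> vector_fields A"
    note vf = ham_vf[OF a] ham_vf[OF b]
    note lt = lie_bracket_tangent[OF vf(2) Y]
    have "\<alpha> p (\<lambda>f. h p * lie_bracket A (ham \<beta>) Y p f + (- Y p h) * ham \<beta> p f) =
        h p * \<alpha> p (lie_bracket A (ham \<beta>) Y p) + (- Y p h) * \<alpha> p (ham \<beta> p)"
      unfolding cot_D(1)[OF form_cot[OF a] tangent_scale[OF lt] tangent_scale[OF vf_tangent[OF vf(2)]]]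
        cot_D(2)[OF form_cot[OF a] lt] cot_D(2)[OF form_cot[OF a] vf_tangent[OF vf(2)]] ..
    moreover have "\<alpha> p (ham \<beta> p) = - pair \<alpha> \<beta> p"
      by (simp add: form_ham[OF b a] pair_skew[OF a b])
    ultimately show "fb \<alpha> (\<lambda>q v. h q * \<beta> q v) p (Y p) = h p * fb \<alpha> \<beta> p (Y p) + ham \<alpha> p h * \<beta> p (Y p)"
      using vf_comp_mult[OF vf(1) h form_smooth[OF b Y], of p]
        vf_comp_mult[OF Y h pair_smooth[OF a b], of p]
      by (simp add: fb_eval[OF a b Y] fb_eval[OF a form_smul[OF h b] Y] ham_smul[OF b]
        lie_bracket_smul_left[OF vf(2) Y h] pair_smul_right[OF a b] algebra_simps)
  qed (intro cot_plus cot_scale fb_cot form_smul form_cot a b h)+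
qed

lemma fb_add_left:
  assumes a: "\<alpha> \<in> one_forms A" and b: "\<beta> \<in> one_forms A" and c: "\<gamma> \<in> one_forms A"
  shows "fb (\<lambda>q v. \<beta> q v + \<gamma> q v) \<alpha> = (\<lambda>q v. fb \<beta> \<alpha> q v + fb \<gamma> \<alpha> q v)"
  by (simp add: fb_skew[OF a form_add[OF b c]] fb_skew[OF a b] fb_skew[OF a c] fb_add_right[OF a b c])

lemma fb_leibniz_left:
  assumes a: "\<alpha> \<in> one_forms A" and b: "\<beta> \<in> one_forms A" and h: "h \<in> smooth_funs A"
  shows "fb (\<lambda>q v. h q * \<beta> q v) \<alpha> = (\<lambda>q v. h q * fb \<beta> \<alpha> q v - ham \<alpha> q h * \<beta> q v)"
  by (simp add: fb_skew[OF a form_smul[OF h b]] fb_skew[OF a b] fb_leibniz[OF a b h])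

section \<open>The Poisson bracket of functions and the Jacobi identities\<close>

abbreviation pb :: "('m \<Rightarrow> real) \<Rightarrow> ('m \<Rightarrow> real) \<Rightarrow> 'm \<Rightarrow> real" where
  "pb f g \<equiv> pair (differential A f) (differential A g)"

lemma pb_smooth: "f \<in> smooth_funs A \<Longrightarrow> g \<in> smooth_funs A \<Longrightarrow> pb f g \<in> smooth_funs A"
  by (intro pair_smooth differential_form)

text \<open>On \<open>Y\<close>, each of the two Lie derivative terms contributes
  \<open>Y {f, g}\<close>, the second one by skew symmetry, and the last term takes one of them
  away.\<close>

lemma fb_exact:
  assumes f: "f \<in> smooth_funs A" and g: "g \<in> smooth_funs A"
  shows "fb (differential A f) (differential A g) = differential A (pb f g)"
proof
  fix p
  note df = differential_form[OF f] and dg = differential_form[OF g]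
  show "fb (differential A f) (differential A g) p = differential A (pb f g) p"
  proof (rule form_eqI)
    fix Y assume Y: "Y \<in> vector_fields A"
    note Xf = ham_vf[OF df] and Xg = ham_vf[OF dg]
    have "(\<lambda>q. ham (differential A f) q g) = pb f g" "(\<lambda>q. ham (differential A g) q f) = (\<lambda>q. - pb f g q)"
      by (auto simp: ham_apply df dg pair_skew[OF df dg])
    moreover have "Y p (\<lambda>q. - pb f g q) = - Y p (pb f g)"
      by (rule tangent_minus[OF vf_tangent[OF Y] smooth_at_smooth_funs[OF pb_smooth[OF f g]]])
    ultimately show "fb (differential A f) (differential A g) p (Y p) = differential A (pb f g) p (Y p)"
      using f g by (simp add: fb_eval[OF df dg Y] differential_apply vf_tangent[OF Y]
        lie_bracket_tangent[OF Xf Y] lie_bracket_tangent[OF Xg Y] lie_bracket_apply)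
  qed (intro fb_cot df dg differential_cot)+
qed

text \<open>The three terms belong to the three choices of two inner arguments;
  \<open>{0, 2}\<close> has one inversion, hence the minus sign. For two bivectors the exponent
  \<open>(2 + 1) * (2 + 1)\<close> is odd, so the two compositions in \<open>schouten\<close> add up
  and the bracket is twice this sum.\<close>

lemma pb_jacobi:
  assumes f: "f \<in> smooth_funs A" and g: "g \<in> smooth_funs A" and h: "h \<in> smooth_funs A"
  shows "pb (pb f g) h x - pb (pb f h) g x + pb (pb g h) f x = 0"
proof -
  define B where "B = bivector_multider A \<pi>"
  have B: "B [u, w] = pb u w" for u w by (simp add: B_def bivector_multider_def pair_def fun_eq_iff)
  have S: "{S. S \<subseteq> {..<3} \<and> card S = 2} = {{0, 1}, {0, 2}, {1, 2 :: nat}}"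
  proof (intro equalityI subsetI)
    fix S :: "nat set" assume "S \<in> {S. S \<subseteq> {..<3} \<and> card S = 2}"
    then obtain x y where S: "S = {x, y}" "x \<noteq> y" "x < 3" "y < 3" by (auto simp: card_2_iff)
    then have "x \<in> {0, 1, 2}" "y \<in> {0, 1, 2}" by auto
    with S show "S \<in> {{0, 1}, {0, 2}, {1, 2}}" by (elim insertE emptyE) (simp_all add: insert_commute)
  qed auto
  have e: "{(i, j). i \<in> {0, 1} \<and> j \<in> {..<3} - {0, 1} \<and> j < i} = ({} :: (nat \<times> nat) set)"
    "{(i, j). i \<in> {0, 2} \<and> j \<in> {..<3} - {0, 2} \<and> j < i} = {(2, 1 :: nat)}"
    "{(i, j). i \<in> {1, 2} \<and> j \<in> {..<3} - {1, 2} \<and> j < i} = {(1, 0), (2, 0 :: nat)}"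
    by auto
  have sg: "shuffle_sign 3 {0, 1} = 1" "shuffle_sign 3 {0, 2} = - 1" "shuffle_sign 3 {1, 2} = 1"
    unfolding shuffle_sign_def e by simp_all
  have n: "nths [f, g, h] {0, 1} = [f, g]" "nths [f, g, h] (- {0, 1}) = [h]"
    "nths [f, g, h] {0, 2} = [f, h]" "nths [f, g, h] (- {0, 2}) = [g]"
    "nths [f, g, h] {1, 2} = [g, h]" "nths [f, g, h] (- {1, 2}) = [f]"
    by (simp_all add: nths_Cons)
  have ne: "{0, 1} \<noteq> {0, 2 :: nat}" "{0, 1} \<noteq> {1, 2 :: nat}" "{0, 2} \<noteq> {1, 2 :: nat}"
    by (simp_all add: doubleton_eq_iff)
  have "length [f, g, h] = 3" by simp
  then have "shuffle_comp 2 B B [f, g, h] x =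
      (\<Sum>S\<in>{{0, 1}, {0, 2}, {1, 2}}. shuffle_sign 3 S * B (B (nths [f, g, h] S) # nths [f, g, h] (- S)) x)"
    unfolding shuffle_comp_def by (simp only: S)
  also have "\<dots> = shuffle_sign 3 {0, 1} * B (B (nths [f, g, h] {0, 1}) # nths [f, g, h] (- {0, 1})) x +
      (shuffle_sign 3 {0, 2} * B (B (nths [f, g, h] {0, 2}) # nths [f, g, h] (- {0, 2})) x +
       shuffle_sign 3 {1, 2} * B (B (nths [f, g, h] {1, 2}) # nths [f, g, h] (- {1, 2})) x)"
    using ne by (subst sum.insert, simp, simp only: insert_iff empty_iff, simp)+
  finally have "shuffle_comp 2 B B [f, g, h] x = pb (pb f g) h x - pb (pb f h) g x + pb (pb g h) f x"
    unfolding sg n B by simp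
  moreover have "schouten 2 2 B B [f, g, h] x = 0"
  proof -
    have "length [f, g, h] = 3" "set [f, g, h] \<subseteq> smooth_funs A" using f g h by simp_all
    then show ?thesis
      using poisson[unfolded poisson_def, THEN conjunct2, rule_format, of "[f, g, h]" x] unfolding B_def by simp
  qed
  ultimately show ?thesis by (simp add: schouten_def)
qed

lemma ham_bracket:
  assumes a: "\<alpha> \<in> one_forms A" and b: "\<beta> \<in> one_forms A"
  shows "ham (fb \<alpha> \<beta>) = lie_bracket A (ham \<alpha>) (ham \<beta>)"
proof
  fix p
  show "ham (fb \<alpha> \<beta>) p = lie_bracket A (ham \<alpha>) (ham \<beta>) p"
  proof (rule tangent_eqI[OF vf_tangent[OF ham_vf[OF fb_form[OF a b]]] lie_bracket_tangent[OF ham_vf[OF a] ham_vf[OF b]]])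
    fix g assume g: "g \<in> smooth_funs A"
    \<comment> \<open>Fixing \<open>p\<close> and the test function \<open>g\<close> makes the
      defect real-valued, as \<open>tensorial_form_vanishes\<close> requires.\<close>
    define D where "D \<alpha> \<beta> = ham (fb \<alpha> \<beta>) p g - lie_bracket A (ham \<alpha>) (ham \<beta>) p g" for \<alpha> \<beta>
    have D_skew: "D \<beta> \<alpha> = - D \<alpha> \<beta>" if "\<alpha> \<in> one_forms A" "\<beta> \<in> one_forms A" for \<alpha> \<beta>
      by (simp add: D_def fb_skew[OF that] ham_smul[OF fb_form[OF that], of "\<lambda>q. - 1", simplified]
          lie_bracket_skew[of "ham \<beta>" "ham \<alpha>"])
    have D_add: "D \<alpha> (\<lambda>q v. \<beta> q v + \<gamma> q v) = D \<alpha> \<beta> + D \<alpha> \<gamma>"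
      if a: "\<alpha> \<in> one_forms A" and b: "\<beta> \<in> one_forms A" and c: "\<gamma> \<in> one_forms A" for \<alpha> \<beta> \<gamma>
      by (simp add: D_def fb_add_right[OF a b c] ham_add[OF fb_form[OF a b] fb_form[OF a c]] ham_add[OF b c]
          lie_bracket_add_right[OF ham_vf[OF a] ham_vf[OF b] ham_vf[OF c]])
    \<comment> \<open>Both Leibniz rules produce the same extra term
      \<open>\<sharp>\<alpha> h * \<sharp>\<beta> g\<close>.\<close>
    have D_smul: "D \<alpha> (\<lambda>q v. h q * \<beta> q v) = h p * D \<alpha> \<beta>"
      if a: "\<alpha> \<in> one_forms A" and h: "h \<in> smooth_funs A" and b: "\<beta> \<in> one_forms A" for \<alpha> \<beta> h
    proof -
      have h': "(\<lambda>q. ham \<alpha> q h) \<in> smooth_funs A" by (rule vf_smooth[OF ham_vf[OF a] h])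
      show ?thesis
        unfolding D_def fb_leibniz[OF a b h] ham_add[OF form_smul[OF h fb_form[OF a b]] form_smul[OF h' b]]
          ham_smul[OF fb_form[OF a b]] ham_smul[OF b] lie_bracket_smul_right[OF ham_vf[OF a] ham_vf[OF b] h]
        by (simp add: algebra_simps)
    qed
    have D_exact: "D (differential A f) (differential A h) = 0" if f: "f \<in> smooth_funs A" and h: "h \<in> smooth_funs A" for f h
    proof -
      note d = differential_form
      have swap: "pb u w = (\<lambda>q. - pb w u q)" if "u \<in> smooth_funs A" "w \<in> smooth_funs A" for u w
        by (rule pair_skew[OF d[OF that(2)] d[OF that(1)]])
      have "pb f (pb h g) p = - pb (pb h g) f p" "pb h (pb f g) p = - pb (pb f g) h p"
        using swap[OF f pb_smooth[OF h g]] swap[OF h pb_smooth[OF f g]] by simp_all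
      moreover have "(\<lambda>q. ham (differential A u) q w) = pb u w" if "u \<in> smooth_funs A" for u w
        by (simp add: ham_apply d that)
      ultimately show ?thesis
        using pb_jacobi[OF f h g, of p] f g h
        by (simp add: D_def fb_exact lie_bracket_apply ham_apply d pb_smooth)
    qed
    \<comment> \<open>Tensoriality is used once per argument: here with a differential on the left,
      then, after a swap by \<open>D_skew\<close>, with arbitrary \<open>\<alpha>\<close> on the
      left.\<close>
    have 1: "D (differential A f) \<beta> = 0" if f: "f \<in> smooth_funs A" and b: "\<beta> \<in> one_forms A" for f \<beta>
      by (rule tensorial_form_vanishes[where T = "D (differential A f)" and p = p])
        (auto simp: D_add[OF differential_form[OF f]] D_smul[OF differential_form[OF f]] D_exact[OF f] b)
    have "D \<alpha> (differential A f) = 0" if "f \<in> smooth_funs A" for f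
      using 1[OF that a] D_skew[OF differential_form[OF that] a] by simp
    note 2 = this
    have "D \<alpha> \<beta> = 0"
      by (rule tensorial_form_vanishes[where T = "D \<alpha>" and p = p]) (auto simp: D_add[OF a] D_smul[OF a] 2 b)
    then show "ham (fb \<alpha> \<beta>) p g = lie_bracket A (ham \<alpha>) (ham \<beta>) p g" by (simp add: D_def)
  qed
qed

text \<open>The Jacobiator \<open>J\<close> is cyclic, so tensoriality in the last argument
  suffices: rotating brings each argument in turn into that position, where it may be assumed to be
  a differential.\<close>

lemma fb_jacobi:
  assumes a: "\<alpha> \<in> one_forms A" and b: "\<beta> \<in> one_forms A" and c: "\<gamma> \<in> one_forms A"
  shows "fb \<alpha> (fb \<beta> \<gamma>) p v + (fb \<beta> (fb \<gamma> \<alpha>) p v + fb \<gamma> (fb \<alpha> \<beta>) p v) = 0"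
proof -
  define J where "J \<alpha> \<beta> \<gamma> = fb \<alpha> (fb \<beta> \<gamma>) p v + (fb \<beta> (fb \<gamma> \<alpha>) p v + fb \<gamma> (fb \<alpha> \<beta>) p v)" for \<alpha> \<beta> \<gamma>
  have cyc: "J \<alpha> \<beta> \<gamma> = J \<beta> \<gamma> \<alpha>" for \<alpha> \<beta> \<gamma> by (simp add: J_def)
  have J_add: "J \<alpha> \<beta> (\<lambda>q v. \<gamma> q v + \<delta> q v) = J \<alpha> \<beta> \<gamma> + J \<alpha> \<beta> \<delta>"
    if a: "\<alpha> \<in> one_forms A" and b: "\<beta> \<in> one_forms A" and c: "\<gamma> \<in> one_forms A" and d: "\<delta> \<in> one_forms A" for \<alpha> \<beta> \<gamma> \<delta>
    by (simp add: J_def fb_add_right[OF b c d] fb_add_right[OF a fb_form[OF b c] fb_form[OF b d]] fb_add_left[OF a c d]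
        fb_add_right[OF b fb_form[OF c a] fb_form[OF d a]] fb_add_left[OF fb_form[OF a b] c d])
  have J_smul: "J \<alpha> \<beta> (\<lambda>q v. h q * \<gamma> q v) = h p * J \<alpha> \<beta> \<gamma>"
    if a: "\<alpha> \<in> one_forms A" and b: "\<beta> \<in> one_forms A" and h: "h \<in> smooth_funs A" and c: "\<gamma> \<in> one_forms A" for \<alpha> \<beta> \<gamma> h
  proof -
    have ah: "(\<lambda>q. ham \<alpha> q h) \<in> smooth_funs A" and bh: "(\<lambda>q. ham \<beta> q h) \<in> smooth_funs A"
      using vf_smooth[OF ham_vf[OF a] h] vf_smooth[OF ham_vf[OF b] h] .
    have mah: "(\<lambda>q. - ham \<alpha> q h) \<in> smooth_funs A" using smooth_funs_intros(3)[OF smooth_funs_intros(1)[of 0] ah] by simp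
    have 1: "fb \<alpha> (fb \<beta> (\<lambda>q v. h q * \<gamma> q v)) p v = h p * fb \<alpha> (fb \<beta> \<gamma>) p v + ham \<alpha> p h * fb \<beta> \<gamma> p v
        + (ham \<beta> p h * fb \<alpha> \<gamma> p v + ham \<alpha> p (\<lambda>q. ham \<beta> q h) * \<gamma> p v)"
      unfolding fb_leibniz[OF b c h] fb_add_right[OF a form_smul[OF h fb_form[OF b c]] form_smul[OF bh c]]
        fb_leibniz[OF a fb_form[OF b c] h] fb_leibniz[OF a c bh] ..
    have e: "fb (\<lambda>q v. h q * \<gamma> q v) \<alpha> = (\<lambda>q v. h q * fb \<gamma> \<alpha> q v + (- ham \<alpha> q h) * \<gamma> q v)"
      by (simp add: fb_leibniz_left[OF a c h])
    have m: "ham \<beta> p (\<lambda>q. - ham \<alpha> q h) = - ham \<beta> p (\<lambda>q. ham \<alpha> q h)"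
      by (rule tangent_minus[OF vf_tangent[OF ham_vf[OF b]] smooth_at_smooth_funs[OF ah]])
    have 2: "fb \<beta> (fb (\<lambda>q v. h q * \<gamma> q v) \<alpha>) p v = h p * fb \<beta> (fb \<gamma> \<alpha>) p v + ham \<beta> p h * fb \<gamma> \<alpha> p v
        + ((- ham \<alpha> p h) * fb \<beta> \<gamma> p v + (- ham \<beta> p (\<lambda>q. ham \<alpha> q h)) * \<gamma> p v)"
      unfolding e fb_add_right[OF b form_smul[OF h fb_form[OF c a]] form_smul[OF mah c]]
        fb_leibniz[OF b fb_form[OF c a] h] fb_leibniz[OF b c mah] m ..
    \<comment> \<open>Replacing \<open>\<sharp>{\<alpha>, \<beta>} h\<close> by
      \<open>[\<sharp>\<alpha>, \<sharp>\<beta>] h\<close> makes it cancel the second derivatives of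
      \<open>h\<close> in the other two terms.\<close>
    have 3: "fb (\<lambda>q v. h q * \<gamma> q v) (fb \<alpha> \<beta>) p v = h p * fb \<gamma> (fb \<alpha> \<beta>) p v
        - (ham \<alpha> p (\<lambda>q. ham \<beta> q h) - ham \<beta> p (\<lambda>q. ham \<alpha> q h)) * \<gamma> p v"
      unfolding fb_leibniz_left[OF fb_form[OF a b] c h] ham_bracket[OF a b] lie_bracket_apply[OF h] ..
    \<comment> \<open>Cancels the terms with \<open>\<sharp>\<beta> h\<close>; those with
      \<open>\<sharp>\<alpha> h\<close> cancel without it.\<close>
    have s: "fb \<gamma> \<alpha> p v = - fb \<alpha> \<gamma> p v" by (simp add: fb_skew[OF a c])
    show ?thesis unfolding J_def 1 2 3 s by (simp add: algebra_simps)
  qed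
  note d = differential_form
  have J_exact: "J (differential A f) (differential A g) (differential A h) = 0"
    if f: "f \<in> smooth_funs A" and g: "g \<in> smooth_funs A" and h: "h \<in> smooth_funs A" for f g h
  proof (cases "v \<in> tangent_space A p")
    case True
    have swap: "pb u w = (\<lambda>q. - pb w u q)" if "u \<in> smooth_funs A" "w \<in> smooth_funs A" for u w
      by (rule pair_skew[OF d[OF that(2)] d[OF that(1)]])
    define u1 u2 u3 where "u1 = pb f (pb g h)" and "u2 = pb g (pb h f)" and "u3 = pb h (pb f g)"
    have s: "smooth_at A p u1" "smooth_at A p u2" "smooth_at A p u3"
      unfolding u1_def u2_def u3_def by (intro smooth_at_smooth_funs pb_smooth f g h)+
    have pbm: "pb (\<lambda>q. - w q) u x = - pb w u x" if "w \<in> smooth_funs A" "u \<in> smooth_funs A" for w u x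
    proof -
      have "pb u (\<lambda>q. - w q) x = ham (differential A u) x (\<lambda>q. - w q)" by (simp add: ham_apply d that)
      also have "\<dots> = - ham (differential A u) x w"
        by (rule tangent_minus[OF vf_tangent[OF ham_vf[OF d[OF that(2)]]] smooth_at_smooth_funs[OF that(1)]])
      also have "\<dots> = - pb u w x" by (simp add: ham_apply d that)
      moreover have "(\<lambda>q. - w q) \<in> smooth_funs A"
        using smooth_funs_intros(3)[OF smooth_funs_intros(1)[of 0] that(1)] by simp
      ultimately show ?thesis using swap[OF that] swap[of "\<lambda>q. - w q" u] that(2) by simp
    qed
    \<comment> \<open>Vanishing at every point, not only at \<open>p\<close>, is what allows
      \<open>v\<close> to be applied to the identity.\<close>
    have "u1 x + (u2 x + u3 x) = 0" for x
    proof -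
      have "u1 x = - pb (pb g h) f x" "u2 x = pb (pb f h) g x" "u3 x = - pb (pb f g) h x"
        unfolding u1_def u2_def u3_def
        using swap[OF f pb_smooth[OF g h]] swap[OF g pb_smooth[OF h f]] swap[OF h pb_smooth[OF f g]]
          swap[OF h f] pbm[OF pb_smooth[OF f h] g, of x] by simp_all
      with pb_jacobi[OF f g h, of x] show ?thesis by simp
    qed
    then have "v (\<lambda>x. u1 x + (u2 x + u3 x)) = 0" using tangent_const[OF True, of 0] by simp
    then have "v u1 + (v u2 + v u3) = 0"
      using tangent_spaceD(1)[OF True s(1) smooth_at_add[OF s(2,3)]] tangent_spaceD(1)[OF True s(2,3)] by simp
    then show ?thesis
      using f g h by (simp add: J_def fb_exact pb_smooth differential_apply[OF True] u1_def u2_def u3_def)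
  next
    case False
    have "fb \<alpha> \<beta> p v = 0" if "\<alpha> \<in> one_forms A" "\<beta> \<in> one_forms A" for \<alpha> \<beta>
      using cot_D(3)[OF fb_cot[OF that] False] .
    then show ?thesis using f g h by (simp add: J_def fb_form d)
  qed
  have 1: "J (differential A f) (differential A g) \<gamma> = 0"
    if f: "f \<in> smooth_funs A" and g: "g \<in> smooth_funs A" and c: "\<gamma> \<in> one_forms A" for f g \<gamma>
    by (rule tensorial_form_vanishes[where T = "J (differential A f) (differential A g)" and p = p])
      (auto simp: J_add[OF d[OF f] d[OF g]] J_smul[OF d[OF f] d[OF g]] J_exact[OF f g] c)
  have 2: "J \<gamma> (differential A f) \<beta> = 0"
    if f: "f \<in> smooth_funs A" and c: "\<gamma> \<in> one_forms A" and b: "\<beta> \<in> one_forms A" for f \<beta> \<gamma>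
  proof (rule tensorial_form_vanishes[where T = "J \<gamma> (differential A f)" and p = p])
    show "J \<gamma> (differential A f) (differential A g) = 0" if "g \<in> smooth_funs A" for g
      using 1[OF f that c] cyc[of \<gamma> "differential A f" "differential A g"] by simp
  qed (auto simp: J_add[OF c d[OF f]] J_smul[OF c d[OF f]] b)
  have "J \<alpha> \<beta> \<gamma> = 0"
  proof (rule tensorial_form_vanishes[where T = "J \<alpha> \<beta>" and p = p])
    show "J \<alpha> \<beta> (differential A g) = 0" if "g \<in> smooth_funs A" for g
      using 2[OF that b a] cyc[of \<alpha> \<beta> "differential A g"] by simp
  qed (auto simp: J_add[OF a b] J_smul[OF a b] c)
  then show ?thesis by (simp add: J_def)
qed

lemma fb_self:
  assumes a: "\<alpha> \<in> one_forms A"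
  shows "fb \<alpha> \<alpha> = (\<lambda>q v. 0)"
proof -
  have "fb \<alpha> \<alpha> q v = (- 1) * fb \<alpha> \<alpha> q v" for q v using fb_skew[OF a a] by (metis (no_types))
  then show ?thesis by (simp add: fun_eq_iff)
qed

section \<open>The Lie algebroid axioms for the cotangent bundle\<close>

lemma bundle_map_sharp: "bundle_map A (cotM A) (TM A) (sharp A \<pi>)"
proof (rule bundle_mapI[OF vector_bundle_cotM vector_bundle_TM])
  show "linear_fibre_map (cotM A) (TM A) (sharp A \<pi>) q" for q
    by (simp add: linear_fibre_map_def cotM_simps TM_simps sharp(1) sharp_add sharp_smul)
  show "(\<lambda>q. sharp A \<pi> q (s q)) \<in> vector_fields A" if "s \<in> one_forms A" for s
    using ham_vf[OF that] by (simp add: ham_def)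
qed

theorem lie_algebroid_cotangent: "lie_algebroid A (cotM A) (sharp A \<pi>) (form_bracket A \<pi>)"
  unfolding lie_algebroid_def fb_def[symmetric] sadd_def smul_def cotM_simps
proof (intro conjI ballI allI vector_bundle_cotM bundle_map_sharp)
  fix s t assume s: "s \<in> one_forms A" and t: "t \<in> one_forms A"
  show "fb s t \<in> one_forms A" by (rule fb_form[OF s t])
  show "fb s s = (\<lambda>q v. 0)" by (rule fb_self[OF s])
  show "fb s t = (\<lambda>q v. - 1 * fb t s q v)" by (rule fb_skew[OF t s])
  show "fb (\<lambda>q v. c * s q v) t = (\<lambda>q v. c * fb s t q v)" for c
    using fb_leibniz_left[OF t s smooth_funs_intros(1), of c] tangent_const[OF vf_tangent[OF ham_vf[OF t]]] by simp
  show "(\<lambda>q. sharp A \<pi> q (fb s t q)) = lie_bracket A (\<lambda>q. sharp A \<pi> q (s q)) (\<lambda>q. sharp A \<pi> q (t q))"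
    using ham_bracket[OF s t] unfolding ham_def .
  show "fb s (\<lambda>q v. f q * t q v) = (\<lambda>q v. f q * fb s t q v + sharp A \<pi> q (s q) f * t q v)" if "f \<in> smooth_funs A" for f
    using fb_leibniz[OF s t that] by (simp add: ham_def)
  fix u assume u: "u \<in> one_forms A"
  show "fb (\<lambda>q v. s q v + u q v) t = (\<lambda>q v. fb s t q v + fb u t q v)" by (rule fb_add_left[OF t s u])
  show "(\<lambda>q v. fb s (fb t u) q v + (fb t (fb u s) q v + fb u (fb s t) q v)) = (\<lambda>q v. 0)"
    by (simp add: fb_jacobi[OF s t u])
qed

end

section \<open>Annihilators\<close>

context smooth_mfd begin

text \<open>For a frame \<open>e\<close> whose first \<open>k\<close> members span \<open>P\<close>,
  the covectors in the annihilator are those with \<open>\<alpha> (e j) = 0\<close> for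
  \<open>j < k\<close>. Only the last \<open>n - k\<close> dual coordinates remain free, and a
  rotation of the indices moves these to the front, as an adapted trivialization requires.\<close>

lemma annihilator_subbundle:
  assumes P: "subbundle A (TM A) P"
  shows "subbundle A (cotM A) (annihilator A P)"
  unfolding subbundle_def
proof (intro conjI allI)
  show "annihilator A P q \<subseteq> fibre (cotM A) q" for q by (auto simp: annihilator_def cotM_simps)
  fix p
  obtain U n \<Phi> k where t: "adapted_triv A (TM A) P k (U, n, \<Phi>)" "p \<in> U" by (rule subbundle_cover[OF P])
  note lt = adapted_trivD(2)[OF t(1)] and st = adapted_trivD(1)[OF t(1)] and kn = adapted_trivD(3)[OF t(1)]
    and oU = adapted_trivD(4)[OF t(1)]
  define e where "e j q = tinv (TM A) \<Phi> q (\<lambda>i. if i = j then 1 else 0)" for j q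
  \<comment> \<open>Position \<open>i\<close> of the new coordinates belongs to the frame member
    \<open>\<sigma> i\<close>, with the indices from \<open>k\<close> on coming first;
    \<open>\<tau>\<close> is the inverse rotation.\<close>
  define \<sigma> where "\<sigma> i = (if i < n - k then i + k else i - (n - k))" for i
  define \<tau> where "\<tau> j = (if j < k then j + (n - k) else j - k)" for j
  have \<sigma>\<tau>: "\<sigma> (\<tau> j) = j" "\<tau> j < n" if "j < n" for j using that kn by (auto simp: \<sigma>_def \<tau>_def)
  have \<tau>\<sigma>: "\<tau> (\<sigma> i) = i" "\<sigma> i < n" if "i < n" for i using that kn by (auto simp: \<sigma>_def \<tau>_def)
  have e: "e j q \<in> tangent_space A q" "\<Phi> q (e j q) = (\<lambda>i. if i = j then 1 else 0)" if "q \<in> U" "j < n" for j q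
    using tinv_fibre[OF lt that(1) Rk_unit[OF that(2)]] triv_tinv[OF lt that(1) Rk_unit[OF that(2)]]
    by (simp_all add: e_def TM_simps)
  have expand: "\<alpha> v = (\<Sum>j<n. \<Phi> q v j * \<alpha> (e j q))"
    if q: "q \<in> U" and a: "\<alpha> \<in> cotangent_space A q" and v: "v \<in> tangent_space A q" for q \<alpha> v
  proof -
    have R: "\<Phi> q v \<in> Rk n" using triv_Rk[OF lt q] v by (simp add: TM_simps)
    have "\<alpha> (tinv (TM A) \<Phi> q (\<Phi> q v)) = (\<Sum>j<n. \<Phi> q v j * \<alpha> (e j q))" unfolding e_def
    proof (rule Rk_linear_expand[where L = "\<lambda>c. \<alpha> (tinv (TM A) \<Phi> q c)", OF _ _ R])
      fix c d and r :: real assume "c \<in> Rk n" and "d \<in> Rk n"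
      then show "\<alpha> (tinv (TM A) \<Phi> q (\<lambda>i. c i + d i)) = \<alpha> (tinv (TM A) \<Phi> q c) + \<alpha> (tinv (TM A) \<Phi> q d)"
        using cot_D(1)[OF a] tinv_fibre[OF lt q] by (simp add: tinv_add[OF lt q] TM_simps)
    next
      fix c and r :: real assume "c \<in> Rk n"
      then show "\<alpha> (tinv (TM A) \<Phi> q (\<lambda>i. r * c i)) = r * \<alpha> (tinv (TM A) \<Phi> q c)"
        using cot_D(2)[OF a] tinv_fibre[OF lt q] by (simp add: tinv_scale[OF lt q] TM_simps)
    qed
    then show ?thesis using tinv_triv[OF lt q] v by (simp add: TM_simps)
  qed
  define \<Psi> where "\<Psi> q \<alpha> i = (if i < n then \<alpha> (e (\<sigma> i) q) else 0)" for q and \<alpha> :: "'m covec" and i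
  \<comment> \<open>Inverse of \<open>\<Psi> q\<close>: the covector whose values on the frame are
    the entries of \<open>c\<close>, with \<open>\<tau>\<close> undoing the rotation.\<close>
  define I where "I q c v = (if v \<in> tangent_space A q then \<Sum>j<n. c (\<tau> j) * \<Phi> q v j else 0)"
    for q and c :: "nat \<Rightarrow> real" and v
  have I: "I q c \<in> cotangent_space A q" if q: "q \<in> U" for q c
  proof (rule cotI)
    fix u v assume u: "u \<in> tangent_space A q" and v: "v \<in> tangent_space A q"
    have "\<Phi> q (\<lambda>f. u f + v f) = (\<lambda>i. \<Phi> q u i + \<Phi> q v i)"
      using local_trivD(6)[OF lt q, of u v] u v by (simp add: TM_simps)
    then show "I q c (\<lambda>f. u f + v f) = I q c u + I q c v"
      using u v by (simp add: I_def tangent_plus algebra_simps sum.distrib)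
  next
    fix v r assume v: "v \<in> tangent_space A q"
    have "\<Phi> q (\<lambda>f. r * v f) = (\<lambda>i. r * \<Phi> q v i)"
      using local_trivD(8)[OF lt q, of v r] v by (simp add: TM_simps)
    then show "I q c (\<lambda>f. r * v f) = r * I q c v"
      using v by (simp add: I_def tangent_scale sum_distrib_left mult_ac)
  qed (simp add: I_def)
  have \<Psi>I: "\<Psi> q (I q c) = c" if q: "q \<in> U" and c: "c \<in> Rk n" for q c
  proof
    fix i
    have "I q c (e (\<sigma> i) q) = c i" if "i < n"
    proof -
      have "I q c (e (\<sigma> i) q) = (\<Sum>j<n. c (\<tau> j) * (if j = \<sigma> i then 1 else 0))"
        using e[OF q \<tau>\<sigma>(2)[OF that]] by (simp add: I_def)
      also have "\<dots> = (\<Sum>j<n. if j = \<sigma> i then c (\<tau> j) else 0)" by (rule sum.cong) auto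
      finally show ?thesis using \<tau>\<sigma>[OF that] by simp
    qed
    then show "\<Psi> q (I q c) i = c i" using c by (auto simp: \<Psi>_def Rk_def)
  qed
  have inj: "inj_on (\<Psi> q) (cotangent_space A q)" if q: "q \<in> U" for q
  proof (rule inj_onI)
    fix \<alpha> \<beta> assume a: "\<alpha> \<in> cotangent_space A q" and b: "\<beta> \<in> cotangent_space A q" and eq: "\<Psi> q \<alpha> = \<Psi> q \<beta>"
    have "\<alpha> (e j q) = \<beta> (e j q)" if "j < n" for j
      using fun_cong[OF eq, of "\<tau> j"] \<sigma>\<tau>[OF that] by (simp add: \<Psi>_def)
    then show "\<alpha> = \<beta>" by (intro cot_eqI[OF a b]) (simp add: expand[OF q a] expand[OF q b])
  qed
  have bij: "bij_betw (\<Psi> q) (cotangent_space A q) (Rk n)" if q: "q \<in> U" for q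
    unfolding bij_betw_def
  proof
    show "\<Psi> q ` cotangent_space A q = Rk n"
    proof (intro equalityI subsetI)
      fix c assume c: "c \<in> Rk n"
      show "c \<in> \<Psi> q ` cotangent_space A q"
        by (rule image_eqI[where f = "\<Psi> q", OF \<Psi>I[OF q c, symmetric] I[OF q]])
    qed (auto simp: \<Psi>_def Rk_def)
  qed (rule inj[OF q])
  have lt': "local_triv (cotM A) (U, n, \<Psi>)"
    using bij oU by (auto simp: local_triv_def cotM_simps cot_zero cot_plus cot_scale \<Psi>_def)
  have tinv': "tinv (cotM A) \<Psi> q c = I q c" if q: "q \<in> U" and c: "c \<in> Rk n" for q c
    by (rule triv_eqI[OF lt' q tinv_fibre[OF lt' q c]]) (simp_all add: cotM_simps I[OF q] \<Psi>I[OF q c] triv_tinv[OF lt' q c])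
  \<comment> \<open>The matrix entries are chart coordinates of frame members, smooth because the
    two trivializations of the tangent bundle are compatible.\<close>
  have into: "smooth_transition A (cotM A) (fst \<kappa>, DIM('e), cotM_triv \<kappa>) (U, n, \<Psi>)" if \<kappa>: "\<kappa> \<in> A" for \<kappa>
    unfolding smooth_transition_iff[OF chart_open[OF \<kappa>] oU]
  proof (intro ballI allI)
    fix c i q assume c: "c \<in> Rk DIM('e)" and q: "q \<in> fst \<kappa> \<inter> U"
    have tr: "smooth_at A q (\<lambda>q. TM_triv \<kappa> q (e j q) l)" if "j < n" for j l
      using smooth_triv_transition[OF vector_bundle_TM st TM_smooth_triv[OF \<kappa>]] q Rk_unit[OF that]
      unfolding smooth_transition_iff[OF oU chart_open[OF \<kappa>]] e_def by blast
    have "smooth_at A q (\<lambda>q. if i < n then \<Sum>l<DIM('e). c l * TM_triv \<kappa> q (e (\<sigma> i) q) l else 0)"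
      using smooth_at_const[of q 0] by (cases "i < n") (auto intro!: smooth_at_intros tr \<tau>\<sigma>(2))
    then show "smooth_at A q (\<lambda>q. \<Psi> q (tinv (cotM A) (cotM_triv \<kappa>) q c) i)"
    proof (rule smooth_at_cong)
      show "\<forall>\<^sub>F q in nhds q. (if i < n then \<Sum>l<DIM('e). c l * TM_triv \<kappa> q (e (\<sigma> i) q) l else 0) =
          \<Psi> q (tinv (cotM A) (cotM_triv \<kappa>) q c) i"
        using eventually_nhds_in_open[OF open_Int[OF chart_open[OF \<kappa>] oU] q]
      proof eventually_elim
        case (elim q)
        then have q: "q \<in> fst \<kappa>" "q \<in> U" by auto
        show ?case
          using cotM_local_triv(2)[OF \<kappa> q(1) c] e(1)[OF q(2) \<tau>\<sigma>(2), of i]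
          by (auto simp: \<Psi>_def differential_apply TM_triv_def intro!: sum.cong)
      qed
    qed
  qed
  \<comment> \<open>Conversely the matrix entries are the frame coordinates of the coordinate vector
    with index \<open>l\<close>, which is given by the unit vector \<open>u\<close>.\<close>
  have onto: "smooth_transition A (cotM A) (U, n, \<Psi>) (fst \<kappa>, DIM('e), cotM_triv \<kappa>)" if \<kappa>: "\<kappa> \<in> A" for \<kappa>
    unfolding smooth_transition_iff[OF oU chart_open[OF \<kappa>]]
  proof (intro ballI allI)
    fix c :: "nat \<Rightarrow> real" and l q assume c: "c \<in> Rk n" and q: "q \<in> U \<inter> fst \<kappa>"
    define u where "u = (\<lambda>i::nat. if i = l then 1 else 0 :: real)"
    have "smooth_at A q (\<lambda>q. if l < DIM('e) then \<Sum>j<n. c (\<tau> j) * \<Phi> q (tinv (TM A) (TM_triv \<kappa>) q u) j else 0)"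
    proof (cases "l < DIM('e)")
      case True
      have "smooth_at A q (\<lambda>q. \<Phi> q (tinv (TM A) (TM_triv \<kappa>) q u) j)" for j
        using smooth_triv_transition[OF vector_bundle_TM TM_smooth_triv[OF \<kappa>] st] q Rk_unit[OF True]
        unfolding smooth_transition_iff[OF chart_open[OF \<kappa>] oU] u_def by blast
      with True show ?thesis by (auto intro!: smooth_at_intros)
    qed (simp add: smooth_at_const)
    then show "smooth_at A q (\<lambda>q. cotM_triv \<kappa> q (tinv (cotM A) \<Psi> q c) l)"
    proof (rule smooth_at_cong)
      show "\<forall>\<^sub>F q in nhds q. (if l < DIM('e) then \<Sum>j<n. c (\<tau> j) * \<Phi> q (tinv (TM A) (TM_triv \<kappa>) q u) j else 0) =
          cotM_triv \<kappa> q (tinv (cotM A) \<Psi> q c) l"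
        using eventually_nhds_in_open[OF open_Int[OF oU chart_open[OF \<kappa>]] q]
      proof eventually_elim
        case (elim q)
        then have q: "q \<in> fst \<kappa>" "q \<in> U" by auto
        show ?case
        proof (cases "l < DIM('e)")
          case True
          have "tinv (TM A) (TM_triv \<kappa>) q u = coord_vec A \<kappa> l q"
            using TM_local_triv(2)[OF \<kappa> q(1) Rk_unit[OF True]] True
            by (simp add: u_def sum.delta if_distrib[of "\<lambda>x. x * _"] cong: if_cong)
          then show ?thesis
            using True coord_vec_tangent[OF \<kappa> q(1)] by (simp add: cotM_triv_def tinv'[OF q(2) c] I_def)
        qed (simp add: cotM_triv_def)
      qed
    qed
  qed
  have "smooth_triv A (cotM A) (U, n, \<Psi>)"
    unfolding smooth_triv_def trivs_cotM using lt' into onto by blast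
  moreover have "\<Psi> q ` annihilator A P q = Rk (n - k)" if q: "q \<in> U" for q
  proof (intro equalityI subsetI)
    have mem: "v \<in> P q \<longleftrightarrow> \<Phi> q v \<in> Rk k" if "v \<in> tangent_space A q" for v
      using adapted_mem_iff[OF P t(1) q, of v] that by (simp add: TM_simps)
    {
      fix c assume "c \<in> \<Psi> q ` annihilator A P q"
      then obtain \<alpha> where a: "c = \<Psi> q \<alpha>" "\<And>v. v \<in> P q \<Longrightarrow> \<alpha> v = 0" by (auto simp: annihilator_def)
      have "e j q \<in> P q" if "j < k" for j
        using mem[OF e(1)[OF q]] e(2)[OF q] that kn Rk_unit[OF that] by simp
      then show "c \<in> Rk (n - k)" using a by (auto simp: Rk_def \<Psi>_def \<sigma>_def)
    next
      fix c assume c: "c \<in> Rk (n - k)"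
      then have c': "c \<in> Rk n" using Rk_mono[of "n - k" n] by auto
      have "I q c v = 0" if v: "v \<in> P q" for v
      proof -
        have "v \<in> tangent_space A q" using subbundle_fibre[OF P v] by (simp add: TM_simps)
        with mem v have "\<Phi> q v \<in> Rk k" by blast
        then have "c (\<tau> j) * \<Phi> q v j = 0" for j using c kn by (cases "j < k") (auto simp: Rk_def \<tau>_def)
        then show ?thesis unfolding I_def by (simp only: sum.neutral_const if_cancel)
      qed
      then have "I q c \<in> annihilator A P q" using I[OF q] by (simp add: annihilator_def)
      then show "c \<in> \<Psi> q ` annihilator A P q"
        by (rule image_eqI[where f = "\<Psi> q", OF \<Psi>I[OF q c', symmetric]])
    }
  qed
  ultimately show "\<exists>U n \<Phi> k. p \<in> U \<and> adapted_triv A (cotM A) (annihilator A P) k (U, n, \<Phi>)"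
    using t(2) unfolding adapted_triv_def by (intro exI[of _ U] exI[of _ n] exI[of _ \<Psi>] exI[of _ "n - k"]) simp
qed

section \<open>Partitions of unity and lifting of sections\<close>

text \<open>If the sets \<open>{\<eta>\<^sub>n > 0}\<close> cover the manifold, then the supports of \<open>\<eta>\<^sub>n \<Prod>\<^sub>k\<^sub><\<^sub>n flat (1/(n+1) - \<eta>\<^sub>k)\<close>
  are locally finite: such a function vanishes where \<open>\<eta>\<^sub>m > 1/(n+1)\<close> for some \<open>m < n\<close>.\<close>

lemma partition_of_unity:
  assumes cover: "\<And>p. \<exists>U\<in>\<U>. open U \<and> p \<in> U"
  obtains \<theta> :: "nat \<Rightarrow> 'm \<Rightarrow> real" where "\<And>n. \<theta> n \<in> smooth_funs A"
    "\<And>n. \<exists>U\<in>\<U>. \<exists>K. closed K \<and> K \<subseteq> U \<and> (\<forall>q. q \<notin> K \<longrightarrow> \<theta> n q = 0)"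
    "\<And>p. \<exists>W N. open W \<and> p \<in> W \<and> (\<forall>q\<in>W. (\<forall>n\<ge>N. \<theta> n q = 0) \<and> (\<Sum>n<N. \<theta> n q) = 1)"
proof -
  have "\<exists>\<eta> K. \<eta> \<in> smooth_funs A \<and> (\<forall>q. \<eta> q \<ge> 0) \<and> \<eta> p = 1 \<and>
      (\<exists>U\<in>\<U>. closed K \<and> K \<subseteq> U \<and> (\<forall>q. q \<notin> K \<longrightarrow> \<eta> q = 0))" for p
  proof -
    obtain U where U: "U \<in> \<U>" "open U" "p \<in> U" using cover by blast
    obtain \<eta> K where "\<eta> \<in> smooth_funs A" "\<And>q. \<eta> q \<ge> 0" "\<forall>\<^sub>F q in nhds p. \<eta> q = 1"
      "closed K" "K \<subseteq> U" "\<And>q. q \<notin> K \<Longrightarrow> \<eta> q = 0"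
      by (rule bump[OF U(2,3)]) (rule that)
    with U(1) show ?thesis using eventually_nhds_x_imp_x by blast
  qed
  then obtain \<eta> K where \<eta>: "\<And>p. \<eta> p \<in> smooth_funs A" "\<And>p q. \<eta> p q \<ge> 0" "\<And>p. \<eta> p p = 1"
    "\<And>p. \<exists>U\<in>\<U>. closed (K p) \<and> K p \<subseteq> U \<and> (\<forall>q. q \<notin> K p \<longrightarrow> \<eta> p q = 0)" by metis
  have cont: "continuous_on UNIV f" if "f \<in> smooth_funs A" for f :: "'m \<Rightarrow> real"
    using smooth_at_isCont[OF smooth_at_smooth_funs[OF that]] by (simp add: continuous_at_imp_continuous_on)
  have opn: "open {q. r < f q}" if "f \<in> smooth_funs A" for f :: "'m \<Rightarrow> real" and r
    using cont[OF that] by (intro open_Collect_less continuous_on_const)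
  define V where "V p = {q. 0 < \<eta> p q}" for p
  have oV: "\<And>T. T \<in> range V \<Longrightarrow> open T" using opn[OF \<eta>(1)] by (auto simp: V_def)
  \<comment> \<open>Second countability enters here, to select countably many of the sets.\<close>
  obtain F where F: "F \<subseteq> range V" "countable F" "\<Union>F = \<Union>(range V)" using Lindelof[OF oV] by blast
  obtain D where D: "countable D" "F = V ` D"
    using F(1,2) countable_subset_image[of F V UNIV] by auto
  have cov: "\<exists>p\<in>D. 0 < \<eta> p q" for q
  proof -
    have "q \<in> V q" using \<eta>(3)[of q] by (simp add: V_def)
    then have "q \<in> \<Union>F" unfolding F(3) by blast
    then show ?thesis unfolding D(2) by (auto simp: V_def)
  qed
  \<comment> \<open>Members of \<open>D\<close> may be repeated in this sequence, which is harmless: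
    what matters is that the sets where some \<open>\<mu> n\<close> is positive cover.\<close>
  define \<mu> where "\<mu> n = \<eta> (from_nat_into D n)" for n
  have \<mu>: "\<mu> n \<in> smooth_funs A" "\<mu> n q \<ge> 0" for n q using \<eta> by (auto simp: \<mu>_def)
  have \<mu>_cov: "\<exists>n. 0 < \<mu> n q" for q
    using cov[of q] from_nat_into_surj[OF D(1)] unfolding \<mu>_def by metis
  define \<psi> where "\<psi> n q = \<mu> n q * (\<Prod>k<n. flat (1 / (real n + 1) - \<mu> k q))" for n q
  have \<psi>: "smooth_at A p (\<psi> n)" for n p
    unfolding \<psi>_def[abs_def]
    by (intro smooth_at_mult smooth_at_prod smooth_at_compose[OF _ open_UNIV UNIV_I C_inf_on_exp_flat]
        smooth_at_diff smooth_at_const smooth_at_smooth_funs \<mu>(1))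
  have \<psi>_nn: "\<psi> n q \<ge> 0" for n q by (simp add: \<psi>_def \<mu>(2) prod_nonneg flat_nonneg)
  have \<psi>_pos: "\<exists>n. 0 < \<psi> n q" for q
  proof -
    \<comment> \<open>At the least \<open>m\<close> with \<open>\<mu> m q > 0\<close>, every factor
      of the product is \<open>flat (1 / (m + 1))\<close>, hence positive.\<close>
    define m where "m = (LEAST n. 0 < \<mu> n q)"
    have "0 < \<mu> m q" unfolding m_def using \<mu>_cov[of q] by (rule LeastI_ex)
    moreover have "\<mu> k q = 0" if "k < m" for k
      using not_less_Least[of k "\<lambda>n. 0 < \<mu> n q"] that \<mu>(2)[of k q] by (auto simp: m_def)
    ultimately have "0 < \<psi> m q" by (auto simp: \<psi>_def flat_pos_iff intro!: mult_pos_pos prod_pos)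
    then show ?thesis ..
  qed
  have fin: "\<exists>W N. open W \<and> p \<in> W \<and> (\<forall>q\<in>W. \<forall>n\<ge>N. \<psi> n q = 0)" for p
  proof -
    obtain m where m: "0 < \<mu> m p" using \<mu>_cov by blast
    define W where "W = {q. \<mu> m p / 2 < \<mu> m q}"
    obtain N0 where N0: "1 / (real N0 + 1) < \<mu> m p / 2"
      using m nat_approx_posE[of "\<mu> m p / 2"] by (metis Suc_eq_plus1 half_gt_zero of_nat_1 of_nat_add)
    \<comment> \<open>\<open>N0\<close> makes the argument of the factor for \<open>m\<close>
      nonpositive on \<open>W\<close>, and \<open>Suc m\<close> ensures that this factor occurs in
      the product over \<open>k < n\<close>.\<close>
    have "\<psi> n q = 0" if q: "q \<in> W" and n: "n \<ge> max N0 (Suc m)" for q n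
    proof -
      have "1 / (real n + 1) \<le> 1 / (real N0 + 1)" using n by (intro divide_left_mono) auto
      then have "1 / (real n + 1) - \<mu> m q \<le> 0" using N0 q by (simp add: W_def)
      then have "flat (1 / (real n + 1) - \<mu> m q) = 0" by (simp add: flat_eq_0_iff)
      moreover have "m < n" using n by simp
      ultimately show ?thesis by (auto simp: \<psi>_def)
    qed
    moreover have "open W" unfolding W_def by (rule opn[OF \<mu>(1)])
    moreover have "p \<in> W" using m by (simp add: W_def)
    ultimately show ?thesis by blast
  qed
  define S where "S q = (\<Sum>n. \<psi> n q)" for q
  have S_eq: "S q = (\<Sum>n<N. \<psi> n q)" if "\<forall>n\<ge>N. \<psi> n q = 0" for q N
    unfolding S_def using that by (intro suminf_finite) auto
  have S_pos: "S q > 0" for q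
  proof -
    obtain W N where W: "q \<in> W" "\<forall>q\<in>W. \<forall>n\<ge>N. \<psi> n q = 0" using fin[of q] by blast
    obtain m where m: "0 < \<psi> m q" using \<psi>_pos by blast
    then have "m < N" using W by (metis linorder_not_less order_less_irrefl)
    then have "0 < (\<Sum>n<N. \<psi> n q)" using m \<psi>_nn by (intro sum_pos2[of _ m]) auto
    then show ?thesis using S_eq[of N q] W by simp
  qed
  have S_smooth: "smooth_at A p S" for p
  proof -
    obtain W N where W: "open W" "p \<in> W" "\<forall>q\<in>W. \<forall>n\<ge>N. \<psi> n q = 0" using fin[of p] by blast
    have "smooth_at A p (\<lambda>q. \<Sum>n<N. \<psi> n q)" by (intro smooth_at_sum \<psi>)
    then show ?thesis
      by (rule smooth_at_cong) (rule eventually_mono[OF eventually_nhds_in_open[OF W(1,2)]], use S_eq[of N] W(3) in simp)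
  qed
  define \<theta> where "\<theta> n q = \<psi> n q * inverse (S q)" for n q
  show ?thesis
  proof (rule that[of \<theta>])
    show "\<theta> n \<in> smooth_funs A" for n
    proof (rule smooth_funsI)
      show "smooth_at A p (\<theta> n)" for p
        unfolding \<theta>_def[abs_def] using S_pos[of p] by (intro smooth_at_mult smooth_at_inverse \<psi> S_smooth) simp
    qed
    show "\<exists>U\<in>\<U>. \<exists>K. closed K \<and> K \<subseteq> U \<and> (\<forall>q. q \<notin> K \<longrightarrow> \<theta> n q = 0)" for n
    proof -
      define d where "d = from_nat_into D n"
      obtain U where U: "U \<in> \<U>" "closed (K d)" "K d \<subseteq> U" "\<And>q. q \<notin> K d \<Longrightarrow> \<eta> d q = 0"
        using \<eta>(4)[of d] by blast
      then have "\<forall>q. q \<notin> K d \<longrightarrow> \<theta> n q = 0" by (simp add: \<theta>_def \<psi>_def \<mu>_def d_def)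
      with U show ?thesis by blast
    qed
    fix p
    obtain W N where W: "open W" "p \<in> W" "\<forall>q\<in>W. \<forall>n\<ge>N. \<psi> n q = 0" using fin[of p] by blast
    have "(\<Sum>n<N. \<theta> n q) = 1" if "q \<in> W" for q
      using S_eq[of N q] W(3) that S_pos[of q] by (simp add: \<theta>_def sum_distrib_right[symmetric])
    then show "\<exists>W N. open W \<and> p \<in> W \<and> (\<forall>q\<in>W. (\<forall>n\<ge>N. \<theta> n q = 0) \<and> (\<Sum>n<N. \<theta> n q) = 1)"
      using W by (intro exI[of _ W] exI[of _ N]) (simp add: \<theta>_def)
  qed
qed

section \<open>Gluing local lifts of sections of a quotient\<close>

lemma cotM_coset_eq_iff:
  assumes F: "subbundle A (cotM A) F" and a: "\<alpha> \<in> cotangent_space A q" and b: "\<beta> \<in> cotangent_space A q"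
  shows "coset (cotM A) F q \<alpha> = coset (cotM A) F q \<beta> \<longleftrightarrow> (\<lambda>v. \<beta> v - \<alpha> v) \<in> F q"
proof -
  have "coset (cotM A) F q \<alpha> = coset (cotM A) F q \<beta> \<longleftrightarrow> (\<exists>w\<in>F q. \<beta> = (\<lambda>v. \<alpha> v + w v))"
    using coset_eq_iff[OF vector_bundle_cotM F, of \<alpha> q \<beta>] a b by (simp add: cotM_simps)
  also have "\<dots> \<longleftrightarrow> (\<lambda>v. \<beta> v - \<alpha> v) \<in> F q"
  proof
    assume "(\<lambda>v. \<beta> v - \<alpha> v) \<in> F q"
    then show "\<exists>w\<in>F q. \<beta> = (\<lambda>v. \<alpha> v + w v)" by (rule bexI[rotated]) simp
  next
    assume "\<exists>w\<in>F q. \<beta> = (\<lambda>v. \<alpha> v + w v)"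
    then show "(\<lambda>v. \<beta> v - \<alpha> v) \<in> F q" by auto
  qed
  finally show ?thesis .
qed

text \<open>The representatives of a class form an affine space, so local lifts can be averaged with
  weights \<open>\<theta> n\<close> of sum 1. Where \<open>\<theta> n\<close> vanishes any
  representative will do, so \<open>s n\<close> is \<open>\<theta> n\<close> times a representative
  at every point.\<close>

lemma lift_section:
  assumes F: "subbundle A (cotM A) F" and S: "S \<in> smooth_sections A (quotient_bundle A (cotM A) F)"
  obtains \<alpha> where "\<alpha> \<in> one_forms A" "\<And>q. coset (cotM A) F q (\<alpha> q) = S q"
proof -
  note cl = subbundle_closed[OF F, unfolded cotM_simps]
  have "\<exists>U\<in>{U. \<exists>n \<Phi> k. adapted_triv A (cotM A) F k (U, n, \<Phi>)}. open U \<and> p \<in> U" for p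
  proof -
    obtain U n \<Phi> k where t: "adapted_triv A (cotM A) F k (U, n, \<Phi>)" "p \<in> U" by (rule subbundle_cover[OF F])
    then show ?thesis using adapted_trivD(4)[OF t(1)] by blast
  qed
  then obtain \<theta> :: "nat \<Rightarrow> 'm \<Rightarrow> real" where \<theta>: "\<And>n. \<theta> n \<in> smooth_funs A"
    "\<And>n. \<exists>U\<in>{U. \<exists>n \<Phi> k. adapted_triv A (cotM A) F k (U, n, \<Phi>)}. \<exists>K. closed K \<and> K \<subseteq> U \<and> (\<forall>q. q \<notin> K \<longrightarrow> \<theta> n q = 0)"
    "\<And>p. \<exists>W N. open W \<and> p \<in> W \<and> (\<forall>q\<in>W. (\<forall>n\<ge>N. \<theta> n q = 0) \<and> (\<Sum>n<N. \<theta> n q) = 1)"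
    by (rule partition_of_unity) (rule that)
  have Sq: "\<exists>u\<in>cotangent_space A q. coset (cotM A) F q u = S q" for q
    using section_fibre[OF S, of q] by (auto simp: quotient_fields[OF vector_bundle_cotM F] cotM_simps)
  have "\<exists>s\<in>one_forms A. \<forall>q. \<exists>u\<in>cotangent_space A q. coset (cotM A) F q u = S q \<and> s q = (\<lambda>v. \<theta> n q * u v)" for n
  proof -
    obtain U m \<Phi> k K where t: "adapted_triv A (cotM A) F k (U, m, \<Phi>)"
      and K: "closed K" "K \<subseteq> U" "\<And>q. q \<notin> K \<Longrightarrow> \<theta> n q = 0" using \<theta>(2)[of n] by blast
    obtain s where s: "s \<in> one_forms A" "\<And>q. q \<notin> K \<Longrightarrow> s q = vzero (cotM A) q"
      "\<And>q. q \<in> U \<Longrightarrow> \<exists>u\<in>fibre (cotM A) q. coset (cotM A) F q u = S q \<and> s q = vsmul (cotM A) q (\<theta> n q) u"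
      by (rule cutoff_lift[OF vector_bundle_cotM F S t \<theta>(1) K]) (assumption | rule that)+
    have "\<exists>u\<in>cotangent_space A q. coset (cotM A) F q u = S q \<and> s q = (\<lambda>v. \<theta> n q * u v)" for q
    proof (cases "q \<in> U")
      case True
      then show ?thesis using s(3) by (simp add: cotM_simps)
    next
      case False
      then have "s q = (\<lambda>v. 0)" "\<theta> n q = 0" using K s(2) by (auto simp: cotM_simps)
      then show ?thesis using Sq[of q] by simp
    qed
    with s(1) show ?thesis by blast
  qed
  then obtain s where s: "\<And>n. s n \<in> one_forms A"
    "\<And>n q. \<exists>u\<in>cotangent_space A q. coset (cotM A) F q u = S q \<and> s n q = (\<lambda>v. \<theta> n q * u v)" by metis
  define u where "u n q = (SOME u. u \<in> cotangent_space A q \<and> coset (cotM A) F q u = S q \<and> s n q = (\<lambda>v. \<theta> n q * u v))" for n q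
  have "u n q \<in> cotangent_space A q \<and> coset (cotM A) F q (u n q) = S q \<and> s n q = (\<lambda>v. \<theta> n q * u n q v)" for n q
  proof -
    have "\<exists>u. u \<in> cotangent_space A q \<and> coset (cotM A) F q u = S q \<and> s n q = (\<lambda>v. \<theta> n q * u v)"
      using s(2)[of q n] by blast
    from someI_ex[OF this] show ?thesis unfolding u_def .
  qed
  then have u: "\<And>n q. u n q \<in> cotangent_space A q" "\<And>n q. coset (cotM A) F q (u n q) = S q"
    "\<And>n q. s n q = (\<lambda>v. \<theta> n q * u n q v)" by blast+
  \<comment> \<open>Near each point all but finitely many terms vanish, so the series is locally a
    finite sum of smooth forms.\<close>
  define \<alpha> where "\<alpha> q v = (\<Sum>n. s n q v)" for q v
  have \<alpha>_eq: "\<alpha> q v = (\<Sum>n<N. s n q v)" if "\<forall>n\<ge>N. \<theta> n q = 0" for q v N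
    unfolding \<alpha>_def using that by (intro suminf_finite) (auto simp: u(3))
  have "\<alpha> \<in> one_forms A"
  proof (rule formI)
    fix p
    obtain W N where W: "open W" "p \<in> W" "\<forall>q\<in>W. \<forall>n\<ge>N. \<theta> n q = 0" using \<theta>(3)[of p] by blast
    have "\<alpha> p = (\<lambda>v. \<Sum>n<N. \<theta> n p * u n p v)" using \<alpha>_eq[of N p] W by (simp add: u(3) fun_eq_iff)
    then show "\<alpha> p \<in> cotangent_space A p" using cot_sum_closed[of "{..<N}" "\<lambda>n. u n p" p "\<lambda>n. \<theta> n p"] u(1) by simp
  next
    fix X assume X: "X \<in> vector_fields A"
    show "(\<lambda>q. \<alpha> q (X q)) \<in> smooth_funs A"
    proof (rule smooth_funsI)
      fix p
      obtain W N where W: "open W" "p \<in> W" "\<forall>q\<in>W. \<forall>n\<ge>N. \<theta> n q = 0" using \<theta>(3)[of p] by blast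
      have "smooth_at A p (\<lambda>q. \<Sum>n<N. s n q (X q))" by (rule smooth_at_sum) (rule smooth_at_smooth_funs[OF form_smooth[OF s(1) X]])
      then show "smooth_at A p (\<lambda>q. \<alpha> q (X q))"
        by (rule smooth_at_cong)
          (rule eventually_mono[OF eventually_nhds_in_open[OF W(1,2)]], use \<alpha>_eq[of N] W(3) in simp)
    qed
  qed
  moreover have "coset (cotM A) F q (\<alpha> q) = S q" for q
  proof -
    obtain W N where N: "\<forall>n\<ge>N. \<theta> n q = 0" "(\<Sum>n<N. \<theta> n q) = 1" using \<theta>(3)[of q] by blast
    \<comment> \<open>A reference representative: the differences \<open>u n q - u0\<close> lie in
      the vector space \<open>F q\<close>, and since the weights add up to 1 their combination is
      \<open>\<alpha> q - u0\<close>.\<close>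
    define u0 where "u0 = u 0 q"
    have d: "(\<lambda>v. u n q v - u0 v) \<in> F q" for n
      using cotM_coset_eq_iff[OF F u(1)[where n = 0 and q = q] u(1)[where n = n and q = q]] u(2)[where q = q] by (simp add: u0_def)
    have mem: "(\<lambda>v. \<Sum>n<M. \<theta> n q * (u n q v - u0 v)) \<in> F q" for M
    proof (induction M)
      case (Suc M)
      show ?case using cl(2)[OF Suc.IH cl(3)[OF d[of M], of "\<theta> M q"]] by simp
    qed (use cl(1) in simp)
    have eq: "(\<lambda>v. \<Sum>n<N. \<theta> n q * (u n q v - u0 v)) = (\<lambda>v. \<alpha> q v - u0 v)"
      using \<alpha>_eq[OF N(1)] N(2) by (simp add: u(3) right_diff_distrib sum_subtractf sum_distrib_right[symmetric])
    have "(\<lambda>v. \<alpha> q v - u0 v) \<in> F q" using mem[of N] unfolding eq .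
    then show ?thesis
      using cotM_coset_eq_iff[OF F u(1)[where n = 0 and q = q] form_cot[OF \<open>\<alpha> \<in> one_forms A\<close>]] u(2)[where n = 0 and q = q] by (simp add: u0_def)
  qed
  ultimately show ?thesis by (rule that)
qed

end

section \<open>The induced structure on the dual bundle\<close>

context poisson_mfd begin

context
  fixes P :: "'m \<Rightarrow> 'm tvec set"
  assumes hP: "nonholonomic_poisson_submanifold A \<pi> P"
begin

section \<open>The sections of the annihilator as an abelian ideal\<close>

lemma P_subbundle: "subbundle A (TM A) P"
  using hP by (simp add: nonholonomic_poisson_submanifold_def nonholonomic_submanifold_def)

lemmas ann_subbundle = annihilator_subbundle[OF P_subbundle]

lemma sharp_in_P: "\<alpha> \<in> cotangent_space A q \<Longrightarrow> sharp A \<pi> q \<alpha> \<in> P q"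
  using hP unfolding nonholonomic_poisson_submanifold_def by blast

lemma bracket_in_P:
  "\<alpha> \<in> one_forms A \<Longrightarrow> X \<in> vector_fields A \<Longrightarrow> (\<And>q. X q \<in> P q) \<Longrightarrow> lie_bracket A (ham \<alpha>) X q \<in> P q"
  using hP unfolding nonholonomic_poisson_submanifold_def ham_def by blast

lemma ann_iff: "\<alpha> \<in> annihilator A P q \<longleftrightarrow> \<alpha> \<in> cotangent_space A q \<and> (\<forall>v\<in>P q. \<alpha> v = 0)"
  by (simp add: annihilator_def)

lemmas ann_closed = subbundle_closed[OF ann_subbundle, unfolded cotM_simps]

text \<open>By skew symmetry \<open>(\<sharp>\<alpha>) f = \<pi>(\<alpha>, df) = - \<alpha>(\<sharp>
  df)\<close>, and \<open>\<sharp> df\<close> lies in \<open>P\<close>.\<close>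

lemma sharp_ann: "\<alpha> \<in> annihilator A P q \<Longrightarrow> sharp A \<pi> q \<alpha> = (\<lambda>f. 0)"
  using pi_skew[OF differential_cot] sharp(2)[OF differential_cot] sharp_in_P[OF differential_cot]
  by (simp add: ann_iff sharp_apply fun_eq_iff)

lemma ham_ann: "(\<And>q. \<beta> q \<in> annihilator A P q) \<Longrightarrow> ham \<beta> = (\<lambda>q f. 0)"
  unfolding ham_def by (intro ext) (simp add: sharp_ann)

lemma pair_ann:
  assumes a: "\<alpha> \<in> one_forms A" and b: "\<beta> \<in> one_forms A" "\<And>q. \<beta> q \<in> annihilator A P q"
  shows "pair \<alpha> \<beta> = (\<lambda>q. 0)"
  using form_ham[OF a b(1)] b(2) sharp_in_P[OF form_cot[OF a]] by (auto simp: ann_iff ham_def fun_eq_iff)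

lemma lie_bracket_zero_left: "X \<in> vector_fields A \<Longrightarrow> lie_bracket A (\<lambda>q f. 0) X p = (\<lambda>f. 0)"
  using tangent_const[OF vf_tangent] by (simp add: lie_bracket_def fun_eq_iff)

text \<open>The sections of the annihilator form an ideal: \<open>{\<alpha>, \<beta>}\<close> reduces to \<open>L\<^bsub>\<sharp>\<alpha>\<^esub> \<beta>\<close>, which vanishes on \<open>P\<close>
  because \<open>[\<sharp>\<alpha>, X] \<in> P\<close>.\<close>

lemma fb_ann:
  assumes a: "\<alpha> \<in> one_forms A" and b: "\<beta> \<in> one_forms A" "\<And>q. \<beta> q \<in> annihilator A P q"
  shows "fb \<alpha> \<beta> q \<in> annihilator A P q"
  unfolding ann_iff
proof (intro conjI ballI fb_cot a b(1))
  fix v assume "v \<in> P q"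
  \<comment> \<open>The bracket condition on \<open>P\<close> is about fields, so the vector
    \<open>v\<close> is extended to a field with values in \<open>P\<close>.\<close>
  then obtain X where X: "X \<in> vector_fields A" "\<And>q. X q \<in> P q" "X q = v"
    using subbundle_section_through[OF vector_bundle_TM P_subbundle] by metis
  have "\<beta> r (lie_bracket A (ham \<alpha>) X r) = 0" "\<beta> r (X r) = 0" for r
    using b(2) bracket_in_P[OF a X(1,2)] X(2) by (auto simp: ann_iff)
  moreover have "v (\<lambda>q. 0) = 0" using tangent_const[OF vf_tangent[OF X(1)], of q 0] X(3) by simp
  ultimately show "fb \<alpha> \<beta> q v = 0"
    using fb_eval[OF a b(1) X(1), of q] tangent_const[OF vf_tangent[OF ham_vf[OF a]]]
      cot_zero_vec[OF form_cot[OF a]]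
    by (simp add: X(3) ham_ann[OF b(2)] pair_ann[OF a b] lie_bracket_zero_left[OF X(1)])
qed

text \<open>Every term of \<open>fb_eval\<close> contains \<open>\<sharp>\<alpha>\<close>,
  \<open>\<sharp>\<beta>\<close> or \<open>\<pi>(\<alpha>, \<beta>)\<close>, all of which vanish.
  This is what makes the inclusion of the annihilator with zero bracket a morphism.\<close>

lemma fb_ann_ann:
  assumes a: "\<alpha> \<in> one_forms A" "\<And>q. \<alpha> q \<in> annihilator A P q" and b: "\<beta> \<in> one_forms A" "\<And>q. \<beta> q \<in> annihilator A P q"
  shows "fb \<alpha> \<beta> = (\<lambda>q v. 0)"
proof
  fix p
  show "fb \<alpha> \<beta> p = (\<lambda>v. 0)"
  proof (rule form_eqI[OF fb_cot[OF a(1) b(1)] cot_zero])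
    fix Y assume Y: "Y \<in> vector_fields A"
    show "fb \<alpha> \<beta> p (Y p) = 0"
      using fb_eval[OF a(1) b(1) Y, of p] tangent_const[OF vf_tangent[OF Y]]
        cot_zero_vec[OF form_cot[OF a(1)]] cot_zero_vec[OF form_cot[OF b(1)]]
      by (simp add: ham_ann[OF a(2)] ham_ann[OF b(2)] pair_ann[OF a(1) b] lie_bracket_zero_left[OF Y])
  qed
qed

section \<open>Anchor and bracket on the quotient\<close>

abbreviation cs :: "'m \<Rightarrow> 'm covec \<Rightarrow> 'm covec set" where
  "cs \<equiv> coset (cotM A) (annihilator A P)"

abbreviation QB :: "('m, 'm covec set) vbundle" where
  "QB \<equiv> quotient_bundle A (cotM A) (annihilator A P)"

lemmas vector_bundle_QB = vector_bundle_quotient[OF vector_bundle_cotM ann_subbundle]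
lemmas cs_eq_iff = cotM_coset_eq_iff[OF ann_subbundle]
lemmas cs_vadd = quotient_vadd[OF vector_bundle_cotM ann_subbundle, unfolded cotM_simps]
lemmas cs_vsmul = quotient_vsmul[OF vector_bundle_cotM ann_subbundle, unfolded cotM_simps]
lemmas QB_fields = quotient_fields[OF vector_bundle_cotM ann_subbundle, unfolded cotM_simps]
lemmas cs_zero = coset_zero[OF vector_bundle_cotM ann_subbundle, unfolded cotM_simps]
lemmas cs_section = coset_section[OF vector_bundle_cotM ann_subbundle]

text \<open>Two representatives differ by a section \<open>\<delta>\<close> of the annihilator, and
  \<open>fb \<alpha> \<delta>\<close> is again such a section.\<close>

lemma fb_cs_cong_right:
  assumes a: "\<alpha> \<in> one_forms A" and b: "\<beta> \<in> one_forms A" "\<beta>' \<in> one_forms A" and eq: "\<And>q. cs q (\<beta> q) = cs q (\<beta>' q)"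
  shows "cs q (fb \<alpha> \<beta> q) = cs q (fb \<alpha> \<beta>' q)"
proof -
  define \<delta> where "\<delta> = (\<lambda>q v. \<beta>' q v + (- 1) * \<beta> q v)"
  have d: "\<delta> \<in> one_forms A" unfolding \<delta>_def by (intro form_add form_smul[OF smooth_funs_intros(1)] b)
  have da: "\<delta> q \<in> annihilator A P q" for q
    using eq[of q] cs_eq_iff[OF form_cot[OF b(1)] form_cot[OF b(2)]] by (simp add: \<delta>_def)
  have "\<beta>' = (\<lambda>q v. \<beta> q v + \<delta> q v)" by (simp add: \<delta>_def)
  then have "fb \<alpha> \<beta>' = (\<lambda>q v. fb \<alpha> \<beta> q v + fb \<alpha> \<delta> q v)" using fb_add_right[OF a b(1) d] by simp
  then have "(\<lambda>v. fb \<alpha> \<beta>' q v - fb \<alpha> \<beta> q v) \<in> annihilator A P q" using fb_ann[OF a d da] by simp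
  then show ?thesis using cs_eq_iff[OF fb_cot[OF a b(1)] fb_cot[OF a b(2)]] by blast
qed

lemma fb_cs_cong:
  assumes a: "\<alpha> \<in> one_forms A" "\<alpha>' \<in> one_forms A" and b: "\<beta> \<in> one_forms A" "\<beta>' \<in> one_forms A"
    and eq: "\<And>q. cs q (\<alpha> q) = cs q (\<alpha>' q)" "\<And>q. cs q (\<beta> q) = cs q (\<beta>' q)"
  shows "cs q (fb \<alpha> \<beta> q) = cs q (fb \<alpha>' \<beta>' q)"
proof -
  have m: "cs q (\<lambda>v. (- 1) * w v) = vsmul QB q (- 1) (cs q w)" if "w \<in> cotangent_space A q" for w
    using cs_vsmul[OF that] by simp
  have "cs q (fb \<alpha> \<beta>' q) = cs q (fb \<alpha>' \<beta>' q)"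
    unfolding fb_skew[OF b(2) a(1)] fb_skew[OF b(2) a(2)] m[OF fb_cot[OF b(2) a(1)]] m[OF fb_cot[OF b(2) a(2)]]
      fb_cs_cong_right[OF b(2) a eq(1)] ..
  then show ?thesis using fb_cs_cong_right[OF a(1) b eq(2)] by simp
qed

text \<open>An arbitrary choice of a representing one-form; by \<open>fb_cs_cong\<close> the classes
  of brackets do not depend on it.\<close>

definition lift :: "('m \<Rightarrow> 'm covec set) \<Rightarrow> 'm \<Rightarrow> 'm covec" where
  "lift S = (SOME \<alpha>. \<alpha> \<in> one_forms A \<and> (\<forall>q. cs q (\<alpha> q) = S q))"

lemma lift:
  assumes "S \<in> smooth_sections A QB"
  shows "lift S \<in> one_forms A" "cs q (lift S q) = S q"
proof -
  obtain \<alpha> where "\<alpha> \<in> one_forms A" "\<And>q. cs q (\<alpha> q) = S q" using lift_section[OF ann_subbundle assms] by blast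
  then have "\<exists>\<alpha>. \<alpha> \<in> one_forms A \<and> (\<forall>q. cs q (\<alpha> q) = S q)" by blast
  from someI_ex[OF this] show "lift S \<in> one_forms A" "cs q (lift S q) = S q" unfolding lift_def by blast+
qed

definition rhoQ :: "'m \<Rightarrow> 'm covec set \<Rightarrow> 'm tvec" where
  "rhoQ q C = sharp A \<pi> q (SOME u. u \<in> C)"

definition brQ :: "('m \<Rightarrow> 'm covec set) \<Rightarrow> ('m \<Rightarrow> 'm covec set) \<Rightarrow> 'm \<Rightarrow> 'm covec set" where
  "brQ S T q = cs q (fb (lift S) (lift T) q)"

text \<open>Elements of one class differ by a covector of the annihilator, which
  \<open>sharp\<close> maps to 0.\<close>

lemma rhoQ_cs:
  assumes u: "u \<in> cotangent_space A q"
  shows "rhoQ q (cs q u) = sharp A \<pi> q u"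
proof -
  have "u \<in> cs q u" using coset_self[OF vector_bundle_cotM ann_subbundle] u by (simp add: cotM_simps)
  then have "(SOME v. v \<in> cs q u) \<in> cs q u" by (rule someI[where P = "\<lambda>v. v \<in> cs q u"])
  then obtain w where w: "w \<in> annihilator A P q" "(SOME v. v \<in> cs q u) = (\<lambda>v. u v + w v)"
    by (auto simp: coset_def cotM_simps)
  then show ?thesis using sharp_add[OF u, of w] sharp_ann[OF w(1)] by (simp add: rhoQ_def ann_iff)
qed

lemma brQ_cs:
  assumes s: "s \<in> one_forms A" and t: "t \<in> one_forms A"
  shows "brQ (\<lambda>q. cs q (s q)) (\<lambda>q. cs q (t q)) = (\<lambda>q. cs q (fb s t q))"
proof
  fix q
  note ls = lift[OF cs_section[OF s]] and lt = lift[OF cs_section[OF t]]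
  show "brQ (\<lambda>q. cs q (s q)) (\<lambda>q. cs q (t q)) q = cs q (fb s t q)"
    unfolding brQ_def by (rule fb_cs_cong[OF ls(1) s lt(1) t ls(2) lt(2)])
qed

text \<open>Reduces statements on sections of the quotient to one-forms, on which
  \<open>brQ_cs\<close>, \<open>sadd_cs\<close> and \<open>smul_cs\<close> compute.\<close>

lemma QB_section_cases:
  assumes "S \<in> smooth_sections A QB"
  obtains \<alpha> where "\<alpha> \<in> one_forms A" "S = (\<lambda>q. cs q (\<alpha> q))"
  using lift[OF assms] by (metis ext)

lemma sadd_cs:
  "\<alpha> \<in> one_forms A \<Longrightarrow> \<beta> \<in> one_forms A \<Longrightarrow>
    sadd QB (\<lambda>q. cs q (\<alpha> q)) (\<lambda>q. cs q (\<beta> q)) = (\<lambda>q. cs q (\<lambda>v. \<alpha> q v + \<beta> q v))"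
  unfolding sadd_def by (intro ext cs_vadd form_cot)

lemma smul_cs:
  "\<alpha> \<in> one_forms A \<Longrightarrow> smul QB f (\<lambda>q. cs q (\<alpha> q)) = (\<lambda>q. cs q (\<lambda>v. f q * \<alpha> q v))"
  unfolding smul_def by (intro ext cs_vsmul form_cot)

lemma vzero_QB: "vzero QB = (\<lambda>q. cs q (\<lambda>v. 0))"
  by (simp add: QB_fields cs_zero)

lemma induced_QB: "induced_on_quotient A (cotM A) (sharp A \<pi>) (form_bracket A \<pi>) (annihilator A P) rhoQ brQ"
  unfolding induced_on_quotient_def fb_def[symmetric] by (simp add: rhoQ_cs brQ_cs cotM_simps)

lemma bundle_map_rhoQ: "bundle_map A QB (TM A) rhoQ"
proof (rule bundle_mapI[OF vector_bundle_QB vector_bundle_TM])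
  fix q
  show "linear_fibre_map QB (TM A) rhoQ q"
    unfolding linear_fibre_map_def QB_fields(1)
    by (auto simp: rhoQ_cs cs_vadd cs_vsmul cot_plus cot_scale TM_simps sharp(1) sharp_add sharp_smul)
next
  fix S assume "S \<in> smooth_sections A QB"
  then obtain \<alpha> where a: "\<alpha> \<in> one_forms A" "S = (\<lambda>q. cs q (\<alpha> q))" by (rule QB_section_cases)
  have "(\<lambda>q. rhoQ q (S q)) = ham \<alpha>" using a by (simp add: ham_def rhoQ_cs form_cot)
  then show "(\<lambda>q. rhoQ q (S q)) \<in> vector_fields A" using ham_vf[OF a(1)] by simp
qed

lemma rhoQ_section: "\<alpha> \<in> one_forms A \<Longrightarrow> (\<lambda>q. rhoQ q (cs q (\<alpha> q))) = ham \<alpha>"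
  by (simp add: ham_def rhoQ_cs form_cot)

text \<open>Sections lift to one-forms, and each axiom becomes the class of the corresponding
  identity for one-forms; the two conditions on the anchor carry over because \<open>rhoQ\<close> of
  a class is \<open>sharp\<close> of any representative.\<close>

theorem lie_algebroid_QB: "lie_algebroid A QB rhoQ brQ"
  unfolding lie_algebroid_def
proof (intro conjI ballI allI vector_bundle_QB bundle_map_rhoQ)
  fix S T assume S: "S \<in> smooth_sections A QB" and T: "T \<in> smooth_sections A QB"
  obtain s where s: "s \<in> one_forms A" "S = (\<lambda>q. cs q (s q))" using S by (rule QB_section_cases)
  obtain t where t: "t \<in> one_forms A" "T = (\<lambda>q. cs q (t q))" using T by (rule QB_section_cases)
  note f = fb_form[OF s(1) t(1)]
  show "brQ S T \<in> smooth_sections A QB"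
    unfolding s t brQ_cs[OF s(1) t(1)] by (rule cs_section[OF f])
  show "brQ S S = vzero QB"
    unfolding s brQ_cs[OF s(1) s(1)] vzero_QB fb_self[OF s(1)] ..
  show "brQ S T = smul QB (\<lambda>q. - 1) (brQ T S)"
    unfolding s t brQ_cs[OF s(1) t(1)] brQ_cs[OF t(1) s(1)] smul_cs[OF fb_form[OF t(1) s(1)]] fb_skew[OF t(1) s(1)] ..
  show "brQ (smul QB (\<lambda>q. c) S) T = smul QB (\<lambda>q. c) (brQ S T)" for c
  proof -
    have "fb (\<lambda>q v. c * s q v) t = (\<lambda>q v. c * fb s t q v)"
      using fb_leibniz_left[OF t(1) s(1) smooth_funs_intros(1), of c] tangent_const[OF vf_tangent[OF ham_vf[OF t(1)]]] by simp
    then show ?thesis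
      unfolding s t smul_cs[OF s(1)] brQ_cs[OF form_smul[OF smooth_funs_intros(1) s(1)] t(1)] brQ_cs[OF s(1) t(1)] smul_cs[OF f]
      by simp
  qed
  show "brQ S (smul QB h T) = sadd QB (smul QB h (brQ S T)) (smul QB (\<lambda>q. rhoQ q (S q) h) T)"
    if h: "h \<in> smooth_funs A" for h
  proof -
    have sh: "(\<lambda>q. ham s q h) \<in> smooth_funs A" by (rule vf_smooth[OF ham_vf[OF s(1)] h])
    have r: "(\<lambda>q. rhoQ q (cs q (s q)) h) = (\<lambda>q. ham s q h)"
      using rhoQ_section[OF s(1)] by (simp add: fun_eq_iff)
    show ?thesis
      unfolding s t smul_cs[OF t(1)] brQ_cs[OF s(1) form_smul[OF h t(1)]] brQ_cs[OF s(1) t(1)] smul_cs[OF f] r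
        sadd_cs[OF form_smul[OF h f] form_smul[OF sh t(1)]] fb_leibniz[OF s(1) t(1) h] ..
  qed
  show "(\<lambda>q. rhoQ q (brQ S T q)) = lie_bracket A (\<lambda>q. rhoQ q (S q)) (\<lambda>q. rhoQ q (T q))"
    unfolding s t brQ_cs[OF s(1) t(1)] rhoQ_section[OF s(1)] rhoQ_section[OF t(1)] rhoQ_section[OF f]
    by (rule ham_bracket[OF s(1) t(1)])
  fix U assume "U \<in> smooth_sections A QB"
  then obtain u where u: "u \<in> one_forms A" "U = (\<lambda>q. cs q (u q))" by (rule QB_section_cases)
  show "brQ (sadd QB S U) T = sadd QB (brQ S T) (brQ U T)"
    unfolding s t u sadd_cs[OF s(1) u(1)] brQ_cs[OF form_add[OF s(1) u(1)] t(1)] brQ_cs[OF s(1) t(1)] brQ_cs[OF u(1) t(1)]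
      sadd_cs[OF f fb_form[OF u(1) t(1)]] fb_add_left[OF t(1) s(1) u(1)] ..
  note f' = fb_form[OF s(1) fb_form[OF t(1) u(1)]] fb_form[OF t(1) fb_form[OF u(1) s(1)]] fb_form[OF u(1) f]
  show "sadd QB (brQ S (brQ T U)) (sadd QB (brQ T (brQ U S)) (brQ U (brQ S T))) = vzero QB"
    unfolding s t u brQ_cs[OF t(1) u(1)] brQ_cs[OF u(1) s(1)] brQ_cs[OF s(1) t(1)] brQ_cs[OF s(1) fb_form[OF t(1) u(1)]]
      brQ_cs[OF t(1) fb_form[OF u(1) s(1)]] brQ_cs[OF u(1) f] sadd_cs[OF f'(2,3)] sadd_cs[OF f'(1) form_add[OF f'(2,3)]]
      vzero_QB fb_jacobi[OF s(1) t(1) u(1)] ..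
qed

section \<open>The exact sequence and uniqueness of the induced structure\<close>

abbreviation AB :: "('m, 'm covec) vbundle" where
  "AB \<equiv> sub_bundle A (cotM A) (annihilator A P)"

lemmas vector_bundle_AB = vector_bundle_sub_bundle[OF vector_bundle_cotM ann_subbundle]
lemmas AB_sections = smooth_sections_sub_bundle[OF vector_bundle_cotM ann_subbundle]

lemma AB_simps: "fibre AB = annihilator A P" "vadd AB q \<alpha> \<beta> = (\<lambda>v. \<alpha> v + \<beta> v)"
  "vsmul AB q c \<alpha> = (\<lambda>v. c * \<alpha> v)" "vzero AB = (\<lambda>q v. 0)"
  by (simp_all add: sub_bundle_def cotM_def)

lemma bundle_map_AB_zero: "bundle_map A AB (TM A) (\<lambda>q \<alpha>. vzero (TM A) q)"
  by (rule bundle_mapI[OF vector_bundle_AB vector_bundle_TM])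
    (simp_all add: linear_fibre_map_def TM_simps tangent_zero vf_zero)

lemma bundle_map_AB_inclusion: "bundle_map A AB (cotM A) (\<lambda>q \<alpha>. \<alpha>)"
  by (rule bundle_mapI[OF vector_bundle_AB vector_bundle_cotM])
    (simp_all add: linear_fibre_map_def AB_simps cotM_simps AB_sections ann_iff)

lemma lie_algebroid_AB: "lie_algebroid A AB (\<lambda>q \<alpha>. vzero (TM A) q) (\<lambda>s t. vzero (cotM A))"
proof -
  have z: "vzero (cotM A) = (\<lambda>q v. 0)" by (simp add: cotM_def)
  have "(\<lambda>q v. 0) \<in> smooth_sections A AB"
    using form_zero ann_closed(1) by (simp add: AB_sections)
  moreover have "lie_bracket A (\<lambda>q f. 0) (\<lambda>q f. 0) = (\<lambda>q f. 0)" using lie_bracket_zero_left[OF vf_zero] by auto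
  ultimately show ?thesis
    unfolding lie_algebroid_def z
    using vector_bundle_AB bundle_map_AB_zero
    by (simp add: sadd_def smul_def AB_simps TM_simps)
qed

theorem exact_sequence:
  "exact_lie_algebroid_sequence A AB (\<lambda>q \<alpha>. vzero (TM A) q) (\<lambda>s t. vzero (cotM A)) (\<lambda>q \<alpha>. \<alpha>)
     (cotM A) (sharp A \<pi>) (form_bracket A \<pi>) cs QB rhoQ brQ"
  unfolding exact_lie_algebroid_sequence_def
proof (intro conjI allI lie_algebroid_AB lie_algebroid_cotangent lie_algebroid_QB)
  show "lie_algebroid_morphism A AB (\<lambda>q \<alpha>. vzero (TM A) q) (\<lambda>s t. vzero (cotM A)) (cotM A) (sharp A \<pi>) (form_bracket A \<pi>) (\<lambda>q \<alpha>. \<alpha>)"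
    unfolding lie_algebroid_morphism_def fb_def[symmetric]
    using bundle_map_AB_inclusion by (simp add: AB_simps sharp_ann TM_simps AB_sections fb_ann_ann cotM_simps)
  show "lie_algebroid_morphism A (cotM A) (sharp A \<pi>) (form_bracket A \<pi>) QB rhoQ brQ cs"
    unfolding lie_algebroid_morphism_def fb_def[symmetric]
    using bundle_map_coset[OF vector_bundle_cotM ann_subbundle] by (simp add: cotM_simps rhoQ_cs brQ_cs)
  fix q
  show "inj_on (\<lambda>\<alpha>. \<alpha>) (fibre AB q)" by simp
  \<comment> \<open>Exactness in the middle: the zero of the quotient fibre is the annihilator
    itself, as a coset.\<close>
  show "(\<lambda>\<alpha>. \<alpha>) ` fibre AB q = {v \<in> fibre (cotM A) q. cs q v = vzero QB q}"
    using coset_eq_zero_iff[OF vector_bundle_cotM ann_subbundle, of _ q] subbundle_fibre[OF ann_subbundle, of _ q]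
    unfolding AB_simps cotM_simps QB_fields(2) image_ident by blast
  show "cs q ` fibre (cotM A) q = fibre QB q" by (simp add: QB_fields cotM_simps)
qed

text \<open>\<open>induced_on_quotient\<close> prescribes the bracket only for pairs of sections
  that are classes of one-forms; by lifting, these are all pairs of smooth sections.\<close>

lemma induced_unique:
  assumes "induced_on_quotient A (cotM A) (sharp A \<pi>) (form_bracket A \<pi>) (annihilator A P) \<rho>' br'"
  shows "u \<in> fibre QB q \<Longrightarrow> \<rho>' q u = rhoQ q u"
    "S \<in> smooth_sections A QB \<Longrightarrow> T \<in> smooth_sections A QB \<Longrightarrow> br' S T = brQ S T"
proof -
  note ind = assms[unfolded induced_on_quotient_def fb_def[symmetric] cotM_simps]
  show "\<rho>' q u = rhoQ q u" if "u \<in> fibre QB q"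
    using that ind by (auto simp: QB_fields rhoQ_cs)
  assume S: "S \<in> smooth_sections A QB" and T: "T \<in> smooth_sections A QB"
  obtain s where s: "s \<in> one_forms A" "S = (\<lambda>q. cs q (s q))" using S by (rule QB_section_cases)
  obtain t where t: "t \<in> one_forms A" "T = (\<lambda>q. cs q (t q))" using T by (rule QB_section_cases)
  show "br' S T = brQ S T" using ind s t by (simp add: brQ_cs)
qed

end

end

theorem proposition4p1:
  fixes A :: "('m::{t2_space,second_countable_topology}, 'e::euclidean_space) chart set"
    and \<pi> :: "'m \<Rightarrow> 'm covec \<Rightarrow> 'm covec \<Rightarrow> real"
    and P :: "'m \<Rightarrow> 'm tvec set"
  assumes "smooth_manifold A"
    and "poisson A \<pi>"
    and "nonholonomic_poisson_submanifold A \<pi> P"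
  defines "annP \<equiv> annihilator A P"
    and "Q \<equiv> quotient_bundle A (cotM A) (annihilator A P)"
  shows "\<exists>\<rho> br.
     induced_on_quotient A (cotM A) (sharp A \<pi>) (form_bracket A \<pi>) annP \<rho> br \<and>
     lie_algebroid A Q \<rho> br \<and>
     exact_lie_algebroid_sequence A
       (sub_bundle A (cotM A) annP) (\<lambda>q \<alpha>. vzero (TM A) q) (\<lambda>s t. vzero (cotM A))
       (\<lambda>q \<alpha>. \<alpha>)
       (cotM A) (sharp A \<pi>) (form_bracket A \<pi>)
       (coset (cotM A) annP)
       Q \<rho> br \<and>
     (\<forall>\<rho>' br'. induced_on_quotient A (cotM A) (sharp A \<pi>) (form_bracket A \<pi>) annP \<rho>' br' \<longrightarrow>
        (\<forall>q. \<forall>u\<in>fibre Q q. \<rho>' q u = \<rho> q u) \<and>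
        (\<forall>s\<in>smooth_sections A Q. \<forall>t\<in>smooth_sections A Q. br' s t = br s t))"
proof -
  interpret poisson_mfd A \<pi> using assms(1,2) by unfold_locales
  note hP = assms(3)
  show ?thesis unfolding annP_def Q_def
    using induced_QB[OF hP] lie_algebroid_QB[OF hP] exact_sequence[OF hP] induced_unique[OF hP] by blast
qed

end
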